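(* Let $n\ge3$. The tropicalization $\operatorname{trop}(\mathcal{F}l_{\mathrm{short}})$ of the short flag variety equals the union of the cones $$C^S_{F_\bullet,\widehat F_\bullet}=A_S+C_{F_\bullet,\widehat F_\bullet}\times w^S,$$ where $S$ varies over proper subsets of $[n]$ and $F_\bullet$ and $\widehat F_\bullet$ are (not both exceptional) chains of flats in $\mathcal{M}_S$ and $\widehat{\mathcal{M}}_S$ respectively. These cones are in one-to-one correspondence with the pairs $(F_\bullet,\widehat F_\bullet)$ consisting of a chain of flats $F_\bullet$ in $\mathcal{M}_S$ and a chain of flats $\widehat F_\bullet$ in $\widehat{\mathcal{M}}_S$, not both exceptional, where $S$ varies over proper subsets of $[n]$, and the cones in a nonempty stratum of $\operatorname{trop}(\mathcal{F}l_{\mathrm{short}})$ form a fan.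
   Context: $K$ is an algebraically closed field with a nontrivial non-Archimedean valuation. $\overline{\mathbb{R}}=\mathbb{R}\cup\{\infty\}$ with $\oplus=\min,\odot=+$; $\mathbb{TP}^m=(\overline{\mathbb{R}}^{m+1}\setminus\{(\infty,\dots,\infty)\})/\mathbb{R}$, with $\mathbb{R}$ acting by adding a constant. For a multi-projective variety $Z$ with ideal $I$, $\operatorname{trop}(Z)$ is the set of points $w$ of the product of tropical projective spaces such that for every multi-homogeneous $f=\sum c_ux^u\in I$ the minimum $\min_u(\operatorname{val}(c_u)+u\cdot w)$ is $\infty$ or attained at least twice (with $0\cdot\infty=0$). The strata are the subsets with a fixed set of infinite coordinates. $\mathcal{F}l_{\mathrm{short}}=\{(Y,X)\in\mathrm{Gr}(n-2,n)\times\mathrm{Gr}(n-1,n):Y\subseteq X\}\subseteq\mathbb{P}^{\binom{n}{n-2}-1}\times\mathbb{P}^{n-1}$ (Plücker embeddings), so $\operatorname{trop}(\mathcal{F}l_{\mathrm{short}})$ lives in the corresponding product of tropical projective spaces with coordinates indexed by $\binom{[n]}{n-2}$ and $\binom{[n]}{n-1}$. For $S\subset[n]$ (proper): $A_S$ is the subspace of $\mathbb{R}^{\binom{[n]}{n-2}}/\mathbb{R}\times\mathbb{R}^{\binom{[n]}{n-1}}/\mathbb{R}$ spanned by $a_i\times e_{[n]\setminus i}$, $i\notin S$, where $(a_i)_J=|\{i\}\setminus J|$; $w^S=\infty\cdot\sum_{i\in S}e_{[n]\setminus i}$ (i.e. $w^S_I=0$ if $S\subseteq I$, $\infty$ otherwise).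 Let $J$ range over $\binom{[n]}{n-2}$ and put $E_S=\{J:S\subseteq J\}$, $E_{S,0}=\{J:|S\setminus J|=2\}$, $E_{S,a}=\{J:S\setminus J=\{a\}\}$ for $a\in S$, $\widehat E_S=\bigcup_{a\in S}E_{S,a}$. $\mathcal{M}_S$ is the matroid on $E_S$ that is the graphic matroid of the complete graph on vertex set $[n]\setminus S$, with $J$ corresponding to the edge $[n]\setminus J$. $\mathcal{M}_{S,a}$ is the loopless rank-one (uniform) matroid on $E_{S,a}$, and $\widehat{\mathcal{M}}_S=\bigoplus_{a\in S}\mathcal{M}_{S,a}$, with ground set $\widehat E_S$. (These are the summands of the linear matroid of $L^S(X)=\{Y\in\mathrm{Gr}(n-2,n):\mathrm{pr}_S(Y)\subseteq X\}$ for generic $X\in\mathrm{Gr}(n-1,n)$, with $\mathrm{pr}_S$ the projection killing $e_i$ for $i\in S$.) Chains of flats are strictly increasing chains $F_\bullet:F_0\subset\dots\subset F_r\subset E_S$ of flats of $\mathcal{M}_S$ and $\widehat F_\bullet:\widehat F_0\subset\dots\subset\widehat F_s\subset\widehat E_S$ of flats of $\widehat{\mathcal{M}}_S$; in addition the exceptional chains $F_\bullet:F_0=E_S$ and $\widehat F_\bullet:\widehat F_0=\widehat E_S$ are allowed. With $e_F=\sum_{J\in F}e_J$, the cone of a pair is $$C_{F_\bullet,\widehat F_\bullet}=\infty\cdot(e_{E_{S,0}}+e_{F_0}+e_{\widehat F_0})+\operatorname{cone}(e_{F_1},\dots,e_{F_r},e_{\widehat F_1},\dots,e_{\widehat F_s})+\mathbb{R}(1,\dots,1)$$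 (for an exceptional chain there are no corresponding cone generators). Sums of sets are Minkowski sums, and residue classes modulo $\mathbb{R}$ are suppressed. *)

theory Defs
  imports
    "HOL-Analysis.Analysis"
    "HOL-Library.Poly_Mapping"
    "HOL-Computational_Algebra.Polynomial"
    "Jordan_Normal_Form.Determinant"
begin

text \<open>
  The set $[n]$ is a finite linearly ordered type \<open>'n\<close> with $n$ = \<open>CARD('n)\<close>; complements
  $[n] \setminus S$ are then \<open>- S\<close>.  Coordinates are indexed by subsets of $[n]$ of a fixed size.
  To avoid a separate type for each size, all coordinate vectors are indexed by the whole type
  \<open>'n set\<close>, and carry a dummy value at the irrelevant indices: \<open>0\<close> for vectors over a field,
  \<open>\<infinity>\<close> for tropical vectors.
\<close>

definition nonarch_valuation :: "('k::field \<Rightarrow> ereal) \<Rightarrow> bool" where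
  "nonarch_valuation val \<longleftrightarrow>
     (\<forall>x. val x \<noteq> -\<infinity>) \<and>
     (\<forall>x. val x = \<infinity> \<longleftrightarrow> x = 0) \<and>
     (\<forall>x y. val (x * y) = val x + val y) \<and>
     (\<forall>x y. val (x + y) \<ge> min (val x) (val y))"

definition nontrivial_valuation :: "('k::field \<Rightarrow> ereal) \<Rightarrow> bool" where
  "nontrivial_valuation val \<longleftrightarrow> (\<exists>x. x \<noteq> 0 \<and> val x \<noteq> 0)"

text \<open>
  Representatives of the points of the tropical projective space with coordinate set \<open>A\<close>; the
  value \<open>-\<infinity>\<close> of type \<^typ>\<open>ereal\<close> is excluded, and coordinates outside \<open>A\<close> are dummies.
\<close>

definition tp_reps :: "'i set \<Rightarrow> ('i \<Rightarrow> ereal) set" where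
  "tp_reps A = {w. (\<forall>i. w i \<noteq> -\<infinity>) \<and> (\<forall>i. i \<notin> A \<longrightarrow> w i = \<infinity>) \<and> (\<exists>i\<in>A. w i \<noteq> \<infinity>)}"

definition tp_class :: "('i \<Rightarrow> ereal) \<Rightarrow> ('i \<Rightarrow> ereal) set" where
  "tp_class w = {\<lambda>i. w i + ereal c | c :: real. True}"

type_synonym ('i, 'j) tp_point = "('i \<Rightarrow> ereal) set \<times> ('j \<Rightarrow> ereal) set"

definition stratum :: "'i set \<Rightarrow> 'j set \<Rightarrow> 'i set \<Rightarrow> 'j set \<Rightarrow> ('i, 'j) tp_point set" where
  "stratum A B P Q =
     {(tp_class v, tp_class w) | v w.
        v \<in> tp_reps A \<and> w \<in> tp_reps B \<and> {i \<in> A. v i = \<infinity>} = P \<and> {j \<in> B. w j = \<infinity>} = Q}"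

text \<open>
  Polynomials in variables \<open>'v\<close>: finitely supported maps from exponent vectors to coefficients.
  For a product of two projective spaces the variables have type \<open>'i + 'j\<close>.
\<close>

type_synonym ('v, 'k) mvpoly = "('v \<Rightarrow>\<^sub>0 nat) \<Rightarrow>\<^sub>0 'k"

definition mvpoly_eval :: "('v, 'k::comm_ring_1) mvpoly \<Rightarrow> ('v \<Rightarrow> 'k) \<Rightarrow> 'k" where
  "mvpoly_eval f x =
     (\<Sum>u\<in>Poly_Mapping.keys f.
        Poly_Mapping.lookup f u * (\<Prod>v\<in>Poly_Mapping.keys u. x v ^ Poly_Mapping.lookup u v))"

definition coord_ring :: "'i set \<Rightarrow> 'j set \<Rightarrow> ('i + 'j, 'k::comm_ring_1) mvpoly set" where
  "coord_ring A B = {f. \<forall>u\<in>Poly_Mapping.keys f. Poly_Mapping.keys u \<subseteq> A <+> B}"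

definition bihomogeneous :: "('i::finite + 'j::finite, 'k::comm_ring_1) mvpoly \<Rightarrow> bool" where
  "bihomogeneous f \<longleftrightarrow>
     (\<exists>d e. \<forall>u\<in>Poly_Mapping.keys f.
        (\<Sum>i\<in>UNIV. Poly_Mapping.lookup u (Inl i)) = d \<and>
        (\<Sum>j\<in>UNIV. Poly_Mapping.lookup u (Inr j)) = e)"

text \<open>
  A subset \<open>Z\<close> of a product of two projective spaces is given by the set of all pairs of
  homogeneous coordinate vectors of its points.
\<close>

definition vanishing_ideal ::
  "'i set \<Rightarrow> 'j set \<Rightarrow> (('i \<Rightarrow> 'k::comm_ring_1) \<times> ('j \<Rightarrow> 'k)) set \<Rightarrow> ('i + 'j, 'k) mvpoly set" where
  "vanishing_ideal A B Z =
     {f \<in> coord_ring A B. \<forall>(p, q)\<in>Z. mvpoly_eval f (case_sum p q) = 0}"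

text \<open>In \<^typ>\<open>ereal\<close> we have \<open>0 * \<infinity> = 0\<close>.\<close>

definition trop_term ::
  "('k::comm_ring_1 \<Rightarrow> ereal) \<Rightarrow> ('v::finite, 'k) mvpoly \<Rightarrow> ('v \<Rightarrow> ereal) \<Rightarrow> ('v \<Rightarrow>\<^sub>0 nat) \<Rightarrow> ereal" where
  "trop_term val f w u =
     val (Poly_Mapping.lookup f u) + (\<Sum>v\<in>UNIV. ereal (real (Poly_Mapping.lookup u v)) * w v)"

definition trop_vanishes ::
  "('k::comm_ring_1 \<Rightarrow> ereal) \<Rightarrow> ('v::finite, 'k) mvpoly \<Rightarrow> ('v \<Rightarrow> ereal) \<Rightarrow> bool" where
  "trop_vanishes val f w \<longleftrightarrow>
     (let m = (INF u\<in>Poly_Mapping.keys f. trop_term val f w u) in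
        m = \<infinity> \<or>
        (\<exists>u\<in>Poly_Mapping.keys f. \<exists>u'\<in>Poly_Mapping.keys f.
            u \<noteq> u' \<and> trop_term val f w u = m \<and> trop_term val f w u' = m))"

definition trop ::
  "('k::comm_ring_1 \<Rightarrow> ereal) \<Rightarrow> 'i::finite set \<Rightarrow> 'j::finite set \<Rightarrow>
     (('i \<Rightarrow> 'k) \<times> ('j \<Rightarrow> 'k)) set \<Rightarrow> ('i, 'j) tp_point set" where
  "trop val A B Z =
     {(tp_class v, tp_class w) | v w.
        v \<in> tp_reps A \<and> w \<in> tp_reps B \<and>
        (\<forall>f\<in>vanishing_ideal A B Z. bihomogeneous f \<longrightarrow> trop_vanishes val f (case_sum v w))}"

definition hyp2 :: "'n::finite set set" where
  "hyp2 = {J. card J = CARD('n) - 2}"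

definition hyp1 :: "'n::finite set set" where
  "hyp1 = {I. card I = CARD('n) - 1}"

text \<open>
  The maximal minors of the \<open>k\<close> by \<open>n\<close> matrix with rows \<open>bs\<close>, where \<open>k = length bs\<close>.
  The qualified \<^const>\<open>Determinant.det\<close> and \<^const>\<open>Matrix.mat\<close> are those for matrices whose
  dimensions are not types.
\<close>

definition plucker_minors :: "('k::field ^ 'n::{finite,linorder}) list \<Rightarrow> 'n set \<Rightarrow> 'k" where
  "plucker_minors bs J =
     (if card J = length bs
      then Determinant.det (Matrix.mat (length bs) (length bs)
             (\<lambda>(r, c). vec_nth (bs ! r) (sorted_list_of_set J ! c)))
      else 0)"

text \<open>
  All Pluecker coordinate vectors of a linear subspace \<open>Y\<close> of positive dimension: these are
  the minor vectors of all bases, since a change of basis scales by an arbitrary nonzero factor.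
\<close>

definition plucker_vectors ::
  "('k::field ^ 'n::{finite,linorder}) set \<Rightarrow> ('n set \<Rightarrow> 'k) set" where
  "plucker_vectors Y =
     {plucker_minors bs | bs. distinct bs \<and> vec.independent (set bs) \<and> vec.span (set bs) = Y}"

definition Fl_short ::
  "(('n::{finite,linorder} set \<Rightarrow> 'k::field) \<times> ('n set \<Rightarrow> 'k)) set" where
  "Fl_short =
     {(p, q). \<exists>Y X :: ('k ^ 'n::{finite,linorder}) set.
        vec.subspace Y \<and> vec.dim Y = CARD('n) - 2 \<and>
        vec.subspace X \<and> vec.dim X = CARD('n) - 1 \<and>
        Y \<subseteq> X \<and> p \<in> plucker_vectors Y \<and> q \<in> plucker_vectors X}"

record 'e matroid =
  ground :: "'e set"
  indep :: "'e set \<Rightarrow> bool"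

definition matroid_rank :: "'e matroid \<Rightarrow> 'e set \<Rightarrow> nat" where
  "matroid_rank M X = Max (card ` {T. T \<subseteq> X \<and> indep M T})"

definition flat :: "'e matroid \<Rightarrow> 'e set \<Rightarrow> bool" where
  "flat M F \<longleftrightarrow>
     F \<subseteq> ground M \<and> (\<forall>x \<in> ground M - F. matroid_rank M F < matroid_rank M (insert x F))"

definition has_cycle :: "'v set set \<Rightarrow> bool" where
  "has_cycle G \<longleftrightarrow>
     (\<exists>vs. 3 \<le> length vs \<and> distinct vs \<and>
        (\<forall>i < length vs. {vs ! i, vs ! (Suc i mod length vs)} \<in> G))"

text \<open>
  The graphic matroid of a simple graph, where the elements \<open>x \<in> E\<close> correspond bijectively to
  the edges \<open>\<phi> x\<close>.
\<close>

definition graphic_matroid :: "('e \<Rightarrow> 'v set) \<Rightarrow> 'e set \<Rightarrow> 'e matroid" where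
  "graphic_matroid \<phi> E = \<lparr>ground = E, indep = (\<lambda>T. T \<subseteq> E \<and> \<not> has_cycle (\<phi> ` T))\<rparr>"

definition uniform_matroid :: "nat \<Rightarrow> 'e set \<Rightarrow> 'e matroid" where
  "uniform_matroid r E = \<lparr>ground = E, indep = (\<lambda>T. T \<subseteq> E \<and> finite T \<and> card T \<le> r)\<rparr>"

definition direct_sum_matroid :: "'a set \<Rightarrow> ('a \<Rightarrow> 'e matroid) \<Rightarrow> 'e matroid" where
  "direct_sum_matroid I M =
     \<lparr>ground = (\<Union>a\<in>I. ground (M a)),
      indep = (\<lambda>T. T \<subseteq> (\<Union>a\<in>I. ground (M a)) \<and> (\<forall>a\<in>I. indep (M a) (T \<inter> ground (M a))))\<rparr>"

definition E_full :: "'n::finite set \<Rightarrow> 'n set set" where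
  "E_full S = {J \<in> hyp2. S \<subseteq> J}"

definition E_zero :: "'n::finite set \<Rightarrow> 'n set set" where
  "E_zero S = {J \<in> hyp2. card (S - J) = 2}"

definition E_elem :: "'n::finite set \<Rightarrow> 'n \<Rightarrow> 'n set set" where
  "E_elem S a = {J \<in> hyp2. S - J = {a}}"

text \<open>The edges of the complete graph on \<open>- S\<close> are the complements of the elements of \<open>E_full S\<close>.\<close>

lemma bij_betw_E_full_edges:
  assumes "2 \<le> CARD('n::finite)"
  shows "bij_betw uminus (E_full (S :: 'n set)) {e. e \<subseteq> - S \<and> card e = 2}"
proof (rule bij_betwI[where g = uminus])
  have c: "card (- J) = CARD('n) - card J" for J :: "'n set"
    by (simp add: Compl_eq_Diff_UNIV card_Diff_subset)
  show "uminus \<in> E_full S \<rightarrow> {e. e \<subseteq> - S \<and> card e = 2}"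
    using assms c by (auto simp: E_full_def hyp2_def)
  show "uminus \<in> {e. e \<subseteq> - S \<and> card e = 2} \<rightarrow> E_full S"
    using c by (auto simp: E_full_def hyp2_def)
qed auto

definition M_full :: "'n::finite set \<Rightarrow> 'n set matroid" where
  "M_full S = graphic_matroid uminus (E_full S)"

definition M_hat :: "'n::finite set \<Rightarrow> 'n set matroid" where
  "M_hat S = direct_sum_matroid S (\<lambda>a. uniform_matroid 1 (E_elem S a))"

text \<open>
  A chain $F_0 \subset \dots \subset F_r$ is the nonempty list of its members, so $F_0$ is its
  head and $F_1, \dots, F_r$ form its tail.
\<close>

definition exceptional_chain :: "'e matroid \<Rightarrow> 'e set list \<Rightarrow> bool" where
  "exceptional_chain M Fs \<longleftrightarrow> Fs = [ground M]"

definition chain_of_flats :: "'e matroid \<Rightarrow> 'e set list \<Rightarrow> bool" where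
  "chain_of_flats M Fs \<longleftrightarrow>
     (Fs \<noteq> [] \<and> sorted_wrt (\<subset>) Fs \<and> (\<forall>F\<in>set Fs. flat M F \<and> F \<subset> ground M)) \<or>
     exceptional_chain M Fs"

definition ind_vec :: "'i::finite set \<Rightarrow> real ^ 'i" where
  "ind_vec F = (\<chi> i. if i \<in> F then 1 else 0)"

definition inf_vec :: "'i set \<Rightarrow> 'i \<Rightarrow> ereal" where
  "inf_vec F i = (if i \<in> F then \<infinity> else 0)"

definition lin_space :: "'n::finite set \<Rightarrow> ((real ^ 'n set) \<times> (real ^ 'n set)) set" where
  "lin_space S =
     span ((\<lambda>i. (\<chi> J. if J \<in> hyp2 then real (card ({i} - J)) else 0, ind_vec {- {i}})) ` (- S))"

definition w_vec :: "'n::finite set \<Rightarrow> 'n set \<Rightarrow> ereal" where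
  "w_vec S = inf_vec ((\<lambda>i. - {i}) ` S \<union> - hyp1)"

text \<open>
  The index set \<open>- hyp2\<close> accounts for the dummy coordinates.  The convex cone hull of the empty
  set is \<open>{0}\<close>.
\<close>

definition chain_cone ::
  "'n::finite set \<Rightarrow> 'n set set list \<Rightarrow> 'n set set list \<Rightarrow> ('n set \<Rightarrow> ereal) set" where
  "chain_cone S Fs Gs =
     {\<lambda>J. inf_vec (- hyp2 \<union> E_zero S \<union> hd Fs \<union> hd Gs) J + ereal (x $ J) + ereal c | x c.
        x \<in> convex_cone hull (ind_vec ` (set (tl Fs) \<union> set (tl Gs)))}"

definition flag_cone ::
  "'n::finite set \<times> 'n set set list \<times> 'n set set list \<Rightarrow> ('n set, 'n set) tp_point set" where
  "flag_cone = (\<lambda>(S, Fs, Gs).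
     {(tp_class (\<lambda>J. ereal (a $ J) + v J), tp_class (\<lambda>I. ereal (b $ I) + w_vec S I)) | a b v.
        (a, b) \<in> lin_space S \<and> v \<in> chain_cone S Fs Gs})"

definition flag_chain_pairs :: "('n::finite set \<times> 'n set set list \<times> 'n set set list) set" where
  "flag_chain_pairs =
     {(S, Fs, Gs). S \<subset> UNIV \<and>
        chain_of_flats (M_full S) Fs \<and> chain_of_flats (M_hat S) Gs \<and>
        \<not> (exceptional_chain (M_full S) Fs \<and> exceptional_chain (M_hat S) Gs)}"

definition is_fan :: "'a::euclidean_space set set \<Rightarrow> bool" where
  "is_fan \<Sigma> \<longleftrightarrow>
     finite \<Sigma> \<and> \<Sigma> \<noteq> {} \<and>
     (\<forall>C\<in>\<Sigma>. polyhedron C \<and> convex_cone C) \<and>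
     (\<forall>C\<in>\<Sigma>. \<forall>F. F face_of C \<and> F \<noteq> {} \<longrightarrow> F \<in> \<Sigma>) \<and>
     (\<forall>C\<in>\<Sigma>. \<forall>D\<in>\<Sigma>. (C \<inter> D) face_of C \<and> (C \<inter> D) face_of D)"

text \<open>
  A stratum with index sets \<open>P\<close>, \<open>Q\<close> of finite coordinates is
  $\mathbb{R}^P/\mathbb{R} \times \mathbb{R}^Q/\mathbb{R}$.  For a subset \<open>C\<close> of a stratum,
  \<open>finite_part C\<close> is its full preimage in $\mathbb{R}^P \times \mathbb{R}^Q$, the latter
  being embedded as a coordinate subspace (note \<^term>\<open>real_of_ereal \<infinity> = 0\<close>).  Taking preimages
  identifies polyhedral cones and their faces in the quotient with polyhedral cones containing
  $\mathbb{R}(1,\dots,1) \times \mathbb{R}(1,\dots,1)$ and their faces.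
\<close>

definition finite_part ::
  "('i::finite, 'j::finite) tp_point set \<Rightarrow> ((real ^ 'i) \<times> (real ^ 'j)) set" where
  "finite_part C =
     {(\<chi> i. real_of_ereal (v i), \<chi> j. real_of_ereal (w j)) | v w. (tp_class v, tp_class w) \<in> C}"

end

theory Submission
  imports Defs
begin

text \<open>
  Pass to orthogonal complements.  A hyperplane $X$ becomes a point $x$ with coordinates
  $x_i = \pm q_{[n] \setminus i}$, a codimension-two subspace $Y$ becomes a line with Pluecker
  coordinates $P_{ij} = \pm p_{[n] \setminus \{i,j\}}$, and $Y \subseteq X$ says that $x$ lies on
  that line.  Hence $P_{ij} = x_i y_j - x_j y_i$ for a second point $y$.  Throughout, the index
  sets $- \{i\}$ and $- \{i,j\}$ are therefore read as the vertices and edges of a complete graph.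

  The only equations needed are the incidence trinomials
  $\pm P_{jk} x_i \pm P_{ik} x_j \pm P_{ij} x_k$; they give the predicate
  \<open>tropical_incidence\<close>.  On the locus where exactly the $x_i$ with $i \in S$ are $0$, subtract
  from the coordinate of each edge the valuations of those of its ends that lie outside \<open>S\<close>.
  What remains on the edges inside $[n] \setminus S$ is an ultrametric, since there
  $P_{ij} = x_i x_j (z_j - z_i)$ with $z = y / x$; on the edges
  $\{a, j\}$ with $a \in S$ it depends on $a$ only, since there $P_{aj} = - x_j y_a$; and on the
  edges inside $S$ it is infinite.

  These relations suffice (\<open>trop_Fl_short\<close>).  Round all valuations to multiples of a small
  positive value: an ultrametric stays an ultrametric, because rounding is monotone.  An
  ultrametric with values in the value group is realised by points $z_i$ with prescribed
  valuations of the differences (\<open>ultrametric_realisation\<close>); this uses that the residue field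
  is infinite, in the form of \<open>unit_avoiding_residues\<close>.  So every solution of the tropical
  relations is a limit of valuations of points of the variety, and the condition imposed by a
  single polynomial is closed (\<open>trop_vanishes_closed\<close>).

  The combinatorial half says that ultrametrics, and functions constant on the parts of a
  partition, are precisely the functions all of whose superlevel sets are flats of the graphic
  matroid, respectively of the direct sum of rank-one matroids.  Writing such a function as a
  minimum plus a nonnegative combination of indicators of its superlevel sets
  (\<open>superlevel_decomposition\<close>) produces the two chains of flats.  The two minima are independent;
  they are absorbed by the constant $c$ and by the lineality space, whose element
  $\sum_{i \notin S} a_i$ is $2$ on the inner edges and $1$ on the edges leaving $S$.

  The combination can be read off again from the function: the coefficient of a flat is the
  positive part of the jump between its minimum on the flat and its maximum on the complement
  (\<open>gap_of_chain_sum\<close>), a quantity that ignores additive constants.  Hence the generators of a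
  cone, and therefore the cone itself, determine the chains.  Cones with common infinite coordinates share
  their lineality space and behave like the cones over the simplices of a simplicial complex; for
  these, intersections and faces correspond to intersections and subsets of the sets of
  generators (locale \<open>simplicial_fan\<close>).
\<close>

section \<open>Valuations and tropical vanishing\<close>

locale valued_field =
  fixes val :: "'k::field \<Rightarrow> ereal"
  assumes nonarch: "nonarch_valuation val"
begin

lemma val_neq_minus_infty [simp]: "val x \<noteq> -\<infinity>"
  and val_eq_infty_iff [simp]: "val x = \<infinity> \<longleftrightarrow> x = 0"
  and val_mult: "val (x * y) = val x + val y"
  and val_add: "min (val x) (val y) \<le> val (x + y)"
  using nonarch unfolding nonarch_valuation_def by blast+

lemma val_0 [simp]: "val 0 = \<infinity>"
  by simp

lemma val_real: "x \<noteq> 0 \<Longrightarrow> \<exists>r. val x = ereal r"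
  by (cases "val x") auto

lemma val_1 [simp]: "val 1 = 0"
proof -
  obtain r where r: "val 1 = ereal r" using val_real[of 1] by auto
  show ?thesis using val_mult[of 1 1] r by simp
qed

lemma val_minus_1 [simp]: "val (- 1) = 0"
proof -
  obtain r where r: "val (-1) = ereal r" using val_real[of "-1"] by auto
  show ?thesis using val_mult[of "-1" "-1"] r by simp
qed

lemma val_minus [simp]: "val (- x) = val x"
  using val_mult[of "-1" x] by simp

lemma val_diff: "min (val x) (val y) \<le> val (x - y)"
  using val_add[of x "- y"] by simp

lemma val_diff_commute: "val (x - y) = val (y - x)"
  using val_minus[of "x - y"] by (simp del: val_minus)

lemma val_divide:
  assumes "y \<noteq> 0" "val y = ereal r"
  shows "val (x / y) = val x - ereal r"
proof -
  have "val x = val (x / y) + ereal r" using val_mult[of "x / y" y] assms by simp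
  then show ?thesis by (cases "val (x / y)") auto
qed

lemma val_power: "val (x ^ m) = ereal (real m) * val x"
proof (induction m)
  case (Suc m)
  then show ?case by (cases "val x") (auto simp: val_mult field_simps)
qed auto

lemma val_prod: "finite A \<Longrightarrow> val (\<Prod>a\<in>A. f a) = (\<Sum>a\<in>A. val (f a))"
  by (induction A rule: finite_induct) (auto simp: val_mult)

text \<open>
  The strict form of the ultrametric inequality for sums: it shows that a unique term of least
  valuation cannot be cancelled by the other terms.
\<close>

lemma val_sum_greater:
  assumes "finite A" "m \<noteq> \<infinity>" "\<And>a. a \<in> A \<Longrightarrow> m < val (f a)"
  shows "m < val (\<Sum>a\<in>A. f a)"
  using assms(1,3)
proof (induction A rule: finite_induct)
  case empty then show ?case using assms(2) by (cases m) auto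
next
  case (insert a A)
  then have "m < min (val (f a)) (val (sum f A))" by auto
  then have "m < val (f a + sum f A)" using val_add by (rule less_le_trans)
  then show ?case using insert.hyps by simp
qed

lemma val_add_eq:
  assumes "val x < val y"
  shows "val (x + y) = val x"
proof (rule antisym)
  show "val x \<le> val (x + y)" using val_add[of x y] assms by auto
  show "val (x + y) \<le> val x"
    using val_diff[of "x + y" y] assms by (auto simp: min_def split: if_splits)
qed

text \<open>
  Failure to vanish tropically is a system of strict inequalities: one finite term lies strictly
  below all the others.  In this form it is seen to be open, invariant under shifts, and
  incompatible with the vanishing of the polynomial.
\<close>

lemma not_trop_vanishes_iff:
  fixes f :: "('v::finite, 'k) mvpoly"
  shows "\<not> trop_vanishes val f w \<longleftrightarrow>
    (\<exists>u0\<in>Poly_Mapping.keys f. trop_term val f w u0 \<noteq> \<infinity> \<and>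
      (\<forall>u\<in>Poly_Mapping.keys f - {u0}. trop_term val f w u0 < trop_term val f w u))"
    (is "_ = ?R")
proof -
  let ?K = "Poly_Mapping.keys f" and ?t = "trop_term val f w"
  define m where "m = (INF u\<in>?K. ?t u)"
  have m_le: "m \<le> ?t u" if "u \<in> ?K" for u unfolding m_def using that by (rule INF_lower)
  have tv: "trop_vanishes val f w \<longleftrightarrow> m = \<infinity> \<or> (\<exists>u\<in>?K. \<exists>u'\<in>?K. u \<noteq> u' \<and> ?t u = m \<and> ?t u' = m)"
    unfolding trop_vanishes_def m_def Let_def ..
  show ?thesis
  proof
    assume no: "\<not> trop_vanishes val f w"
    then have "m \<noteq> \<infinity>" using tv by simp
    then have "?K \<noteq> {}" unfolding m_def by (auto simp: top_ereal_def)
    have "m \<in> ?t ` ?K"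
      unfolding m_def using \<open>?K \<noteq> {}\<close> by (subst cInf_eq_Min) (auto intro!: Min_in)
    then obtain u0 where u0: "u0 \<in> ?K" "?t u0 = m" by auto
    have "?t u0 < ?t u" if "u \<in> ?K - {u0}" for u
    proof -
      have "?t u \<noteq> m" using no tv u0 that by auto
      then show ?thesis using m_le[of u] u0 that by auto
    qed
    then show ?R using u0 \<open>m \<noteq> \<infinity>\<close> by blast
  next
    assume ?R
    then obtain u0 where u0: "u0 \<in> ?K" "?t u0 \<noteq> \<infinity>" "\<And>u. u \<in> ?K - {u0} \<Longrightarrow> ?t u0 < ?t u"
      by blast
    have le: "?t u0 \<le> ?t u" if "u \<in> ?K" for u
      using u0(3)[of u] that by (cases "u = u0") auto
    have m: "m = ?t u0"
      using le m_le[OF u0(1)] unfolding m_def by (intro antisym INF_greatest) auto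
    have "u = u0" if "u \<in> ?K" "?t u = m" for u
      using u0(3)[of u] that m by (cases "u = u0") auto
    then show "\<not> trop_vanishes val f w" using tv m u0(2) by auto
  qed
qed

lemma trop_term_keys:
  fixes f :: "('v::finite, 'k) mvpoly"
  shows "trop_term val f w u = val (Poly_Mapping.lookup f u) +
    (\<Sum>v\<in>Poly_Mapping.keys u. ereal (real (Poly_Mapping.lookup u v)) * w v)"
proof -
  have "(\<Sum>v\<in>UNIV. ereal (real (Poly_Mapping.lookup u v)) * w v) =
    (\<Sum>v\<in>Poly_Mapping.keys u. ereal (real (Poly_Mapping.lookup u v)) * w v)"
    by (intro sum.mono_neutral_right) (auto simp: in_keys_iff)
  then show ?thesis unfolding trop_term_def by simp
qed

text \<open>
  At the valuations of a point, the tropical terms are the valuations of the terms of the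
  polynomial, so a strict minimum would be the valuation of their sum.  The hypothesis
  speaks of occurring variables only, so that it can hold although the dummy entries of tropical
  vectors are infinite.
\<close>

lemma zero_imp_trop_vanishes:
  fixes f :: "('v::finite, 'k) mvpoly"
  assumes zero: "mvpoly_eval f x = 0"
    and w: "\<And>u v. u \<in> Poly_Mapping.keys f \<Longrightarrow> v \<in> Poly_Mapping.keys u \<Longrightarrow> w v = val (x v)"
  shows "trop_vanishes val f w"
proof (rule ccontr)
  let ?K = "Poly_Mapping.keys f"
  define g where "g u = Poly_Mapping.lookup f u *
    (\<Prod>v\<in>Poly_Mapping.keys u. x v ^ Poly_Mapping.lookup u v)" for u
  have t: "trop_term val f w u = val (g u)" if "u \<in> ?K" for u
    unfolding trop_term_keys g_def using w[OF that]
    by (simp add: val_mult val_prod val_power)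
  assume "\<not> trop_vanishes val f w"
  then obtain u0 where u0: "u0 \<in> ?K" "val (g u0) \<noteq> \<infinity>"
    "\<And>u. u \<in> ?K - {u0} \<Longrightarrow> val (g u0) < val (g u)"
    unfolding not_trop_vanishes_iff using t by auto
  have "val (g u0) < val (\<Sum>u\<in>?K - {u0}. g u)"
    using u0 by (intro val_sum_greater) auto
  moreover have "g u0 + (\<Sum>u\<in>?K - {u0}. g u) = 0"
    using zero sum.remove[OF finite_keys u0(1), of g] unfolding mvpoly_eval_def g_def by simp
  then have "(\<Sum>u\<in>?K - {u0}. g u) = - g u0" by (simp add: eq_neg_iff_add_eq_0 add.commute)
  ultimately show False by simp
qed

lemma ereal_sum_real_or_infty:
  fixes h :: "'v \<Rightarrow> ereal"
  assumes "finite V" "\<And>v. v \<in> V \<Longrightarrow> h v \<noteq> -\<infinity>"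
  shows "sum h V = \<infinity> \<longleftrightarrow> (\<exists>v\<in>V. h v = \<infinity>)"
    "(\<And>v. v \<in> V \<Longrightarrow> h v \<noteq> \<infinity>) \<Longrightarrow> sum h V = ereal (\<Sum>v\<in>V. real_of_ereal (h v))"
proof -
  show "sum h V = \<infinity> \<longleftrightarrow> (\<exists>v\<in>V. h v = \<infinity>)"
    using assms by (subst sum_Pinfty) auto
  assume "\<And>v. v \<in> V \<Longrightarrow> h v \<noteq> \<infinity>"
  then have "(\<Sum>v\<in>V. ereal (real_of_ereal (h v))) = sum h V"
    using assms by (intro sum.cong) (auto simp: ereal_real)
  then show "sum h V = ereal (\<Sum>v\<in>V. real_of_ereal (h v))" by simp
qed

lemma trop_term_cases:
  fixes f :: "('v::finite, 'k) mvpoly"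
  assumes w: "\<And>v. w v \<noteq> -\<infinity>" and u: "u \<in> Poly_Mapping.keys f"
  shows "trop_term val f w u =
    (if \<exists>v\<in>Poly_Mapping.keys u. w v = \<infinity> then \<infinity>
     else ereal (real_of_ereal (val (Poly_Mapping.lookup f u)) +
       (\<Sum>v\<in>Poly_Mapping.keys u. real (Poly_Mapping.lookup u v) * real_of_ereal (w v))))"
proof -
  let ?h = "\<lambda>v. ereal (real (Poly_Mapping.lookup u v)) * w v"
  let ?V = "Poly_Mapping.keys u"
  have pos: "0 < Poly_Mapping.lookup u v" if "v \<in> ?V" for v
    using that by (simp add: in_keys_iff)
  have h: "?h v \<noteq> -\<infinity>" "?h v = \<infinity> \<longleftrightarrow> w v = \<infinity>"
    "real_of_ereal (?h v) = real (Poly_Mapping.lookup u v) * real_of_ereal (w v)" if "v \<in> ?V" for v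
    using w[of v] pos[OF that] by (cases "w v"; simp)+
  obtain r where r: "val (Poly_Mapping.lookup f u) = ereal r"
    using val_real u by (auto simp: in_keys_iff)
  show ?thesis
  proof (cases "\<exists>v\<in>?V. w v = \<infinity>")
    case True
    then have "sum ?h ?V = \<infinity>"
      using ereal_sum_real_or_infty(1)[of ?V ?h] h by auto
    then show ?thesis unfolding trop_term_keys using True r by simp
  next
    case False
    then have "sum ?h ?V = ereal (\<Sum>v\<in>?V. real_of_ereal (?h v))"
      using h by (intro ereal_sum_real_or_infty(2)) auto
    also have "(\<Sum>v\<in>?V. real_of_ereal (?h v))
        = (\<Sum>v\<in>?V. real (Poly_Mapping.lookup u v) * real_of_ereal (w v))"
      using h(3) by (intro sum.cong) auto
    finally show ?thesis unfolding trop_term_keys using False r by simp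
  qed
qed

text \<open>
  The terms that involve an infinite variable are infinite along the whole sequence, and the others
  are affine functions of the finite coordinates.  So a strict minimum at the limit would be strict
  already far out in the sequence.
\<close>

lemma trop_vanishes_closed:
  fixes f :: "('v::finite, 'k) mvpoly"
  assumes w: "\<And>v. w v \<noteq> -\<infinity>" and W: "\<And>n v. W n v \<noteq> -\<infinity>" "\<And>n v. W n v = \<infinity> \<longleftrightarrow> w v = \<infinity>"
    and lim: "\<And>v. w v \<noteq> \<infinity> \<Longrightarrow> (\<lambda>n. real_of_ereal (W n v)) \<longlonglongrightarrow> real_of_ereal (w v)"
    and van: "\<And>n::nat. trop_vanishes val f (W n)"
  shows "trop_vanishes val f w"
proof (rule ccontr)
  let ?K = "Poly_Mapping.keys f"
  define r where "r w u = real_of_ereal (val (Poly_Mapping.lookup f u)) +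
       (\<Sum>v\<in>Poly_Mapping.keys u. real (Poly_Mapping.lookup u v) * real_of_ereal (w v))"
    for w :: "'v \<Rightarrow> ereal" and u
  define fin where "fin u \<longleftrightarrow> (\<forall>v\<in>Poly_Mapping.keys u. w v \<noteq> \<infinity>)"
    for u :: "'v \<Rightarrow>\<^sub>0 nat"
  have t: "trop_term val f w u = (if fin u then ereal (r w u) else \<infinity>)"
    "trop_term val f (W n) u = (if fin u then ereal (r (W n) u) else \<infinity>)" if "u \<in> ?K" for u n
    unfolding trop_term_cases[of w, OF w that] trop_term_cases[of "W n", OF W(1) that] fin_def r_def
    using W(2) by auto
  have rlim: "(\<lambda>n. r (W n) u) \<longlonglongrightarrow> r w u" if "fin u" for u
    unfolding r_def using that
    by (intro tendsto_add tendsto_const tendsto_sum tendsto_mult lim) (auto simp: fin_def)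
  assume "\<not> trop_vanishes val f w"
  then obtain u0 where u0: "u0 \<in> ?K" "trop_term val f w u0 \<noteq> \<infinity>"
    "\<And>u. u \<in> ?K - {u0} \<Longrightarrow> trop_term val f w u0 < trop_term val f w u"
    unfolding not_trop_vanishes_iff by blast
  have f0: "fin u0" using u0 t by (auto split: if_splits)
  have "\<forall>\<^sub>F n in sequentially. \<forall>u\<in>?K - {u0}. trop_term val f (W n) u0 < trop_term val f (W n) u"
  proof (intro eventually_ball_finite ballI)
    fix u assume u: "u \<in> ?K - {u0}"
    show "\<forall>\<^sub>F n in sequentially. trop_term val f (W n) u0 < trop_term val f (W n) u"
    proof (cases "fin u")
      case True
      have "0 < r w u - r w u0" using u0(3)[OF u] t u u0(1) f0 True by auto
      moreover have "(\<lambda>n. r (W n) u - r (W n) u0) \<longlonglongrightarrow> r w u - r w u0"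
        using rlim f0 True by (intro tendsto_intros)
      ultimately have "\<forall>\<^sub>F n in sequentially. 0 < r (W n) u - r (W n) u0"
        by (rule order_tendstoD(1)[rotated])
      then show ?thesis
        by eventually_elim (use t u u0(1) f0 True in auto)
    next
      case False
      then show ?thesis using t u u0(1) f0 by auto
    qed
  qed simp
  then obtain n where "\<forall>u\<in>?K - {u0}. trop_term val f (W n) u0 < trop_term val f (W n) u"
    using eventually_happens'[OF sequentially_bot] by blast
  moreover have "trop_term val f (W n) u0 \<noteq> \<infinity>" using t u0(1) f0 by auto
  ultimately have "\<not> trop_vanishes val f (W n)"
    unfolding not_trop_vanishes_iff using u0(1) by blast
  then show False using van by blast
qed

lemma ereal_mult_add_shift:
  assumes "w \<noteq> -\<infinity>"
  shows "ereal (real m) * (w + ereal c) = ereal (real m) * w + ereal (real m * c)"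
  using assms by (cases w; cases "m = 0") (auto simp: algebra_simps)

text \<open>
  For a bihomogeneous polynomial the shift adds the same constant to every term.
\<close>

lemma trop_vanishes_shift:
  fixes f :: "('i::finite + 'j::finite, 'k) mvpoly"
  assumes bh: "bihomogeneous f" and uv: "\<And>i. u i \<noteq> -\<infinity>" "\<And>j. v j \<noteq> -\<infinity>"
    and van: "trop_vanishes val f (case_sum u v)"
  shows "trop_vanishes val f (case_sum (\<lambda>i. u i + ereal c) (\<lambda>j. v j + ereal c'))"
proof -
  obtain d e where de: "\<And>m. m \<in> Poly_Mapping.keys f \<Longrightarrow>
      (\<Sum>i\<in>UNIV. Poly_Mapping.lookup m (Inl i)) = d \<and> (\<Sum>j\<in>UNIV. Poly_Mapping.lookup m (Inr j)) = e"
    using bh unfolding bihomogeneous_def by blast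
  have split: "(\<Sum>v\<in>UNIV. h v) = (\<Sum>i\<in>UNIV. h (Inl i)) + (\<Sum>j\<in>UNIV. h (Inr j))"
    for h :: "'i + 'j \<Rightarrow> ereal"
    by (subst UNIV_Plus_UNIV[symmetric], subst sum.Plus) auto
  have t: "trop_term val f (case_sum (\<lambda>i. u i + ereal c) (\<lambda>j. v j + ereal c')) m
    = trop_term val f (case_sum u v) m + ereal (real d * c + real e * c')"
    if m: "m \<in> Poly_Mapping.keys f" for m
  proof -
    have "(\<Sum>i\<in>UNIV. ereal (real (Poly_Mapping.lookup m (Inl i)) * c)) = ereal (real d * c)"
      using de[OF m] by (simp add: sum_distrib_right[symmetric] of_nat_sum[symmetric] del: of_nat_sum)
    then have 1: "(\<Sum>i\<in>UNIV. ereal (real (Poly_Mapping.lookup m (Inl i))) * (u i + ereal c))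
        = (\<Sum>i\<in>UNIV. ereal (real (Poly_Mapping.lookup m (Inl i))) * u i) + ereal (real d * c)"
      by (simp only: ereal_mult_add_shift[OF uv(1)] sum.distrib)
    have "(\<Sum>j\<in>UNIV. ereal (real (Poly_Mapping.lookup m (Inr j)) * c')) = ereal (real e * c')"
      using de[OF m] by (simp add: sum_distrib_right[symmetric] of_nat_sum[symmetric] del: of_nat_sum)
    then have 2: "(\<Sum>j\<in>UNIV. ereal (real (Poly_Mapping.lookup m (Inr j))) * (v j + ereal c'))
        = (\<Sum>j\<in>UNIV. ereal (real (Poly_Mapping.lookup m (Inr j))) * v j) + ereal (real e * c')"
      by (simp only: ereal_mult_add_shift[OF uv(2)] sum.distrib)
    show ?thesis
      unfolding trop_term_def split sum.case 1 2 plus_ereal.simps(1)[symmetric]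
      by (simp only: add_ac)
  qed
  have ord: "a + ereal r < b + ereal r \<longleftrightarrow> a < b" "a + ereal r = \<infinity> \<longleftrightarrow> a = \<infinity>" for a b r
    by (cases a; cases b; simp)+
  show ?thesis
  proof (rule ccontr)
    assume "\<not> ?thesis"
    then have "\<not> trop_vanishes val f (case_sum u v)"
      unfolding not_trop_vanishes_iff using t by (auto simp: ord)
    then show False using van by simp
  qed
qed

end

locale alg_closed_valued_field = valued_field val
  for val :: "'k::alg_closed_field \<Rightarrow> ereal"
begin

text \<open>
  This is the infinitude of the residue field, without residues: a root \<open>t\<close> of
  $\prod_{s \in S} (T - s) = 1$ is integral, so the nonnegative valuations of the factors $t - s$ add up
  to $0$.
\<close>

lemma unit_avoiding_residues:
  assumes "finite S" "\<And>s. s \<in> S \<Longrightarrow> 0 \<le> val s"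
  shows "\<exists>t. \<forall>s\<in>S. val (t - s) = 0"
proof (cases "S = {}")
  case False
  define p where "p = (\<Prod>s\<in>S. [:- s, 1:]) - 1"
  have "degree (\<Prod>s\<in>S. [:- s, 1:]) = card S"
    by (subst degree_prod_eq_sum_degree) (auto simp: assms(1))
  moreover have "card S > 0" using False assms(1) by (simp add: card_gt_0_iff)
  ultimately have "degree p > 0"
    unfolding p_def by (metis degree_1 degree_add_eq_left degree_minus diff_conv_add_uminus)
  then obtain t where "poly p t = 0" using alg_closed_imp_poly_has_root by blast
  then have t: "(\<Prod>s\<in>S. t - s) = 1"
    unfolding p_def by (simp add: poly_prod)
  then have sum: "(\<Sum>s\<in>S. val (t - s)) = 0"
    using val_prod[OF assms(1), of "\<lambda>s. t - s"] by simp
  have "0 \<le> val t"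
  proof (rule ccontr)
    assume neg: "\<not> 0 \<le> val t"
    have "val (t - s) < 0" if "s \<in> S" for s
    proof -
      have "val t < val (- s)" using neg assms(2)[OF that] by simp
      from val_add_eq[OF this] show ?thesis using neg by simp
    qed
    note neg_all = this
    obtain s where s: "s \<in> S" using False by auto
    have neg_s: "val (t - s) < 0" using neg_all s .
    have rest: "(\<Sum>a\<in>S - {s}. val (t - a)) \<le> 0"
      using neg_all by (intro sum_nonpos less_imp_le) auto
    have "val (t - s) + (\<Sum>a\<in>S - {s}. val (t - a)) \<le> val (t - s) + 0"
      using rest by (rule add_left_mono)
    then have "(\<Sum>s\<in>S. val (t - s)) < 0"
      unfolding sum.remove[OF assms(1) s, of "\<lambda>s. val (t - s)"] using neg_s by auto
    then show False using sum by auto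
  qed
  then have "0 \<le> val (t - s)" if "s \<in> S" for s
    using val_diff[of t s] assms(2)[OF that] by (auto simp: min_def split: if_splits)
  then have "\<forall>s\<in>S. val (t - s) = 0"
    using sum sum_nonneg_eq_0_iff[OF assms(1), of "\<lambda>s. val (t - s)"] by auto
  then show ?thesis by blast
qed auto

text \<open>
  A nontrivial value group is divisible over an algebraically closed field, so it contains
  arbitrarily small positive numbers.
\<close>

lemma small_positive_value:
  assumes "nontrivial_valuation val" "0 < \<epsilon>"
  shows "\<exists>g r. val g = ereal r \<and> 0 < r \<and> r < \<epsilon>"
proof -
  obtain x where x: "x \<noteq> 0" "val x \<noteq> 0" using assms(1) unfolding nontrivial_valuation_def by auto
  obtain r where r: "val x = ereal r" using val_real[OF x(1)] by auto
  have "\<exists>y s. val y = ereal s \<and> 0 < s"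
  proof (cases "0 < r")
    case True then show ?thesis using r by auto
  next
    case False
    have "val (1 / x) = ereal (- r)" using val_divide[OF x(1) r, of 1] by (simp add: zero_ereal_def)
    then show ?thesis using False x(2) r by (intro exI[of _ "1 / x"] exI[of _ "- r"]) auto
  qed
  then obtain y s where y: "val y = ereal s" "0 < s" by auto
  obtain m :: nat where m: "s / \<epsilon> < real m" using reals_Archimedean2 by blast
  have "0 < s / \<epsilon>" using y assms(2) by simp
  then have m0: "m > 0" using m by (cases m) auto
  obtain g where g: "g ^ m = y" using nth_root_exists[OF m0] by auto
  have "ereal (real m) * val g = ereal s" using val_power[of g m] g y by simp
  then obtain r where "val g = ereal r" "real m * r = s"
    using m0 by (cases "val g") auto
  moreover have "0 < r" using \<open>real m * r = s\<close> y(2) m0 by (metis mult_nonneg_nonpos not_less of_nat_0_le_iff)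
  moreover have "r < \<epsilon>"
  proof -
    have "real m * r < real m * \<epsilon>" using m assms(2) \<open>real m * r = s\<close> by (simp add: field_simps)
    then show ?thesis using m0 by (simp add: mult_less_cancel_left)
  qed
  ultimately show ?thesis by blast
qed

text \<open>
  Points are added one at a time.  Let \<open>q\<close> be an existing point closest to the new index \<open>m\<close>, that is,
  one with \<open>d m q\<close> largest.  The new point is
  $z_q + t c$ with \<open>val c = d m q\<close>, where \<open>t\<close> avoids the residues of the points in the same ball;
  all remaining distances are then forced by the ultrametric inequality.
\<close>

lemma ultrametric_realisation:
  assumes "finite R"
    and refl: "\<And>i. i \<in> R \<Longrightarrow> d i i = \<infinity>"
    and sym: "\<And>i j. i \<in> R \<Longrightarrow> j \<in> R \<Longrightarrow> d i j = d j i"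
    and tri: "\<And>i j k. i \<in> R \<Longrightarrow> j \<in> R \<Longrightarrow> k \<in> R \<Longrightarrow> min (d i j) (d j k) \<le> d i k"
    and rng: "\<And>i j. i \<in> R \<Longrightarrow> j \<in> R \<Longrightarrow> d i j \<in> range val"
  shows "\<exists>z. \<forall>i\<in>R. \<forall>j\<in>R. val (z i - z j) = d i j"
  using assms
proof (induction R rule: finite_induct)
  case (insert m R)
  have "\<exists>z. \<forall>i\<in>R. \<forall>j\<in>R. val (z i - z j) = d i j"
    by (rule insert.IH) (use insert.prems in \<open>simp_all\<close>)
  then obtain z where z: "\<And>i j. i \<in> R \<Longrightarrow> j \<in> R \<Longrightarrow> val (z i - z j) = d i j" by blast
  note refl = insert.prems(1) and sym = insert.prems(2) and tri = insert.prems(3)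
    and rng = insert.prems(4)
  have "\<exists>y. \<forall>j\<in>R. val (y - z j) = d m j"
  proof (cases "R = {}")
    case False
    obtain q where q: "q \<in> R" "\<And>j. j \<in> R \<Longrightarrow> d m j \<le> d m q"
    proof -
      have "Max (d m ` R) \<in> d m ` R" using False insert.hyps by simp
      then obtain q where "q \<in> R" "d m q = Max (d m ` R)" by auto
      then show ?thesis using that[of q] insert.hyps by simp
    qed
    have tri1: "min (d m q) (d q j) \<le> d m j" and tri2: "min (d m q) (d m j) \<le> d q j"
      if "j \<in> R" for j
      using tri[of m q j] tri[of q m j] sym[of q m] q(1) that by auto
    show ?thesis
    proof (cases "d m q = \<infinity>")
      case True
      have "val (z q - z j) = d m j" if "j \<in> R" for j
        using tri1[OF that] tri2[OF that] True z[OF q(1) that] by (auto simp: min_def)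
      then show ?thesis by blast
    next
      case D: False
      obtain c where c: "d m q = val c" using rng[of m q] q(1) by auto
      then have c0: "c \<noteq> 0" using D by auto
      obtain r where r: "val c = ereal r" using val_real[OF c0] by auto
      define S where "S = (\<lambda>j. (z j - z q) / c) ` {j \<in> R. d m q \<le> d j q}"
      have "0 \<le> val s" if s: "s \<in> S" for s
      proof -
        obtain j where j: "j \<in> R" "d m q \<le> d j q" "s = (z j - z q) / c"
          using s unfolding S_def by auto
        have "val s = d j q - ereal r" unfolding j(3) val_divide[OF c0 r] z[OF j(1) q(1)] ..
        then show ?thesis using j(2) c r by (cases "d j q") auto
      qed
      then obtain t where t: "\<And>s. s \<in> S \<Longrightarrow> val (t - s) = 0"
        using unit_avoiding_residues[of S] insert.hyps(1) unfolding S_def by auto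
      have "0 \<in> S" unfolding S_def using q(1) refl by (auto intro!: image_eqI[of _ _ q])
      then have t0: "val t = 0" using t[of 0] by simp
      have "val (z q + t * c - z j) = d m j" if j: "j \<in> R" for j
      proof (cases "d m q \<le> d j q")
        case True
        then have "(z j - z q) / c \<in> S" using j unfolding S_def by auto
        moreover have "z q + t * c - z j = (t - (z j - z q) / c) * c"
          using c0 by (simp add: field_simps)
        ultimately have "val (z q + t * c - z j) = d m q" using t c by (simp add: val_mult)
        moreover have "d m q \<le> d m j" using tri1[OF j] True sym[of j q] j q(1) by auto
        ultimately show ?thesis using q(2)[OF j] by auto
      next
        case False
        then have lt: "val (z q - z j) < val (t * c)"
          using z[OF q(1) j] sym[of j q] j q(1) c t0 by (auto simp: val_mult)
        have eq: "z q + t * c - z j = (z q - z j) + t * c" by simp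
        have "val (z q + t * c - z j) = d q j"
          unfolding eq val_add_eq[OF lt] by (rule z[OF q(1) j])
        moreover have "d q j = d m j"
          using tri1[OF j] tri2[OF j] False sym[of j q] j q(1) by (auto simp: min_def split: if_splits)
        ultimately show ?thesis by simp
      qed
      then show ?thesis by blast
    qed
  qed auto
  then obtain y where y: "\<And>j. j \<in> R \<Longrightarrow> val (y - z j) = d m j" by blast
  have "val ((z(m := y)) i - (z(m := y)) j) = d i j" if "i \<in> insert m R" "j \<in> insert m R" for i j
    using that y z insert.hyps(2) refl sym[of m] by (auto simp: val_diff_commute)
  then show ?case by blast
qed auto

end

section \<open>Maximal minors and the incidence relations\<close>

text \<open>
  The minor with an arbitrary list of columns.  Allowing unsorted and repeated columns lets the
  signs of the sorted Pluecker coordinates be treated in a single place, \<open>minor_sort\<close>.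
\<close>

definition minor :: "('k::field ^ 'n) list \<Rightarrow> 'n list \<Rightarrow> 'k" where
  "minor bs js = Determinant.det (Matrix.mat (length bs) (length bs)
     (\<lambda>(r, c). vec_nth (bs ! r) (js ! c)))"

lemma plucker_minors_eq_minor:
  "card J = length bs \<Longrightarrow> plucker_minors bs J = minor bs (sorted_list_of_set J)"
  by (simp add: plucker_minors_def minor_def)

text \<open>
  The sign is that of the sorting permutation of the columns.  It is chosen before the rows, so one
  choice serves all subspaces; this is what makes the incidence relations polynomial identities.
\<close>

lemma minor_sort:
  fixes js :: "'n::{finite,linorder} list"
  assumes "distinct js"
  shows "\<exists>s\<in>{1, -1::'k::field}. \<forall>bs. length bs = length js \<longrightarrow>
           minor bs js = s * plucker_minors bs (set js)"
proof -
  define ks where "ks = sorted_list_of_set (set js)"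
  let ?m = "length js"
  have "mset js = mset ks" unfolding ks_def using assms
    by (metis sorted_list_of_set_sort_remdups distinct_remdups_id mset_sort)
  then obtain p where p: "p permutes {..<length ks}" "permute_list p ks = js"
    by (rule mset_eq_permutation)
  have len: "length ks = ?m" using \<open>mset js = mset ks\<close> by (metis mset_eq_length)
  have nth: "js ! c = ks ! p c" if "c < ?m" for c
    using p that len by (metis permute_list_nth)
  have p': "p permutes {0..<?m}" using p(1) len by (simp add: lessThan_atLeast0)
  have pc: "p c < ?m" if "c < ?m" for c
    using permutes_in_image[OF p', of c] that by simp
  have "minor bs js = signof p * plucker_minors bs (set js)" if bs: "length bs = ?m"
    for bs :: "('k ^ 'n::{finite,linorder}) list"
  proof -
    define A where "A = Matrix.mat ?m ?m (\<lambda>(c, r). vec_nth (bs ! r) (ks ! c))"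
    have A: "A \<in> carrier_mat ?m ?m" by (simp add: A_def)
    have "minor bs js = Determinant.det (transpose_mat (Matrix.mat ?m ?m (\<lambda>(c, r). A $$ (p c, r))))"
      unfolding minor_def bs
      by (intro arg_cong[of _ _ Determinant.det] eq_matI) (auto simp: A_def nth pc)
    also have "\<dots> = Determinant.det (Matrix.mat ?m ?m (\<lambda>(c, r). A $$ (p c, r)))"
      by (rule Determinant.det_transpose[of _ ?m]) simp
    also have "\<dots> = signof p * Determinant.det A"
      by (rule det_permute_rows[OF A p'])
    also have "Determinant.det A = Determinant.det (transpose_mat A)"
      using Determinant.det_transpose[OF A] by simp
    also have "\<dots> = minor bs ks"
      unfolding minor_def bs
      by (intro arg_cong[of _ _ Determinant.det] eq_matI) (auto simp: A_def)
    also have "minor bs ks = plucker_minors bs (set js)"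
      using plucker_minors_eq_minor[of "set js" bs] assms bs by (simp add: ks_def distinct_card)
    finally show ?thesis .
  qed
  note perm = this
  show ?thesis
  proof (intro bexI[of _ "signof p"] allI impI)
    show "signof p \<in> {1, -1::'k}" by (cases p rule: sign_cases) auto
  qed (rule perm)
qed

lemma minor_repeated_column:
  assumes "c < c'" "c' < length bs" "js ! c = js ! c'"
  shows "minor bs js = 0"
proof -
  let ?m = "length bs"
  let ?A = "Matrix.mat ?m ?m (\<lambda>(r, c). vec_nth (bs ! r) (js ! c))"
  have "Determinant.det (transpose_mat ?A) = 0"
    by (rule Determinant.det_identical_rows[of _ ?m c c'])
       (use assms in \<open>auto intro!: eq_vecI\<close>)
  then show ?thesis
    unfolding minor_def using Determinant.det_transpose[of ?A ?m] by simp
qed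

lemma minor_repeated_row:
  assumes "r < r'" "r' < length bs" "bs ! r = bs ! r'"
  shows "minor bs js = 0"
  unfolding minor_def
  by (rule Determinant.det_identical_rows[of _ "length bs" r r'])
     (use assms in \<open>auto intro!: eq_vecI\<close>)

text \<open>
  Replace the last column by the combination $\sum_l x_l b_l$ of all columns, which is zero as the rows
  are orthogonal to \<open>x\<close>; columns that are already present contribute nothing.
\<close>

lemma incidence_relation:
  fixes bs :: "('k::field ^ 'n::finite) list"
  assumes len: "length bs = Suc (length os)"
    and orth: "\<And>b. b \<in> set bs \<Longrightarrow> (\<Sum>l\<in>UNIV. x l * vec_nth b l) = 0"
  shows "(\<Sum>l\<in>- set os. x l * minor bs (os @ [l])) = 0"
proof -
  let ?m = "length bs"
  define A where "A l = Matrix.mat ?m ?m (\<lambda>(r, c). vec_nth (bs ! r) ((os @ [l]) ! c))" for l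
  define C where "C r = cofactor (A undefined) r (length os)" for r
  have A: "A l \<in> carrier_mat ?m ?m" for l by (simp add: A_def)
  have cof: "cofactor (A l) r (length os) = C r" for l r
    unfolding C_def cofactor_def
    by (intro arg_cong[of _ _ "\<lambda>M. _ * Determinant.det M"] eq_matI)
       (auto simp: A_def mat_delete_def nth_append len)
  have exp: "minor bs (os @ [l]) = (\<Sum>r<?m. vec_nth (bs ! r) l * C r)" for l
  proof -
    have "minor bs (os @ [l]) = (\<Sum>r<?m. A l $$ (r, length os) * cofactor (A l) r (length os))"
      using laplace_expansion_column[OF A, of "length os" l] len by (simp add: minor_def A_def)
    then show ?thesis unfolding cof using len by (simp add: A_def)
  qed
  have zero: "minor bs (os @ [l]) = 0" if l: "l \<in> set os" for l
  proof -
    obtain c where "c < length os" "os ! c = l" using l by (auto simp: in_set_conv_nth)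
    then show ?thesis
      using len by (intro minor_repeated_column[of c "length os"]) (auto simp: nth_append)
  qed
  have "(\<Sum>l\<in>- set os. x l * minor bs (os @ [l])) = (\<Sum>l\<in>UNIV. x l * minor bs (os @ [l]))"
    by (intro sum.mono_neutral_left) (auto simp: zero)
  also have "\<dots> = (\<Sum>l\<in>UNIV. \<Sum>r<?m. C r * (x l * vec_nth (bs ! r) l))"
    unfolding exp by (simp add: sum_distrib_left mult_ac)
  also have "\<dots> = (\<Sum>r<?m. C r * (\<Sum>l\<in>UNIV. x l * vec_nth (bs ! r) l))"
    by (subst sum.swap) (simp add: sum_distrib_left)
  also have "\<dots> = 0" using orth by (intro sum.neutral) auto
  finally show ?thesis .
qed

text \<open>
  Expand the determinant of the matrix with rows \<open>v\<close> and \<open>cs\<close> along the row \<open>v\<close>: it vanishes for \<open>v\<close> in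
  the span, and the cofactors are the maximal minors of \<open>cs\<close> up to signs that depend on the column only.
\<close>

lemma hyperplane_equation:
  "\<exists>\<sigma>. (\<forall>l. \<sigma> l \<in> {1, -1::'k::field}) \<and>
     (\<forall>cs. length cs = CARD('n::{finite,linorder}) - 1 \<longrightarrow>
        (\<forall>v\<in>vec.span (set cs). (\<Sum>l\<in>UNIV. \<sigma> l * plucker_minors cs (- {l}) * vec_nth v (l::'n)) = 0))"
proof -
  define L where "L = sorted_list_of_set (UNIV :: 'n set)"
  let ?n = "CARD('n)"
  have L: "distinct L" "set L = UNIV" "length L = ?n"
    unfolding L_def by (auto simp: distinct_card[symmetric])
  define del where "del m = take m L @ drop (Suc m) L" for m
  have del: "distinct (del m)" "set (del m) = - {L ! m}" "length (del m) = ?n - 1" if "m < ?n" for m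
  proof -
    have dec: "L = take m L @ L ! m # drop (Suc m) L"
      using that L(3) by (simp add: id_take_nth_drop)
    then have "distinct (take m L @ L ! m # drop (Suc m) L)" "set (take m L @ L ! m # drop (Suc m) L) = UNIV"
      using L by simp_all
    then show "distinct (del m)" "set (del m) = - {L ! m}" unfolding del_def by auto
    show "length (del m) = ?n - 1" using that L(3) by (simp add: del_def)
  qed
  have "\<forall>l. \<exists>m<?n. L ! m = l" using L by (metis UNIV_I in_set_conv_nth)
  then obtain pos where pos: "\<And>l. pos l < ?n" "\<And>l. L ! pos l = l" by metis
  have pos_nth: "pos (L ! m) = m" if "m < ?n" for m
    using that pos L by (metis nth_eq_iff_index_eq)
  have "\<forall>l. \<exists>s\<in>{1, -1::'k}. \<forall>bs. length bs = length (del (pos l)) \<longrightarrow>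
          minor bs (del (pos l)) = s * plucker_minors bs (- {l})"
  proof
    fix l show "\<exists>s\<in>{1, -1::'k}. \<forall>bs. length bs = length (del (pos l)) \<longrightarrow>
          minor bs (del (pos l)) = s * plucker_minors bs (- {l})"
      using minor_sort[OF del(1)[OF pos(1)[of l]]] unfolding del(2)[OF pos(1)] pos(2) .
  qed
  then obtain s where s: "\<And>l. s l \<in> {1, -1::'k}"
    "\<And>l bs. length bs = ?n - 1 \<Longrightarrow> minor bs (del (pos l)) = s l * plucker_minors bs (- {l})"
    using del(3)[OF pos(1)] by metis
  define \<sigma> where "\<sigma> l = (-1) ^ pos l * s l" for l
  have sg: "\<sigma> l \<in> {1, -1}" for l
    using s(1)[of l] by (cases "even (pos l)") (auto simp: \<sigma>_def)
  have "(\<Sum>l\<in>UNIV. \<sigma> l * plucker_minors cs (- {l}) * vec_nth v l) = 0"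
    if cs: "length cs = ?n - 1" and v: "v \<in> vec.span (set cs)" for cs and v :: "'k ^ 'n::{finite,linorder}"
  proof -
    have n0: "?n > 0" by (simp add: card_gt_0_iff)
    have exp: "minor (v # cs) L = (\<Sum>l\<in>UNIV. \<sigma> l * plucker_minors cs (- {l}) * vec_nth v l)" for v
    proof -
      define A where "A = Matrix.mat ?n ?n (\<lambda>(r, c). vec_nth ((v # cs) ! r) (L ! c))"
      have A: "A \<in> carrier_mat ?n ?n" by (simp add: A_def)
      have len: "length (v # cs) = ?n" using cs n0 by simp
      have cof: "cofactor A 0 m = (-1) ^ m * minor cs (del m)" if "m < ?n" for m
      proof -
        have "mat_delete A 0 m = Matrix.mat (?n - 1) (?n - 1) (\<lambda>(r, c). vec_nth (cs ! r) (del m ! c))"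
          using that L(3)
          by (intro eq_matI) (auto simp: A_def mat_delete_def del_def nth_append min_def)
        then show ?thesis by (simp add: cofactor_def minor_def cs)
      qed
      have "minor (v # cs) L = Determinant.det A"
        unfolding minor_def len A_def ..
      also have "\<dots> = (\<Sum>m<?n. A $$ (0, m) * cofactor A 0 m)"
        by (rule laplace_expansion_row[OF A n0])
      also have "\<dots> = (\<Sum>m<?n. \<sigma> (L ! m) * plucker_minors cs (- {L ! m}) * vec_nth v (L ! m))"
      proof (intro sum.cong refl)
        fix m assume "m \<in> {..<?n}"
        then have m: "m < ?n" by simp
        have "A $$ (0, m) = vec_nth v (L ! m)" using m n0 by (simp add: A_def)
        moreover have "minor cs (del m) = s (L ! m) * plucker_minors cs (- {L ! m})"
          using s(2)[OF cs, of "L ! m"] unfolding pos_nth[OF m] .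
        moreover have "\<sigma> (L ! m) = (-1) ^ m * s (L ! m)"
          unfolding \<sigma>_def pos_nth[OF m] ..
        ultimately show "A $$ (0, m) * cofactor A 0 m =
            \<sigma> (L ! m) * plucker_minors cs (- {L ! m}) * vec_nth v (L ! m)"
          unfolding cof[OF m] by (simp only: mult_ac)
      qed
      also have "\<dots> = (\<Sum>l\<in>UNIV. \<sigma> l * plucker_minors cs (- {l}) * vec_nth v l)"
        by (rule sum.reindex_bij_betw) (use bij_betw_nth[OF L(1)] L in \<open>simp add: lessThan_atLeast0\<close>)
      finally show ?thesis .
    qed
    have base: "minor (v # cs) L = 0" if v: "v \<in> set cs" for v
    proof -
      obtain r where "r < length cs" "cs ! r = v" using v by (auto simp: in_set_conv_nth)
      then show ?thesis by (intro minor_repeated_row[of 0 "Suc r"]) auto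
    qed
    from v show ?thesis
    proof (induction rule: vec.span_induct)
      case base then show ?case
        unfolding vec.subspace_def
        by (auto simp: distrib_left sum.distrib mult.left_commute simp flip: sum_distrib_left)
    next
      case (step v) then show ?case using base exp by metis
    qed
  qed
  then show ?thesis using sg by blast
qed

lemma length_basis:
  fixes bs :: "('k::field ^ 'n::finite) list"
  assumes "distinct bs" "vec.independent (set bs)" "vec.span (set bs) = Y" "vec.dim Y = d"
  shows "length bs = d"
  using assms vec.dim_span_eq_card_independent[OF assms(2)] distinct_card[OF assms(1)] by simp

text \<open>
  The hyperplane $X \supseteq Y$ supplies a vector orthogonal to the rows of a basis of $Y$; the
  relation is \<open>incidence_relation\<close> for it, with all columns outside \<open>{i, j, k}\<close> held fixed.
\<close>

lemma Fl_short_relation: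
  fixes i j k :: "'n::{finite,linorder}"
  assumes dist: "i \<noteq> j" "i \<noteq> k" "j \<noteq> k"
  shows "\<exists>s1\<in>{1,-1}. \<exists>s2\<in>{1,-1}. \<exists>s3\<in>{1,-1::'k::field}. \<forall>(p, q)\<in>Fl_short.
    s1 * (p (- {j, k}) * q (- {i})) + s2 * (p (- {i, k}) * q (- {j})) + s3 * (p (- {i, j}) * q (- {k})) = 0"
proof -
  obtain \<sigma> :: "'n \<Rightarrow> 'k" where \<sigma>: "\<And>l. \<sigma> l \<in> {1, -1}" "\<And>cs v. length cs = CARD('n) - 1 \<Longrightarrow>
      v \<in> vec.span (set cs) \<Longrightarrow> (\<Sum>l\<in>UNIV. \<sigma> l * plucker_minors cs (- {l}) * vec_nth v l) = 0"
    using hyperplane_equation by blast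
  define os where "os = sorted_list_of_set (- {i, j, k})"
  have os: "distinct os" "set os = - {i, j, k}" by (auto simp: os_def)
  have "card {i, j, k} = 3" using dist by simp
  then have len: "length os = CARD('n) - 3" and n3: "3 \<le> CARD('n)"
    using card_mono[of UNIV "{i, j, k}"] by (auto simp: os_def Compl_eq_Diff_UNIV card_Diff_subset)
  have sgn: "\<exists>s\<in>{1,-1::'k}. \<forall>bs. length bs = CARD('n) - 2 \<longrightarrow>
      minor bs (os @ [l]) = s * plucker_minors bs (- ({i, j, k} - {l}))" if "l \<in> {i, j, k}" for l
  proof -
    have "distinct (os @ [l])" "set (os @ [l]) = - ({i, j, k} - {l})"
      "length (os @ [l]) = CARD('n) - 2"
      using os that len n3 by auto
    then show ?thesis using minor_sort[of "os @ [l]"] by metis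
  qed
  have e: "{i, j, k} - {i} = {j, k}" "{i, j, k} - {j} = {i, k}" "{i, j, k} - {k} = {i, j}"
    using dist by auto
  obtain ti where ti: "ti \<in> {1,-1::'k}" "\<And>bs. length bs = CARD('n) - 2 \<Longrightarrow>
      minor bs (os @ [i]) = ti * plucker_minors bs (- {j, k})" using sgn[OF insertI1, unfolded e(1)] by blast
  obtain tj where tj: "tj \<in> {1,-1::'k}" "\<And>bs. length bs = CARD('n) - 2 \<Longrightarrow>
      minor bs (os @ [j]) = tj * plucker_minors bs (- {i, k})" using sgn[OF insertI2[OF insertI1], unfolded e(2)] by blast
  obtain tk where tk: "tk \<in> {1,-1::'k}" "\<And>bs. length bs = CARD('n) - 2 \<Longrightarrow>
      minor bs (os @ [k]) = tk * plucker_minors bs (- {i, j})" using sgn[OF insertI2[OF insertI2[OF insertI1]], unfolded e(3)] by blast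
  have rel: "(\<sigma> i * ti) * (p (- {j, k}) * q (- {i})) + (\<sigma> j * tj) * (p (- {i, k}) * q (- {j}))
      + (\<sigma> k * tk) * (p (- {i, j}) * q (- {k})) = 0" if pq: "(p, q) \<in> Fl_short" for p q
  proof -
    obtain Y X :: "('k ^ 'n::{finite,linorder}) set" and bs cs where
      d: "vec.dim Y = CARD('n) - 2" "vec.dim X = CARD('n) - 1" and YX: "Y \<subseteq> X"
      and p: "p = plucker_minors bs" "distinct bs" "vec.independent (set bs)" "vec.span (set bs) = Y"
      and q: "q = plucker_minors cs" "distinct cs" "vec.independent (set cs)" "vec.span (set cs) = X"
      using pq unfolding Fl_short_def plucker_vectors_def by auto
    have lb: "length bs = CARD('n) - 2" and lc: "length cs = CARD('n) - 1"
      using length_basis[OF p(2-4) d(1)] length_basis[OF q(2-4) d(2)] by auto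
    have "b \<in> vec.span (set cs)" if "b \<in> set bs" for b
      using that p(4) q(4) YX vec.span_base by blast
    then have orth: "(\<Sum>l\<in>UNIV. (\<sigma> l * q (- {l})) * vec_nth b l) = 0" if "b \<in> set bs" for b
      using \<sigma>(2)[OF lc] that q(1) by auto
    have "(\<Sum>l\<in>- set os. (\<sigma> l * q (- {l})) * minor bs (os @ [l])) = 0"
      by (rule incidence_relation[OF _ orth]) (use lb len n3 in auto)
    moreover have "- set os = {i, j, k}" using os by auto
    ultimately show ?thesis
      using dist ti(2)[OF lb] tj(2)[OF lb] tk(2)[OF lb] p(1) by (simp add: mult_ac add_ac)
  qed
  have "\<sigma> i * ti \<in> {1, -1}" "\<sigma> j * tj \<in> {1, -1}" "\<sigma> k * tk \<in> {1, -1}"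
    using \<sigma>(1)[of i] \<sigma>(1)[of j] \<sigma>(1)[of k] ti(1) tj(1) tk(1) by auto
  then show ?thesis using rel by blast
qed

text \<open>
  Independence and the value of the minor both hold because the columns in \<open>K\<close> form an identity
  matrix.  This provides a basis with one Pluecker coordinate known without computation.
\<close>

lemma echelon_basis:
  fixes K :: "'n::{finite,linorder} set" and b :: "'n \<Rightarrow> 'k::field ^ 'n::{finite,linorder}"
  assumes b: "\<And>k l. k \<in> K \<Longrightarrow> l \<in> K \<Longrightarrow> vec_nth (b k) l = (if l = k then 1 else 0)"
  defines "bs \<equiv> map b (sorted_list_of_set K)"
  shows "distinct bs" "vec.independent (set bs)" "length bs = card K" "set bs = b ` K"
    "plucker_minors bs K = 1"
proof -
  show len: "length bs = card K" and set: "set bs = b ` K" by (simp_all add: bs_def)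
  have inj: "inj_on b K"
  proof (rule inj_onI)
    fix k l assume kl: "k \<in> K" "l \<in> K" "b k = b l"
    have 1: "vec_nth (b l) l = (if l = k then 1 else 0)" using b[OF kl(1,2)] unfolding kl(3) .
    have 2: "vec_nth (b l) l = 1" using b[OF kl(2,2)] by simp
    show "k = l" using 1 unfolding 2 by (simp split: if_splits)
  qed
  then show "distinct bs" by (simp add: bs_def distinct_map)
  show "vec.independent (set bs)"
  proof
    assume "vec.dependent (set bs)"
    then obtain u where u: "\<exists>v\<in>b ` K. u v \<noteq> 0" "(\<Sum>v\<in>b ` K. u v *s v) = 0"
      unfolding set by (subst (asm) vec.dependent_finite) auto
    then obtain k where k: "k \<in> K" "u (b k) \<noteq> 0" by auto
    have "0 = vec_nth (\<Sum>l\<in>K. u (b l) *s b l) k"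
      using u(2) by (simp add: sum.reindex[OF inj])
    also have "\<dots> = (\<Sum>l\<in>K. if k = l then u (b l) else 0)"
      unfolding sum_component using b k(1) by (intro sum.cong) auto
    also have "\<dots> = u (b k)" using k(1) by simp
    finally show False using k(2) by simp
  qed
  define L where "L = sorted_list_of_set K"
  have L: "distinct L" "set L = K" "length L = card K" by (simp_all add: L_def)
  have "Matrix.mat (card K) (card K) (\<lambda>(r, c). vec_nth (bs ! r) (L ! c)) = 1\<^sub>m (card K)"
  proof (intro eq_matI)
    fix r c assume "r < dim_row (1\<^sub>m (card K) :: 'k mat)" "c < dim_col (1\<^sub>m (card K) :: 'k mat)"
    then have rc: "r < card K" "c < card K" by auto
    then have "L ! r \<in> K" "L ! c \<in> K" using L nth_mem by metis+
    then have "vec_nth (b (L ! r)) (L ! c) = (if L ! c = L ! r then 1 else 0)" by (rule b)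
    moreover have "L ! c = L ! r \<longleftrightarrow> r = c" using L rc by (metis nth_eq_iff_index_eq)
    moreover have "bs ! r = b (L ! r)" using rc L by (simp add: bs_def L_def)
    ultimately show "Matrix.mat (card K) (card K) (\<lambda>(r, c). vec_nth (bs ! r) (L ! c)) $$ (r, c)
        = 1\<^sub>m (card K) $$ (r, c)"
      using rc by simp
  qed auto
  then show "plucker_minors bs K = 1"
    by (simp add: plucker_minors_def len L_def)
qed

context valued_field
begin

lemma val_sign: "s \<in> {1, -1} \<Longrightarrow> val (s * x) = val x"
  by (auto simp: val_mult)

text \<open>
  The flag is the orthogonal complement of the pair: $X = x^\perp$ and $Y = \{x, y\}^\perp$.
  Bases are written down in echelon form.  Instead of computing all minors, one minor of each is known to
  be $1$, and \<open>incidence_relation\<close> for \<open>x\<close> and \<open>y\<close> relates the valuations of the minors at any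
  two edges with a common vertex; this reaches all edges from the known one.
\<close>

lemma flag_of_point_and_line:
  fixes x y :: "'n::{finite,linorder} \<Rightarrow> 'k"
  assumes ind: "x i0 * y j0 - x j0 * y i0 \<noteq> 0"
  shows "\<exists>p q c c'. (p, q) \<in> Fl_short \<and>
    (\<forall>i j. i \<noteq> j \<longrightarrow> val (p (- {i, j})) = val (x i * y j - x j * y i) + ereal c) \<and>
    (\<forall>i. val (q (- {i})) = val (x i) + ereal c')"
proof -
  define P where "P i j = x i * y j - x j * y i" for i j
  have P0: "P i0 j0 \<noteq> 0" and ij0: "i0 \<noteq> j0" using ind by (auto simp: P_def)
  have "x i0 \<noteq> 0 \<or> x j0 \<noteq> 0" using ind by auto
  then obtain m where m: "m \<in> {i0, j0}" "x m \<noteq> 0" by auto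
  have wP: "val (P i j) = val (P j i)" for i j
    unfolding P_def by (metis minus_diff_eq val_minus)
  \<comment> \<open>A basis of the subspace orthogonal to \<open>x\<close> and \<open>y\<close>.  Its entries in the columns \<open>i0\<close> and
    \<open>j0\<close> solve the two orthogonality conditions by Cramer's rule.\<close>
  define b where "b k = (\<chi> l. if l = k then 1 else if l = i0 then (x j0 * y k - x k * y j0) / P i0 j0
      else if l = j0 then (y i0 * x k - x i0 * y k) / P i0 j0 else 0)" for k
  define bs where "bs = map b (sorted_list_of_set (- {i0, j0}))"
  have bK: "vec_nth (b k) l = (if l = k then 1 else 0)" if "k \<in> - {i0, j0}" "l \<in> - {i0, j0}" for k l
    using that by (auto simp: b_def)
  note bs = echelon_basis[of "- {i0, j0}" b, OF bK, folded bs_def]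
  have dot_b: "(\<Sum>l\<in>UNIV. z l * vec_nth (b k) l) = z k + z i0 * ((x j0 * y k - x k * y j0) / P i0 j0)
      + z j0 * ((y i0 * x k - x i0 * y k) / P i0 j0)" if "k \<in> - {i0, j0}" for z k
  proof -
    have "(\<Sum>l\<in>UNIV. z l * vec_nth (b k) l) = (\<Sum>l\<in>{k, i0, j0}. z l * vec_nth (b k) l)"
      by (rule sum.mono_neutral_right) (auto simp: b_def)
    also have "\<dots> = z k + z i0 * ((x j0 * y k - x k * y j0) / P i0 j0)
      + z j0 * ((y i0 * x k - x i0 * y k) / P i0 j0)"
      using that ij0 by (auto simp: b_def)
    finally show ?thesis .
  qed
  have xb: "(\<Sum>l\<in>UNIV. x l * vec_nth v l) = 0" and yb: "(\<Sum>l\<in>UNIV. y l * vec_nth v l) = 0"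
    if v: "v \<in> set bs" for v
  proof -
    obtain k where k: "k \<in> - {i0, j0}" "v = b k" using v bs(4) by auto
    have "P i0 j0 * (x k + x i0 * ((x j0 * y k - x k * y j0) / P i0 j0)
      + x j0 * ((y i0 * x k - x i0 * y k) / P i0 j0)) = 0"
      using P0 by (simp add: distrib_left) (simp add: P_def algebra_simps)
    then show "(\<Sum>l\<in>UNIV. x l * vec_nth v l) = 0" unfolding k(2) dot_b[OF k(1)] using P0 by simp
    have "P i0 j0 * (y k + y i0 * ((x j0 * y k - x k * y j0) / P i0 j0)
      + y j0 * ((y i0 * x k - x i0 * y k) / P i0 j0)) = 0"
      using P0 by (simp add: distrib_left) (simp add: P_def algebra_simps)
    then show "(\<Sum>l\<in>UNIV. y l * vec_nth v l) = 0" unfolding k(2) dot_b[OF k(1)] using P0 by simp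
  qed
  \<comment> \<open>A basis of the hyperplane orthogonal to \<open>x\<close>, with pivots at all indices but \<open>m\<close>.\<close>
  define h where "h k = (\<chi> l. if l = k then 1 else if l = m then - (x k / x m) else 0)" for k
  define hs where "hs = map h (sorted_list_of_set (- {m}))"
  have hK: "vec_nth (h k) l = (if l = k then 1 else 0)" if "k \<in> - {m}" "l \<in> - {m}" for k l
    using that by (auto simp: h_def)
  note hs = echelon_basis[of "- {m}" h, OF hK, folded hs_def]
  have dot_h: "(\<Sum>l\<in>UNIV. x l * vec_nth v l) = 0" if v: "v \<in> set hs" for v
  proof -
    obtain k where k: "k \<noteq> m" "v = h k" using v hs(4) by auto
    have "(\<Sum>l\<in>UNIV. x l * vec_nth (h k) l) = (\<Sum>l\<in>{k, m}. x l * vec_nth (h k) l)"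
      by (rule sum.mono_neutral_right) (auto simp: h_def)
    then show ?thesis using k m(2) by (simp add: h_def)
  qed
  have span: "v \<in> vec.span (set hs)" if v: "(\<Sum>l\<in>UNIV. x l * vec_nth v l) = 0" for v
  proof -
    have "v = (\<Sum>k\<in>- {m}. vec_nth v k *s h k)"
    proof (rule iffD2[OF Finite_Cartesian_Product.vec_eq_iff], rule allI)
      fix l
      have eq: "vec_nth (\<Sum>k\<in>- {m}. vec_nth v k *s h k) l = (\<Sum>k\<in>- {m}. vec_nth v k * vec_nth (h k) l)"
        by (simp add: sum_component)
      show "vec_nth v l = vec_nth (\<Sum>k\<in>- {m}. vec_nth v k *s h k) l"
      proof (cases "l = m")
        case True
        have "(\<Sum>k\<in>- {m}. vec_nth v k * vec_nth (h k) m) = (\<Sum>k\<in>- {m}. - (x k * vec_nth v k) / x m)"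
          by (intro sum.cong) (auto simp: h_def)
        also have "\<dots> = - (\<Sum>k\<in>- {m}. x k * vec_nth v k) / x m"
          by (simp add: sum_divide_distrib sum_negf)
        also have "(\<Sum>k\<in>- {m}. x k * vec_nth v k) = - (x m * vec_nth v m)"
          using v sum.remove[of UNIV m "\<lambda>k. x k * vec_nth v k"]
          by (simp add: Compl_eq_Diff_UNIV eq_neg_iff_add_eq_0 add.commute)
        finally show ?thesis unfolding eq True using m(2) by simp
      next
        case False
        have "(\<Sum>k\<in>- {m}. vec_nth v k * vec_nth (h k) l) = (\<Sum>k\<in>- {m}. if l = k then vec_nth v k else 0)"
          using False by (intro sum.cong) (auto simp: h_def)
        then show ?thesis unfolding eq using False by simp
      qed
    qed
    moreover have "(\<Sum>k\<in>- {m}. vec_nth v k *s h k) \<in> vec.span (set hs)"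
      using hs(4) by (intro vec.span_sum vec.span_scale vec.span_base) auto
    ultimately show ?thesis by simp
  qed
  define p q where "p = plucker_minors bs" and "q = plucker_minors hs"
  have card: "card (- {i0, j0}) = CARD('n) - 2" "card (- {m}) = CARD('n) - 1"
    using ij0 by (auto simp: Compl_eq_Diff_UNIV card_Diff_subset)
  have two: "card {i, j} \<le> CARD('n)" for i j :: 'n by (rule card_mono) auto
  have n2: "2 \<le> CARD('n)" using two[of i0 j0] ij0 by simp
  have lenb: "length bs = CARD('n) - 2" and lenh: "length hs = CARD('n) - 1"
    using bs(3) hs(3) card by auto
  have "vec.span (set bs) \<subseteq> vec.span (set hs)"
    using span xb by (intro vec.span_minimal) auto
  moreover have "vec.dim (vec.span (set bs)) = CARD('n) - 2" "vec.dim (vec.span (set hs)) = CARD('n) - 1"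
    using vec.dim_span_eq_card_independent[OF bs(2)] vec.dim_span_eq_card_independent[OF hs(2)]
      distinct_card[OF bs(1)] distinct_card[OF hs(1)] lenb lenh by auto
  moreover have "p \<in> plucker_vectors (vec.span (set bs))" "q \<in> plucker_vectors (vec.span (set hs))"
    unfolding plucker_vectors_def p_def q_def using bs(1,2) hs(1,2) by blast+
  ultimately have pq: "(p, q) \<in> Fl_short"
    unfolding Fl_short_def mem_Collect_eq prod.case
    using vec.subspace_span by (intro exI conjI)
  \<comment> \<open>The minors at the three edges of a triangle are, up to sign, a vector orthogonal to the
    restrictions of \<open>x\<close> and \<open>y\<close> to its vertices.  Only valuations are tracked from here on, so the
    signs disappear.\<close>
  have D: "\<exists>D1 D2 D3. val D1 = val (p (- {j, k})) \<and> val D2 = val (p (- {i, k})) \<and> val D3 = val (p (- {i, j}))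
      \<and> x i * D1 + x j * D2 + x k * D3 = 0 \<and> y i * D1 + y j * D2 + y k * D3 = 0"
    if d: "i \<noteq> j" "i \<noteq> k" "j \<noteq> k" for i j k
  proof -
    define os where "os = sorted_list_of_set (- {i, j, k})"
    have os: "distinct os" "set os = - {i, j, k}" by (auto simp: os_def)
    have "card {i, j, k} = 3" using d by simp
    then have len: "length os = CARD('n) - 3" and n3: "3 \<le> CARD('n)"
      using card_mono[of UNIV "{i, j, k}"]
      by (auto simp: os_def Compl_eq_Diff_UNIV card_Diff_subset)
    have sgn: "val (minor bs (os @ [l])) = val (p (- ({i, j, k} - {l})))" if l: "l \<in> {i, j, k}" for l
    proof -
      have 1: "distinct (os @ [l])" "set (os @ [l]) = - ({i, j, k} - {l})"
        "length (os @ [l]) = CARD('n) - 2"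
        using os l len n3 by auto
      obtain s where "s \<in> {1, -1::'k}" "minor bs (os @ [l]) = s * p (- ({i, j, k} - {l}))"
        using minor_sort[OF 1(1), where 'k = 'k] lenb unfolding 1(2,3) p_def by blast
      then show ?thesis using val_sign by simp
    qed
    have e: "{i, j, k} - {i} = {j, k}" "{i, j, k} - {j} = {i, k}" "{i, j, k} - {k} = {i, j}"
      using d by auto
    have S: "- set os = {i, j, k}" using os by auto
    have len': "length bs = Suc (length os)" using lenb len n3 by simp
    have rel: "z i * minor bs (os @ [i]) + z j * minor bs (os @ [j]) + z k * minor bs (os @ [k]) = 0"
      if "\<And>v. v \<in> set bs \<Longrightarrow> (\<Sum>l\<in>UNIV. z l * vec_nth v l) = 0" for z
      using incidence_relation[OF len' that] d unfolding S by (simp add: add_ac)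
    show ?thesis
      using sgn[of i] sgn[of j] sgn[of k] rel[OF xb] rel[OF yb] unfolding e by blast
  qed
  have adj: "val (p (- {j, k})) + val (P i k) = val (p (- {i, k})) + val (P j k)"
    if d: "i \<noteq> j" "i \<noteq> k" "j \<noteq> k" for i j k
  proof -
    obtain D1 D2 D3 where D: "val D1 = val (p (- {j, k}))" "val D2 = val (p (- {i, k}))"
      "x i * D1 + x j * D2 + x k * D3 = 0" "y i * D1 + y j * D2 + y k * D3 = 0"
      using D[OF d] by blast
    have "D1 * P i k + D2 * P j k
      = y k * (x i * D1 + x j * D2 + x k * D3) - x k * (y i * D1 + y j * D2 + y k * D3)"
      unfolding P_def by (simp add: algebra_simps)
    also have "\<dots> = 0" using D(3,4) by simp
    finally have "val (D1 * P i k) = val (D2 * P j k)"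
      by (metis add_eq_0_iff val_minus)
    then show ?thesis using D(1,2) by (simp add: val_mult)
  qed
  obtain r where r: "val (P i0 j0) = ereal r" using val_real[OF P0] by auto
  have p0: "val (p (- {i0, j0})) = 0" using bs(5) by (simp add: p_def)
  \<comment> \<open>Division by \<open>P i k\<close> is hidden here, which is why a nonzero edge is needed to pass on.\<close>
  have step: "val (p (- {k, l})) = val (P k l) + ereal (- r)"
    if kl: "k \<noteq> l" and ad: "val (p (- {i, k})) = val (P i k) + ereal (- r)" "P i k \<noteq> 0"
      and i: "i \<noteq> k" "i \<noteq> l" for i k l
  proof -
    have "val (p (- {l, k})) + val (P i k) = val (p (- {i, k})) + val (P l k)"
      using adj[of i l k] kl i by auto
    moreover obtain s where "val (P i k) = ereal s" using val_real[OF ad(2)] by auto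
    ultimately show ?thesis using ad(1) wP[of l k]
      by (cases "val (p (- {k, l}))"; cases "val (P k l)") (auto simp: insert_commute)
  qed
  have base: "val (p (- {i0, j0})) = val (P i0 j0) + ereal (- r)"
    "val (p (- {j0, i0})) = val (P j0 i0) + ereal (- r)"
    using p0 r wP[of i0 j0] by (auto simp: zero_ereal_def insert_commute)
  have touch: "val (p (- {i, k})) = val (P i k) + ereal (- r)" if "i \<in> {i0, j0}" "k \<noteq> i" for i k
  proof (cases "k \<in> {i0, j0}")
    case True then show ?thesis using that base by auto
  next
    case False
    show ?thesis
    proof (cases "i = i0")
      case True
      then show ?thesis using step[of i0 k j0] base(2) P0 wP[of i0 j0] False that ij0
        by (metis insertI1 insert_commute val_eq_infty_iff)
    next
      case i: False
      then have "i = j0" using that by auto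
      then show ?thesis using step[of j0 k i0] base(1) P0 False that ij0
        by (metis insertI1)
    qed
  qed
  have pP: "val (p (- {k, l})) = val (P k l) + ereal (- r)" if kl: "k \<noteq> l" for k l
  proof (cases "k \<in> {i0, j0} \<or> l \<in> {i0, j0}")
    case True
    then show ?thesis using touch[of k l] touch[of l k] kl wP[of k l]
      by (metis insert_commute)
  next
    case False
    then have ne: "i0 \<noteq> k" "i0 \<noteq> l" "j0 \<noteq> k" "j0 \<noteq> l" by auto
    show ?thesis
    proof (cases "P i0 k = 0 \<and> P j0 k = 0")
      case nz: False
      then show ?thesis
        using step[OF kl touch[of i0 k]] step[OF kl touch[of j0 k]] ne by auto
    next
      case z: True
      \<comment> \<open>If both edges from \<open>k\<close> to \<open>i0\<close> and \<open>j0\<close> vanish, then \<open>(x k, y k)\<close> is a multiple of two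
        independent vectors.\<close>
      have vanish: "x k = 0 \<and> y k = 0" if "P i0 k = 0" "P j0 k = 0" for k
      proof -
        have 0: "x k * y j0 - y k * x j0 = 0" "x k * y i0 - y k * x i0 = 0"
          using that unfolding P_def by (simp_all add: algebra_simps)
        have "x k * P i0 j0 = x i0 * (x k * y j0 - y k * x j0) - x j0 * (x k * y i0 - y k * x i0)"
          "y k * P i0 j0 = y i0 * (x k * y j0 - y k * x j0) - y j0 * (x k * y i0 - y k * x i0)"
          unfolding P_def by (simp_all add: algebra_simps)
        then have "x k * P i0 j0 = 0" "y k * P i0 j0 = 0" unfolding 0 by simp_all
        then show ?thesis using P0 by simp
      qed
      have k0: "x k = 0" "y k = 0" using vanish z by auto
      show ?thesis
      proof (cases "P i0 l = 0 \<and> P j0 l = 0")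
        case nz: False
        then have "val (p (- {l, k})) = val (P l k) + ereal (- r)"
          using step[OF kl[symmetric] touch[of i0 l]] step[OF kl[symmetric] touch[of j0 l]] ne by auto
        then show ?thesis using wP[of k l] by (simp add: insert_commute)
      next
        case True
        then have l0: "x l = 0" "y l = 0" using vanish by auto
        obtain D1 D2 D3 where D: "val D1 = val (p (- {k, l}))"
          "x i0 * D1 + x k * D2 + x l * D3 = 0" "y i0 * D1 + y k * D2 + y l * D3 = 0"
          using D[of i0 k l] ne kl by blast
        have "D1 = 0" using D(2,3) k0 l0 P0 unfolding P_def by auto
        then have "val (p (- {k, l})) = \<infinity>" using D(1) by simp
        then show ?thesis using k0 l0 by (simp add: P_def)
      qed
    qed
  qed
  \<comment> \<open>The same argument in one dimension less: any two coordinates of the hyperplane are compared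
    directly.\<close>
  have adj1: "val (x i) + val (q (- {j})) = val (x j) + val (q (- {i}))" if d: "i \<noteq> j" for i j
  proof -
    define os where "os = sorted_list_of_set (- {i, j})"
    have os: "distinct os" "set os = - {i, j}" by (auto simp: os_def)
    have "length os = CARD('n) - 2" using d
      by (auto simp: os_def Compl_eq_Diff_UNIV card_Diff_subset)
    then have len: "length hs = Suc (length os)" using lenh n2 by simp
    have sgn: "val (minor hs (os @ [l])) = val (q (- ({i, j} - {l})))" if l: "l \<in> {i, j}" for l
    proof -
      have 1: "distinct (os @ [l])" "set (os @ [l]) = - ({i, j} - {l})" "length (os @ [l]) = length hs"
        using os l len by auto
      obtain s where "s \<in> {1, -1::'k}" "minor hs (os @ [l]) = s * q (- ({i, j} - {l}))"
        using minor_sort[OF 1(1), where 'k = 'k] unfolding 1(2,3) q_def by blast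
      then show ?thesis using val_sign by simp
    qed
    have S: "- set os = {i, j}" using os by auto
    have "x i * minor hs (os @ [i]) + x j * minor hs (os @ [j]) = 0"
      using incidence_relation[OF len dot_h] d unfolding S by simp
    then have "val (x i * minor hs (os @ [i])) = val (x j * minor hs (os @ [j]))"
      by (metis add_eq_0_iff val_minus)
    moreover have "{i, j} - {i} = {j}" "{i, j} - {j} = {i}" using d by auto
    ultimately show ?thesis using sgn[of i] sgn[of j] by (simp add: val_mult)
  qed
  obtain s where s: "val (x m) = ereal s" using val_real[OF m(2)] by auto
  have q0: "val (q (- {m})) = 0" using hs(5) by (simp add: q_def)
  have qx: "val (q (- {i})) = val (x i) + ereal (- s)" for i
  proof (cases "i = m")
    case True then show ?thesis using q0 s by (simp add: zero_ereal_def)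
  next
    case False
    then show ?thesis using adj1[of m i] s q0
      by (cases "val (q (- {i}))"; cases "val (x i)") auto
  qed
  show ?thesis
    using pq pP qx unfolding P_def by blast
qed

end

section \<open>The tropicalization as a tropical incidence variety\<close>

lemma hyp2_iff:
  assumes "2 \<le> CARD('n::finite)"
  shows "J \<in> hyp2 \<longleftrightarrow> (\<exists>i j :: 'n. i \<noteq> j \<and> J = - {i, j})"
proof -
  have c: "card J = CARD('n) - card (- J)"
    by (metis Compl_eq_Diff_UNIV card_Diff_subset double_compl finite top_greatest)
  have le: "card (- J) \<le> CARD('n)" by (rule card_mono) auto
  have "J \<in> hyp2 \<longleftrightarrow> card (- J) = 2"
    using c le assms by (auto simp: hyp2_def)
  also have "\<dots> \<longleftrightarrow> (\<exists>i j. i \<noteq> j \<and> - J = {i, j})" by (auto simp: card_2_iff)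
  also have "\<dots> \<longleftrightarrow> (\<exists>i j. i \<noteq> j \<and> J = - {i, j})" by (metis double_compl)
  finally show ?thesis .
qed

lemma hyp1_iff: "I \<in> hyp1 \<longleftrightarrow> (\<exists>i :: 'n::finite. I = - {i})"
proof -
  have c: "card I = CARD('n) - card (- I)"
    by (metis Compl_eq_Diff_UNIV card_Diff_subset double_compl finite top_greatest)
  have le: "card (- I) \<le> CARD('n)" by (rule card_mono) auto
  have "card (UNIV :: 'n set) > 0" by (simp add: card_gt_0_iff)
  then have "I \<in> hyp1 \<longleftrightarrow> card (- I) = 1"
    unfolding hyp1_def mem_Collect_eq using c le by arith
  also have "\<dots> \<longleftrightarrow> (\<exists>i. - I = {i})" by (auto simp: card_1_singleton_iff)
  also have "\<dots> \<longleftrightarrow> (\<exists>i. I = - {i})" by (metis double_compl)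
  finally show ?thesis .
qed

lemma hyp2_edge: "2 \<le> CARD('n::finite) \<Longrightarrow> (i :: 'n) \<noteq> j \<Longrightarrow> - {i, j} \<in> hyp2"
  by (auto simp: hyp2_iff)

lemma hyp1_vertex: "- {i :: 'n::finite} \<in> hyp1"
  by (auto simp: hyp1_iff)

text \<open>
  As \<open>i\<close>, \<open>j\<close>, \<open>k\<close> range over all orders of three indices, the inequality says that the minimum of
  the three terms $u_{jk} + v_i$, $u_{ik} + v_j$, $u_{ij} + v_k$ is attained twice or infinite.
\<close>

definition tropical_incidence :: "('n::finite set \<Rightarrow> ereal) \<Rightarrow> ('n set \<Rightarrow> ereal) \<Rightarrow> bool" where
  "tropical_incidence u v \<longleftrightarrow> u \<in> tp_reps hyp2 \<and> v \<in> tp_reps hyp1 \<and>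
     (\<forall>i j k. i \<noteq> j \<longrightarrow> i \<noteq> k \<longrightarrow> j \<noteq> k \<longrightarrow>
        min (u (- {i, k}) + v (- {j})) (u (- {i, j}) + v (- {k})) \<le> u (- {j, k}) + v (- {i}))"

definition bilinear_monomial :: "'i \<Rightarrow> 'j \<Rightarrow> ('i + 'j) \<Rightarrow>\<^sub>0 nat" where
  "bilinear_monomial a b = Poly_Mapping.single (Inl a) 1 + Poly_Mapping.single (Inr b) 1"

lemma lookup_bilinear_monomial:
  "Poly_Mapping.lookup (bilinear_monomial a b) w = (if w = Inl a \<or> w = Inr b then 1 else 0)"
  by (auto simp: bilinear_monomial_def lookup_add lookup_single when_def)

lemma keys_bilinear_monomial: "Poly_Mapping.keys (bilinear_monomial a b) = {Inl a, Inr b}"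
  by (auto simp: set_eq_iff in_keys_iff lookup_bilinear_monomial)

lemma bilinear_monomial_eq_iff:
  "bilinear_monomial a b = bilinear_monomial a' b' \<longleftrightarrow> a = a' \<and> b = b'"
proof
  assume "bilinear_monomial a b = bilinear_monomial a' b'"
  then have "{Inl a, Inr b} = {Inl a', Inr b'}" by (metis keys_bilinear_monomial)
  then show "a = a' \<and> b = b'" by auto
qed auto

context valued_field
begin

text \<open>
  A trinomial with coefficients $\pm 1$ has the bare sums of coordinates as its tropical terms, so
  tropical vanishing forbids that the first of them is strictly smaller than the other two.
\<close>

lemma trop_bilinear_trinomial:
  fixes a1 a2 a3 :: "'i::finite" and b1 b2 b3 :: "'j::finite" and s1 s2 s3 :: 'k
  assumes s: "s1 \<in> {1, -1}" "s2 \<in> {1, -1}" "s3 \<in> {1, -1}"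
    and dist: "b1 \<noteq> b2" "b1 \<noteq> b3" "b2 \<noteq> b3"
    and A: "{a1, a2, a3} \<subseteq> A" and B: "{b1, b2, b3} \<subseteq> B"
    and zero: "\<And>p q. (p, q) \<in> Z \<Longrightarrow> s1 * (p a1 * q b1) + s2 * (p a2 * q b2) + s3 * (p a3 * q b3) = 0"
    and trop: "\<And>f. f \<in> vanishing_ideal A B Z \<Longrightarrow> bihomogeneous f \<Longrightarrow> trop_vanishes val f (case_sum u v)"
  shows "min (u a2 + v b2) (u a3 + v b3) \<le> u a1 + v b1"
proof (rule ccontr)
  assume "\<not> ?thesis"
  then have lt: "u a1 + v b1 < u a2 + v b2" "u a1 + v b1 < u a3 + v b3"
    by (simp_all add: not_le)
  let ?m1 = "bilinear_monomial a1 b1" and ?m2 = "bilinear_monomial a2 b2"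
    and ?m3 = "bilinear_monomial a3 b3"
  define f where "f = Poly_Mapping.single ?m1 s1 + Poly_Mapping.single ?m2 s2 + Poly_Mapping.single ?m3 s3"
  have ne: "?m1 \<noteq> ?m2" "?m1 \<noteq> ?m3" "?m2 \<noteq> ?m3" using dist by (auto simp: bilinear_monomial_eq_iff)
  have lkw: "Poly_Mapping.lookup f w =
      (if w = ?m1 then s1 else if w = ?m2 then s2 else if w = ?m3 then s3 else 0)" for w
    using ne by (simp add: f_def lookup_add lookup_single when_def)
  then have lk: "Poly_Mapping.lookup f ?m1 = s1" "Poly_Mapping.lookup f ?m2 = s2"
    "Poly_Mapping.lookup f ?m3 = s3"
    using ne by simp_all
  have s0: "s1 \<noteq> 0" "s2 \<noteq> 0" "s3 \<noteq> 0" using s by auto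
  have keys: "Poly_Mapping.keys f = {?m1, ?m2, ?m3}"
    by (rule Set.set_eqI) (simp add: in_keys_iff lkw s0)
  have eval: "mvpoly_eval f x = s1 * (x (Inl a1) * x (Inr b1)) + s2 * (x (Inl a2) * x (Inr b2))
      + s3 * (x (Inl a3) * x (Inr b3))" for x
    unfolding mvpoly_eval_def keys using ne
    by (simp add: lk keys_bilinear_monomial lookup_bilinear_monomial add_ac)
  have "f \<in> vanishing_ideal A B Z"
    unfolding vanishing_ideal_def coord_ring_def
    using A B zero by (auto simp: keys keys_bilinear_monomial eval)
  moreover have "bihomogeneous f"
    unfolding bihomogeneous_def keys
    by (intro exI[of _ 1]) (auto simp: lookup_bilinear_monomial)
  ultimately have "trop_vanishes val f (case_sum u v)" by (rule trop)
  moreover have t: "trop_term val f (case_sum u v) ?m1 = u a1 + v b1"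
    "trop_term val f (case_sum u v) ?m2 = u a2 + v b2"
    "trop_term val f (case_sum u v) ?m3 = u a3 + v b3"
    using s by (auto simp: trop_term_keys lk keys_bilinear_monomial lookup_bilinear_monomial
        simp flip: one_ereal_def)
  have "\<not> trop_vanishes val f (case_sum u v)"
    unfolding not_trop_vanishes_iff keys
    using lt by (intro bexI[of _ ?m1]) (auto simp: t)
  ultimately show False by simp
qed

lemma trop_imp_tropical_incidence:
  fixes u v :: "'n::{finite,linorder} set \<Rightarrow> ereal"
  assumes n: "3 \<le> CARD('n)" and uv: "u \<in> tp_reps hyp2" "v \<in> tp_reps hyp1"
    and trop: "\<And>f. f \<in> vanishing_ideal hyp2 hyp1 (Fl_short :: (('n set \<Rightarrow> 'k) \<times> ('n set \<Rightarrow> 'k)) set) \<Longrightarrow>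
        bihomogeneous f \<Longrightarrow> trop_vanishes val f (case_sum u v)"
  shows "tropical_incidence u v"
  unfolding tropical_incidence_def
proof (intro conjI allI impI uv)
  fix i j k :: 'n assume d: "i \<noteq> j" "i \<noteq> k" "j \<noteq> k"
  obtain s1 s2 s3 :: 'k where s: "s1 \<in> {1,-1}" "s2 \<in> {1,-1}" "s3 \<in> {1,-1}"
    "\<forall>(p, q)\<in>Fl_short. s1 * (p (- {j, k}) * q (- {i})) + s2 * (p (- {i, k}) * q (- {j}))
       + s3 * (p (- {i, j}) * q (- {k})) = 0"
    using Fl_short_relation[OF d, where 'k = 'k] by blast
  have "\<And>p q. (p, q) \<in> Fl_short \<Longrightarrow> s1 * (p (- {j, k}) * q (- {i})) + s2 * (p (- {i, k}) * q (- {j}))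
       + s3 * (p (- {i, j}) * q (- {k})) = 0"
    using s(4) by blast
  moreover have "- {i} \<noteq> - {j}" "- {i} \<noteq> - {k}" "- {j} \<noteq> - {k}" using d by auto
  moreover have "{- {j, k}, - {i, k}, - {i, j}} \<subseteq> hyp2" "{- {i}, - {j}, - {k}} \<subseteq> hyp1"
    using n d by (auto intro!: hyp2_edge hyp1_vertex)
  ultimately show "min (u (- {i, k}) + v (- {j})) (u (- {i, j}) + v (- {k})) \<le> u (- {j, k}) + v (- {i})"
    using trop_bilinear_trinomial[OF s(1-3), of "- {i}" "- {j}" "- {k}" "- {j, k}" "- {i, k}" "- {i, j}"
        hyp2 hyp1 "Fl_short :: (('n set \<Rightarrow> 'k) \<times> ('n set \<Rightarrow> 'k)) set" u v] trop by blast
qed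

lemma val_multiple:
  assumes "val g = ereal r"
  shows "\<exists>z. val z = ereal (r * of_int k)"
proof -
  have g0: "g \<noteq> 0" using assms by auto
  show ?thesis
  proof (cases "0 \<le> k")
    case True
    then have "val (g ^ nat k) = ereal (r * of_int k)" by (simp add: val_power assms)
    then show ?thesis by blast
  next
    case False
    have "val (1 / g) = ereal (- r)" using val_divide[OF g0 assms, of 1] by (simp add: zero_ereal_def)
    then have "val ((1 / g) ^ nat (- k)) = ereal (r * of_int k)"
      using False by (simp only: val_power) simp
    then show ?thesis by blast
  qed
qed

end

text \<open>
  Closeness that forces infinite coordinates to agree, so that approximation stays within a stratum.
\<close>

definition near :: "real \<Rightarrow> ereal \<Rightarrow> ereal \<Rightarrow> bool" where
  "near e a b \<longleftrightarrow> (a = \<infinity> \<and> b = \<infinity>) \<or> (\<exists>s t. a = ereal s \<and> b = ereal t \<and> \<bar>s - t\<bar> \<le> e)"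

definition grid :: "real \<Rightarrow> ereal \<Rightarrow> ereal" where
  "grid r a = (if a = \<infinity> then \<infinity> else ereal (r * of_int \<lfloor>real_of_ereal a / r\<rfloor>))"

lemma grid_mono:
  assumes "0 < r" "a \<noteq> -\<infinity>" "b \<noteq> -\<infinity>" "a \<le> b"
  shows "grid r a \<le> grid r b"
  using assms by (cases a; cases b) (auto simp: grid_def intro!: floor_mono divide_right_mono)

lemma near_grid:
  assumes "0 < r" "a \<noteq> -\<infinity>"
  shows "near r a (grid r a)"
proof (cases "a = \<infinity>")
  case True then show ?thesis by (simp add: near_def grid_def)
next
  case False
  then obtain s where s: "a = ereal s" using assms by (cases a) auto
  have "\<bar>s / r - of_int \<lfloor>s / r\<rfloor>\<bar> \<le> 1" by linarith
  then have "\<bar>r * (s / r - of_int \<lfloor>s / r\<rfloor>)\<bar> \<le> r" using assms(1) by (simp add: abs_mult)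
  then have "\<bar>s - r * of_int \<lfloor>s / r\<rfloor>\<bar> \<le> r" using assms(1) by (simp add: right_diff_distrib)
  then show ?thesis by (simp add: near_def grid_def s)
qed

lemma near_add: "near e a b \<Longrightarrow> near e' a' b' \<Longrightarrow> near (e + e') (a + a') (b + b')"
  unfolding near_def by (auto intro: abs_triangle_ineq[THEN order_trans])

context alg_closed_valued_field
begin

text \<open>
  The rounded vertex coordinates are the valuations of the entries of \<open>x\<close>, and \<open>S\<close> is the set of zero
  entries.  The normalised coordinates of the inner edges form an ultrametric, which remains one after
  rounding because \<^term>\<open>grid r\<close> is monotone; realise it by points \<open>z\<close> and put $y_i = x_i z_i$.  An edge
  from \<open>a \<in> S\<close> to the outside has a normalised coordinate depending only on \<open>a\<close>, which becomes the
  valuation of $y_a$.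
\<close>

lemma approximate_by_flag_coordinates:
  fixes u v :: "'n::finite set \<Rightarrow> ereal"
  assumes inc: "tropical_incidence u v" and g: "val g = ereal r" "0 < r"
  shows "\<exists>x y. (\<forall>i. near r (v (- {i})) (val (x i))) \<and>
    (\<forall>i j. i \<noteq> j \<longrightarrow> near (3 * r) (u (- {i, j})) (val (x i * y j - x j * y i)))"
proof -
  have um: "u J \<noteq> -\<infinity>" and vm: "v J \<noteq> -\<infinity>" for J
    using inc by (auto simp: tropical_incidence_def tp_reps_def)
  have rel: "min (u (- {i, k}) + v (- {j})) (u (- {i, j}) + v (- {k})) \<le> u (- {j, k}) + v (- {i})"
    if "i \<noteq> j" "i \<noteq> k" "j \<noteq> k" for i j k
    using inc that by (simp add: tropical_incidence_def)
  have grid_val: "grid r a \<in> range val" for a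
  proof (cases "a = \<infinity>")
    case True then show ?thesis by (auto simp: grid_def intro: range_eqI[of _ _ 0])
  next
    case False
    then show ?thesis using val_multiple[OF g(1), of "\<lfloor>real_of_ereal a / r\<rfloor>"]
      unfolding grid_def by (metis rangeI)
  qed
  define S where "S = {i. v (- {i}) = \<infinity>}"
  obtain I0 where I0: "I0 \<in> hyp1" "v I0 \<noteq> \<infinity>"
    using inc by (auto simp: tropical_incidence_def tp_reps_def)
  obtain j0 where "I0 = - {j0}" using iffD1[OF hyp1_iff I0(1)] ..
  then have j0: "j0 \<notin> S" using I0(2) by (simp add: S_def)
  define \<alpha> where "\<alpha> i = real_of_ereal (v (- {i}))" for i
  have va: "v (- {i}) = ereal (\<alpha> i)" if "i \<notin> S" for i
    using that vm[of "- {i}"] by (auto simp: S_def \<alpha>_def ereal_real)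
  have "\<forall>i. \<exists>z. val z = grid r (v (- {i}))" using grid_val by (metis rangeE)
  then obtain x where x: "\<And>i. val (x i) = grid r (v (- {i}))" by metis
  have x0: "x i = 0" if "i \<in> S" for i
    using x[of i] that by (auto simp: S_def grid_def)
  have xn: "near r (v (- {i})) (val (x i))" for i
    unfolding x by (rule near_grid[OF g(2) vm])
  define d where "d i j = (if i = j then \<infinity> else u (- {i, j}) - ereal (\<alpha> i + \<alpha> j))" for i j
  have dm: "d i j \<noteq> -\<infinity>" for i j
    using um[of "- {i, j}"] by (cases "u (- {i, j})") (auto simp: d_def)
  have d_sym: "d i j = d j i" for i j by (auto simp: d_def insert_commute add.commute)
  have d_tri: "min (d i j) (d j k) \<le> d i k" if R: "i \<in> - S" "j \<in> - S" "k \<in> - S" for i j k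
  proof (cases "i = j \<or> i = k \<or> j = k")
    case True then show ?thesis by (auto simp: d_def)
  next
    case False
    have "min (u (- {j, k}) + ereal (\<alpha> i)) (u (- {j, i}) + ereal (\<alpha> k)) \<le> u (- {i, k}) + ereal (\<alpha> j)"
      using rel[of j i k] False R va by auto
    then show ?thesis
      using False um[of "- {j, k}"] um[of "- {j, i}"] um[of "- {i, k}"]
      by (cases "u (- {j, k})"; cases "u (- {j, i})"; cases "u (- {i, k})")
         (auto simp: d_def insert_commute min_def split: if_splits)
  qed
  have "\<exists>z. \<forall>i\<in>- S. \<forall>j\<in>- S. val (z i - z j) = grid r (d i j)"
  proof (rule ultrametric_realisation)
    show "grid r (d i i) = \<infinity>" for i by (simp add: d_def grid_def)
    show "grid r (d i j) = grid r (d j i)" for i j by (simp add: d_sym)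
    show "grid r (d i j) \<in> range val" for i j by (rule grid_val)
    fix i j k assume "i \<in> - S" "j \<in> - S" "k \<in> - S"
    from d_tri[OF this] show "min (grid r (d i j)) (grid r (d j k)) \<le> grid r (d i k)"
      using grid_mono[OF g(2) dm dm, of i j i k] grid_mono[OF g(2) dm dm, of j k i k]
      by (auto simp: min_le_iff_disj)
  qed simp
  then obtain z where z: "\<And>i j. i \<notin> S \<Longrightarrow> j \<notin> S \<Longrightarrow> val (z i - z j) = grid r (d i j)" by auto
  define t where "t a = u (- {a, j0}) - ereal (\<alpha> j0)" for a
  have tm: "t a \<noteq> -\<infinity>" for a
    using um[of "- {a, j0}"] by (cases "u (- {a, j0})") (auto simp: t_def)
  have ut: "u (- {a, j}) = t a + ereal (\<alpha> j)" if a: "a \<in> S" and j: "j \<notin> S" for a j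
  proof (cases "j = j0")
    case True
    then show ?thesis by (cases "u (- {a, j0})") (auto simp: t_def)
  next
    case False
    have aj: "a \<noteq> j" "a \<noteq> j0" using a j j0 by auto
    have vinf: "v (- {a}) = \<infinity>" using a by (simp add: S_def)
    have "u (- {a, j0}) + ereal (\<alpha> j) \<le> u (- {a, j}) + ereal (\<alpha> j0)"
      using rel[of j0 a j] aj False va[OF j] va[OF j0] vinf um by (auto simp: insert_commute)
    moreover have "u (- {a, j}) + ereal (\<alpha> j0) \<le> u (- {a, j0}) + ereal (\<alpha> j)"
      using rel[of j a j0] aj False va[OF j] va[OF j0] vinf um by (auto simp: insert_commute)
    ultimately show ?thesis
      using um[of "- {a, j}"] by (cases "u (- {a, j0})"; cases "u (- {a, j})") (auto simp: t_def)
  qed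
  have uS: "u (- {a, b}) = \<infinity>" if "a \<in> S" "b \<in> S" "a \<noteq> b" for a b
  proof -
    have "j0 \<noteq> a" "j0 \<noteq> b" using that j0 by auto
    then show ?thesis
    using rel[of j0 a b] that j0 va[OF j0] um by (cases "u (- {a, b})") (auto simp: S_def)
  qed
  have "\<forall>a. \<exists>y. val y = grid r (t a)" using grid_val by (metis rangeE)
  then obtain y' where y': "\<And>a. val (y' a) = grid r (t a)" by metis
  define y where "y i = (if i \<in> S then y' i else x i * z i)" for i
  have RR: "near (3 * r) (u (- {i, j})) (val (x i * y j - x j * y i))"
    if ij: "i \<noteq> j" "i \<notin> S" "j \<notin> S" for i j
  proof -
    have "x i * y j - x j * y i = x i * x j * (z j - z i)"
      using ij by (simp add: y_def algebra_simps)
    then have "val (x i * y j - x j * y i) = val (x i) + val (x j) + grid r (d j i)"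
      using z ij by (simp add: val_mult)
    moreover have "near (r + r + r) (v (- {i}) + v (- {j}) + d j i) (val (x i) + val (x j) + grid r (d j i))"
      by (intro near_add xn near_grid g(2) dm)
    moreover have "v (- {i}) + v (- {j}) + d j i = u (- {i, j})"
      using ij va um[of "- {i, j}"] by (cases "u (- {i, j})") (auto simp: d_def insert_commute)
    ultimately show ?thesis by simp
  qed
  have SR: "near (3 * r) (u (- {a, j})) (val (x a * y j - x j * y a))"
    if aj: "a \<in> S" "j \<notin> S" for a j
  proof -
    have "val (x a * y j - x j * y a) = val (x j) + grid r (t a)"
      using x0[OF aj(1)] aj by (simp add: y_def val_mult y')
    moreover have "near (r + r) (v (- {j}) + t a) (val (x j) + grid r (t a))"
      by (intro near_add xn near_grid g(2) tm)
    moreover have "v (- {j}) + t a = u (- {a, j})" using ut[OF aj] va[OF aj(2)] by (simp add: add.commute)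
    ultimately show ?thesis using g(2) by (fastforce simp: near_def)
  qed
  have "near (3 * r) (u (- {i, j})) (val (x i * y j - x j * y i))" if ij: "i \<noteq> j" for i j
  proof (cases "i \<in> S"; cases "j \<in> S")
    assume "i \<in> S" "j \<in> S"
    then show ?thesis using uS ij x0 by (simp add: near_def)
  next
    assume "i \<notin> S" "j \<in> S"
    then show ?thesis using SR[of j i] val_diff_commute[of "x i * y j"] by (simp add: insert_commute)
  qed (use RR SR ij in auto)
  then show ?thesis using xn by blast
qed

text \<open>
  Approximate by valuations of points of the variety, where \<open>f\<close> vanishes, and let the precision tend
  to zero.  Pluecker vectors of the constructed flags are known only up to a common factor, which
  is why bihomogeneity is needed.
\<close>

lemma tropical_incidence_imp_trop_vanishes:
  fixes u v :: "'n::{finite,linorder} set \<Rightarrow> ereal"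
  assumes n: "3 \<le> CARD('n)" and nt: "nontrivial_valuation val" and inc: "tropical_incidence u v"
    and f: "f \<in> vanishing_ideal hyp2 hyp1 (Fl_short :: (('n set \<Rightarrow> 'k) \<times> ('n set \<Rightarrow> 'k)) set)"
    and bh: "bihomogeneous f"
  shows "trop_vanishes val f (case_sum u v)"
proof -
  have um: "u J \<noteq> -\<infinity>" and vm: "v J \<noteq> -\<infinity>"
    and u0: "J \<notin> hyp2 \<Longrightarrow> u J = \<infinity>" and v0: "J \<notin> hyp1 \<Longrightarrow> v J = \<infinity>"
    and ue: "\<exists>J\<in>hyp2. u J \<noteq> \<infinity>" for J :: "'n set"
    using inc by (auto simp: tropical_incidence_def tp_reps_def)
  have n2: "2 \<le> CARD('n)" using n by simp
  have appr: "\<exists>u' v'. (\<forall>J. near e (u J) (u' J)) \<and> (\<forall>I. near e (v I) (v' I)) \<and>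
     trop_vanishes val f (case_sum u' v')" if e: "0 < e" for e
  proof -
    \<comment> \<open>An edge coordinate is a sum of three rounded numbers.\<close>
    obtain g r where g: "val g = ereal r" "0 < r" "r < e / 3"
      using small_positive_value[OF nt, of "e / 3"] e by auto
    obtain x y where x: "\<And>i. near r (v (- {i})) (val (x i))"
      and y: "\<And>i j. i \<noteq> j \<Longrightarrow> near (3 * r) (u (- {i, j})) (val (x i * y j - x j * y i))"
      using approximate_by_flag_coordinates[OF inc g(1,2)] by blast
    obtain J0 where J0: "J0 \<in> hyp2" "u J0 \<noteq> \<infinity>" using ue ..
    obtain i0 j0 where "i0 \<noteq> j0" "J0 = - {i0, j0}" using iffD1[OF hyp2_iff[OF n2] J0(1)] by auto
    then have ij0: "i0 \<noteq> j0" "u (- {i0, j0}) \<noteq> \<infinity>" using J0(2) by auto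
    then have "x i0 * y j0 - x j0 * y i0 \<noteq> 0"
      using y[OF ij0(1)] by (auto simp: near_def)
    from flag_of_point_and_line[OF this] obtain p q c c' where pq: "(p, q) \<in> Fl_short"
      and p: "\<And>i j. i \<noteq> j \<Longrightarrow> val (p (- {i, j})) = val (x i * y j - x j * y i) + ereal c"
      and q: "\<And>i. val (q (- {i})) = val (x i) + ereal c'"
      by blast
    define u' where "u' J = (if J \<in> hyp2 then val (p J) else \<infinity>)" for J
    define v' where "v' I = (if I \<in> hyp1 then val (q I) else \<infinity>)" for I
    have m: "u' J \<noteq> -\<infinity>" "v' I \<noteq> -\<infinity>" for I J by (auto simp: u'_def v'_def)
    have "mvpoly_eval f (case_sum p q) = 0" using f pq by (auto simp: vanishing_ideal_def)
    then have "trop_vanishes val f (case_sum u' v')"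
      by (rule zero_imp_trop_vanishes)
         (use f in \<open>fastforce simp: vanishing_ideal_def coord_ring_def u'_def v'_def split: sum.splits\<close>)
    from trop_vanishes_shift[OF bh m this]
    have "trop_vanishes val f (case_sum (\<lambda>J. u' J + ereal (- c)) (\<lambda>I. v' I + ereal (- c')))" .
    moreover have "near e (u J) (u' J + ereal (- c))" for J
    proof (cases "J \<in> hyp2")
      case True
      then obtain i j where ij: "i \<noteq> j" "J = - {i, j}" using hyp2_iff[OF n2, of J] by auto
      have "u' J + ereal (- c) = val (x i * y j - x j * y i)"
        using True p[OF ij(1)] ij(2) unfolding u'_def
        by (cases "val (x i * y j - x j * y i)") auto
      then show ?thesis using y[OF ij(1)] ij(2) g(3) by (fastforce simp: near_def)
    next
      case False then show ?thesis using u0 by (simp add: u'_def near_def)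
    qed
    moreover have "near e (v I) (v' I + ereal (- c'))" for I
    proof (cases "I \<in> hyp1")
      case True
      then obtain i where i: "I = - {i}" using hyp1_iff[of I] by auto
      have "v' I + ereal (- c') = val (x i)"
        using True q[of i] i unfolding v'_def by (cases "val (x i)") auto
      then show ?thesis using x[of i] i g(2,3) by (fastforce simp: near_def)
    next
      case False then show ?thesis using v0 by (simp add: v'_def near_def)
    qed
    ultimately show ?thesis
      by (intro exI[of _ "\<lambda>J. u' J + ereal (- c)"] exI[of _ "\<lambda>I. v' I + ereal (- c')"] conjI allI)
  qed
  have "\<forall>m. \<exists>w. (\<forall>a. near (1 / real (Suc m)) (case_sum u v a) (w a)) \<and> trop_vanishes val f w"
  proof
    fix m
    obtain u' v' where "\<forall>J. near (1 / real (Suc m)) (u J) (u' J)" "\<forall>I. near (1 / real (Suc m)) (v I) (v' I)"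
      "trop_vanishes val f (case_sum u' v')" using appr[of "1 / real (Suc m)"] by auto
    then show "\<exists>w. (\<forall>a. near (1 / real (Suc m)) (case_sum u v a) (w a)) \<and> trop_vanishes val f w"
      by (intro exI[of _ "case_sum u' v'"]) (auto split: sum.splits)
  qed
  then obtain W where W: "\<And>m a. near (1 / real (Suc m)) (case_sum u v a) (W m a)"
    "\<And>m. trop_vanishes val f (W m)" by metis
  show ?thesis
  proof (rule trop_vanishes_closed[of "case_sum u v" W])
    show "case_sum u v a \<noteq> -\<infinity>" for a using um vm by (auto split: sum.splits)
    show "W m a \<noteq> -\<infinity>" "W m a = \<infinity> \<longleftrightarrow> case_sum u v a = \<infinity>" for m a
      using W(1)[of m a] by (auto simp: near_def)
    show "trop_vanishes val f (W m)" for m by (rule W(2))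
    fix a assume fin: "case_sum u v a \<noteq> \<infinity>"
    show "(\<lambda>m. real_of_ereal (W m a)) \<longlonglongrightarrow> real_of_ereal (case_sum u v a)"
    proof (rule LIM_zero_cancel, rule Lim_null_comparison)
      show "(\<lambda>m. 1 / real (Suc m)) \<longlonglongrightarrow> 0"
        using LIMSEQ_inverse_real_of_nat by (simp add: inverse_eq_divide)
      show "\<forall>\<^sub>F m in sequentially. norm (real_of_ereal (W m a) - real_of_ereal (case_sum u v a))
          \<le> 1 / real (Suc m)"
      proof (rule always_eventually, rule allI)
        fix m
        obtain s t where "case_sum u v a = ereal s" "W m a = ereal t" "\<bar>s - t\<bar> \<le> 1 / real (Suc m)"
          using W(1)[of m a] fin unfolding near_def by blast
        then show "norm (real_of_ereal (W m a) - real_of_ereal (case_sum u v a)) \<le> 1 / real (Suc m)"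
          by (simp add: abs_minus_commute)
      qed
    qed
  qed
qed

lemma trop_Fl_short:
  assumes n: "3 \<le> CARD('n::{finite,linorder})" and nt: "nontrivial_valuation val"
  shows "trop val hyp2 hyp1 (Fl_short :: (('n set \<Rightarrow> 'k) \<times> ('n set \<Rightarrow> 'k)) set)
    = {(tp_class u, tp_class v) | u v. tropical_incidence u v}"
proof -
  have "u \<in> tp_reps hyp2 \<and> v \<in> tp_reps hyp1 \<and>
      (\<forall>f\<in>vanishing_ideal hyp2 hyp1 (Fl_short :: (('n set \<Rightarrow> 'k) \<times> ('n set \<Rightarrow> 'k)) set).
         bihomogeneous f \<longrightarrow> trop_vanishes val f (case_sum u v)) \<longleftrightarrow> tropical_incidence u v"
    (is "?A \<longleftrightarrow> ?B") for u v
  proof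
    assume ?A
    then show ?B by (elim conjE, intro trop_imp_tropical_incidence[OF n]) simp_all
  next
    assume B: ?B
    show ?A
    proof (intro conjI ballI impI)
      show "u \<in> tp_reps hyp2" "v \<in> tp_reps hyp1" using B by (simp_all add: tropical_incidence_def)
    qed (rule tropical_incidence_imp_trop_vanishes[OF n nt B])
  qed
  then show ?thesis unfolding trop_def by (simp only:)
qed

end

section \<open>Flats of the two matroids\<close>

definition adj :: "'v set set \<Rightarrow> ('v \<times> 'v) set" where
  "adj G = {(i, j). {i, j} \<in> G}"

lemma has_cycle_mono: "has_cycle G \<Longrightarrow> G \<subseteq> H \<Longrightarrow> has_cycle H"
  unfolding has_cycle_def by (meson subsetD)

lemma not_has_cycle_empty: "\<not> has_cycle {}"
  unfolding has_cycle_def by (auto intro!: exI[of _ 0])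

text \<open>
  A new cycle passes through the new edge; going around the cycle the other way connects its ends.
\<close>

lemma has_cycle_insert_edge_imp_path:
  assumes cyc: "has_cycle (insert {i, k} G)" and no: "\<not> has_cycle G"
  shows "(i, k) \<in> (adj G)\<^sup>*"
proof -
  obtain vs where L: "3 \<le> length vs" "distinct vs"
    and e: "\<And>m. m < length vs \<Longrightarrow> {vs ! m, vs ! (Suc m mod length vs)} \<in> insert {i, k} G"
    using cyc unfolding has_cycle_def by auto
  let ?L = "length vs"
  obtain m where m: "m < ?L" "{vs ! m, vs ! (Suc m mod ?L)} \<notin> G"
    using no L unfolding has_cycle_def by auto
  have ik: "{vs ! m, vs ! (Suc m mod ?L)} = {i, k}" using e[OF m(1)] m(2) by auto
  have other: "{vs ! q, vs ! (Suc q mod ?L)} \<in> G" if q: "q < ?L" "q \<noteq> m" for q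
  proof (rule ccontr)
    assume "{vs ! q, vs ! (Suc q mod ?L)} \<notin> G"
    then have "{vs ! q, vs ! (Suc q mod ?L)} = {vs ! m, vs ! (Suc m mod ?L)}"
      using e[OF q(1)] ik by auto
    then have "vs ! q = vs ! (Suc m mod ?L) \<and> vs ! m = vs ! (Suc q mod ?L)"
      using nth_eq_iff_index_eq[OF L(2) q(1) m(1)] q(2) by (auto simp: doubleton_eq_iff)
    moreover have lt: "Suc m mod ?L < ?L" "Suc q mod ?L < ?L"
      using m(1) by (auto intro!: mod_less_divisor)
    ultimately have "q = Suc m mod ?L" "m = Suc q mod ?L"
      using nth_eq_iff_index_eq[OF L(2) q(1) lt(1)] nth_eq_iff_index_eq[OF L(2) m(1) lt(2)]
      by blast+
    then have qm: "q = (if Suc m = ?L then 0 else Suc m)" "m = (if Suc q = ?L then 0 else Suc q)"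
      using q(1) m(1) by (metis Suc_lessI mod_less mod_self)+
    show False
    proof (cases "Suc m = ?L")
      case True
      then have "q = 0" using qm(1) by simp
      then show False using qm(2) True L(1) by simp
    next
      case False
      then have "q = Suc m" using qm(1) by simp
      then show False using qm(2) L(1) by (simp split: if_splits)
    qed
  qed
  have walk: "(vs ! ((Suc m) mod ?L), vs ! ((Suc m + t) mod ?L)) \<in> (adj G)\<^sup>*" if "t < ?L" for t
    using that
  proof (induction t)
    case (Suc t)
    let ?q = "(Suc m + t) mod ?L"
    have "?q \<noteq> m"
    proof
      assume "?q = m"
      then have "(m + Suc t) mod ?L = (m + 0) mod ?L" using m(1) by simp
      then have "Suc t mod ?L = 0 mod ?L" by (simp only: nat_mod_eq_iff) auto
      then show False using Suc.prems by auto
    qed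
    moreover have "?q < ?L" using m(1) by (intro mod_less_divisor) auto
    ultimately have "(vs ! ?q, vs ! (Suc ?q mod ?L)) \<in> adj G"
      using other by (simp add: adj_def)
    moreover have "Suc ?q mod ?L = (Suc m + Suc t) mod ?L" by (simp add: mod_Suc_eq)
    ultimately show ?case using Suc by (metis Suc_lessD rtrancl.rtrancl_into_rtrancl)
  qed auto
  have sym: "(b, a) \<in> (adj G)\<^sup>*" if "(a, b) \<in> (adj G)\<^sup>*" for a b
  proof -
    have "sym (adj G)" by (auto simp: sym_def adj_def insert_commute)
    then show ?thesis using that by (meson symD sym_rtrancl)
  qed
  have "Suc m + (?L - 1) = m + ?L" using m(1) by simp
  then have "(Suc m + (?L - 1)) mod ?L = m" using m(1) by (simp only: mod_add_self2 mod_less)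
  then have "(vs ! (Suc m mod ?L), vs ! m) \<in> (adj G)\<^sup>*"
    using walk[of "?L - 1"] L(1) by fastforce
  then show ?thesis using ik sym by (auto simp: doubleton_eq_iff)
qed

lemma rtrancl_imp_distinct_path:
  assumes "(i, k) \<in> r\<^sup>*"
  shows "\<exists>vs. vs \<noteq> [] \<and> hd vs = i \<and> last vs = k \<and> distinct vs \<and>
           (\<forall>m. Suc m < length vs \<longrightarrow> (vs ! m, vs ! Suc m) \<in> r)"
  using assms
proof (induction rule: rtrancl_induct)
  case base then show ?case by (intro exI[of _ "[i]"]) auto
next
  case (step y z)
  then obtain vs where vs: "vs \<noteq> []" "hd vs = i" "last vs = y" "distinct vs"
    "\<And>m. Suc m < length vs \<Longrightarrow> (vs ! m, vs ! Suc m) \<in> r" by auto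
  show ?case
  proof (cases "z \<in> set vs")
    case True
    then obtain q where q: "q < length vs" "vs ! q = z" by (auto simp: in_set_conv_nth)
    have "last (take (Suc q) vs) = z" using q by (simp add: take_Suc_conv_app_nth)
    then show ?thesis using vs q
      by (intro exI[of _ "take (Suc q) vs"]) auto
  next
    case False
    have "((vs @ [z]) ! m, (vs @ [z]) ! Suc m) \<in> r" if m: "Suc m < length (vs @ [z])" for m
    proof (cases "Suc m < length vs")
      case True then show ?thesis using vs(5)[OF True] by (simp add: nth_append)
    next
      case False
      then have "m = length vs - 1" "Suc m = length vs" using m by auto
      then show ?thesis using vs step(2) by (simp add: nth_append last_conv_nth)
    qed
    then show ?thesis using vs False by (intro exI[of _ "vs @ [z]"]) auto
  qed
qed

lemma path_imp_has_cycle_insert_edge: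
  assumes "(i, k) \<in> (adj G)\<^sup>*" "i \<noteq> k" "{i, k} \<notin> G"
  shows "has_cycle (insert {i, k} G)"
proof -
  obtain vs where vs: "vs \<noteq> []" "hd vs = i" "last vs = k" "distinct vs"
    "\<And>m. Suc m < length vs \<Longrightarrow> (vs ! m, vs ! Suc m) \<in> adj G"
    using rtrancl_imp_distinct_path[OF assms(1)] by auto
  have i: "vs ! 0 = i" and k: "vs ! (length vs - 1) = k"
    using vs by (simp_all add: hd_conv_nth last_conv_nth)
  have "length vs \<noteq> 1" using i k assms(2) by auto
  moreover have "length vs \<noteq> 2"
    using i k vs(5)[of 0] assms(3) by (auto simp: adj_def)
  ultimately have L: "3 \<le> length vs" using vs(1) by (metis Suc_leI eval_nat_numeral(3) le_neq_implies_less length_greater_0_conv numeral_1_eq_Suc_0 numeral_2_eq_2 One_nat_def)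
  have "{vs ! m, vs ! (Suc m mod length vs)} \<in> insert {i, k} G" if m: "m < length vs" for m
  proof (cases "Suc m < length vs")
    case True then show ?thesis using vs(5)[OF True] by (simp add: adj_def)
  next
    case False
    then have "Suc m = length vs" using m by auto
    then show ?thesis using i k by (metis diff_Suc_1 insertI1 insert_commute mod_self)
  qed
  then show ?thesis unfolding has_cycle_def using L vs(4) by blast
qed

lemma matroid_rank_ge:
  assumes "finite X" "T \<subseteq> X" "indep M T"
  shows "card T \<le> matroid_rank M X"
  unfolding matroid_rank_def using assms
  by (intro Max_ge) (auto intro: finite_subset[of _ "Pow X"])

lemma matroid_rank_attained:
  assumes "finite X" "indep M {}"
  obtains T where "T \<subseteq> X" "indep M T" "card T = matroid_rank M X"
proof -
  have "matroid_rank M X \<in> card ` {T. T \<subseteq> X \<and> indep M T}"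
    unfolding matroid_rank_def using assms
    by (intro Max_in) (auto intro: finite_subset[of _ "Pow X"])
  then show ?thesis using that by auto
qed

text \<open>
  A largest independent subset of \<open>F\<close> can be augmented by \<open>e\<close>, so the rank increases.
\<close>

lemma flatI_augment:
  assumes fin: "finite (ground M)" and "indep M {}" and "F \<subseteq> ground M"
    and aug: "\<And>e T. e \<in> ground M - F \<Longrightarrow> T \<subseteq> F \<Longrightarrow> indep M T \<Longrightarrow> indep M (insert e T)"
  shows "flat M F"
  unfolding flat_def
proof (intro conjI ballI)
  fix e assume e: "e \<in> ground M - F"
  have F: "finite F" using fin assms(3) finite_subset by auto
  obtain T where T: "T \<subseteq> F" "indep M T" "card T = matroid_rank M F"
    using matroid_rank_attained[OF F assms(2)] by auto
  have "card (insert e T) = Suc (card T)" using T(1) F e finite_subset by (subst card_insert_disjoint) auto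
  moreover have "card (insert e T) \<le> matroid_rank M (insert e F)"
    using T(1) F e aug[OF e T(1,2)] by (intro matroid_rank_ge) auto
  ultimately show "matroid_rank M F < matroid_rank M (insert e F)" using T(3) by simp
qed (fact assms(3))

text \<open>
  If \<open>e\<close> can always be exchanged for an element of \<open>F\<close>, then adding \<open>e\<close> does not raise the rank.
\<close>

lemma flatD_exchange:
  assumes fin: "finite (ground M)" and "indep M {}" and "flat M F" and e: "e \<in> ground M - F"
    and exch: "\<And>T. T \<subseteq> F \<Longrightarrow> indep M (insert e T) \<Longrightarrow> \<exists>f\<in>F - T. indep M (insert f T)"
  shows False
proof -
  have F: "finite F" using fin assms(3) finite_subset by (auto simp: flat_def)
  obtain T where T: "T \<subseteq> insert e F" "indep M T" "card T = matroid_rank M (insert e F)"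
    using matroid_rank_attained[of "insert e F", OF _ assms(2)] F by auto
  have "card T \<le> matroid_rank M F"
  proof (cases "e \<in> T")
    case False then show ?thesis using T F by (intro matroid_rank_ge) auto
  next
    case True
    let ?T = "T - {e}"
    have "?T \<subseteq> F" "insert e ?T = T" using T True by auto
    then obtain f where f: "f \<in> F - ?T" "indep M (insert f ?T)" using exch[of ?T] T by auto
    have "card T = card (insert f ?T)"
      using True f T(1) F finite_subset[OF T(1)] card_Suc_Diff1[of T e] by simp
    then show ?thesis using matroid_rank_ge[OF F _ f(2)] f(1) \<open>?T \<subseteq> F\<close> by auto
  qed
  then show False using bspec[OF conjunct2[OF assms(3)[unfolded flat_def]] e] T(3) by simp
qed

text \<open>
  Removing \<open>e\<close> from a forest separates its ends, so a path between them in \<open>F\<close> has an edge that leaves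
  the component of the first end, and this edge can replace \<open>e\<close>.  Conversely, an edge whose ends are
  not connected in \<open>F\<close> closes no cycle with a forest in \<open>F\<close>.
\<close>

lemma flat_graphic_matroid_iff:
  assumes E: "finite E" "inj_on \<phi> E" "\<And>e. e \<in> E \<Longrightarrow> card (\<phi> e) = 2"
  shows "flat (graphic_matroid \<phi> E) F \<longleftrightarrow>
    F \<subseteq> E \<and> (\<forall>e\<in>E. \<forall>i k. \<phi> e = {i, k} \<and> (i, k) \<in> (adj (\<phi> ` F))\<^sup>* \<longrightarrow> e \<in> F)"
    (is "flat ?M F \<longleftrightarrow> ?R")
proof
  assume fl: "flat ?M F"
  then have FE: "F \<subseteq> E" by (simp add: flat_def graphic_matroid_def)
  have "e \<in> F" if e: "e \<in> E" "\<phi> e = {i, k}" and p: "(i, k) \<in> (adj (\<phi> ` F))\<^sup>*" for e i k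
  proof (rule ccontr)
    assume eF: "e \<notin> F"
    have ik: "i \<noteq> k" using E(3)[OF e(1)] e(2) by auto
    show False
    proof (rule flatD_exchange[OF _ _ fl])
      show "e \<in> ground ?M - F" "finite (ground ?M)" "indep ?M {}"
        using e eF E by (auto simp: graphic_matroid_def not_has_cycle_empty)
      fix T assume T: "T \<subseteq> F" "indep ?M (insert e T)"
      then have acyc: "\<not> has_cycle (insert {i, k} (\<phi> ` T))" "T \<subseteq> E"
        using e by (auto simp: graphic_matroid_def)
      have "{i, k} \<notin> \<phi> ` T" using e eF T E(2) FE
        by (metis inj_on_image_mem_iff subset_iff)
      then have nT: "(i, k) \<notin> (adj (\<phi> ` T))\<^sup>*"
        using path_imp_has_cycle_insert_edge[of i k "\<phi> ` T"] acyc ik by auto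
      have "\<exists>a b. (i, a) \<in> (adj (\<phi> ` T))\<^sup>* \<and> (a, b) \<in> adj (\<phi> ` F) \<and> (i, b) \<notin> (adj (\<phi> ` T))\<^sup>*"
      proof (rule ccontr)
        assume no: "\<not> ?thesis"
        from p have "(i, k) \<in> (adj (\<phi> ` T))\<^sup>*"
          by (induction rule: rtrancl_induct) (use no in auto)
        then show False using nT by simp
      qed
      then obtain a b where ab: "(i, a) \<in> (adj (\<phi> ` T))\<^sup>*" "(a, b) \<in> adj (\<phi> ` F)"
        "(i, b) \<notin> (adj (\<phi> ` T))\<^sup>*" by auto
      then obtain f where f: "f \<in> F" "\<phi> f = {a, b}" by (auto simp: adj_def)
      have nab: "(a, b) \<notin> (adj (\<phi> ` T))\<^sup>*" using ab by (meson rtrancl_trans)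
      then have "f \<notin> T" using f(2) by (auto simp: adj_def)
      moreover have "\<not> has_cycle (\<phi> ` insert f T)"
        using has_cycle_insert_edge_imp_path[of a b "\<phi> ` T"] nab f(2) acyc(1)
          has_cycle_mono[of "\<phi> ` T" "insert {i, k} (\<phi> ` T)"] by auto
      ultimately show "\<exists>f\<in>F - T. indep ?M (insert f T)"
        using f FE acyc(2) by (auto simp: graphic_matroid_def)
    qed
  qed
  then show ?R using FE by blast
next
  assume R: ?R
  show "flat ?M F"
  proof (rule flatI_augment)
    show "finite (ground ?M)" "indep ?M {}" "F \<subseteq> ground ?M"
      using E R by (auto simp: graphic_matroid_def not_has_cycle_empty)
    fix e T assume e: "e \<in> ground ?M - F" and T: "T \<subseteq> F" "indep ?M T"
    then have eE: "e \<in> E" and Tc: "\<not> has_cycle (\<phi> ` T)" "T \<subseteq> E" by (auto simp: graphic_matroid_def)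
    obtain i k where ik: "\<phi> e = {i, k}" using E(3)[OF eE] by (auto simp: card_2_iff)
    have "adj (\<phi> ` T) \<subseteq> adj (\<phi> ` F)" using T by (auto simp: adj_def)
    then have "(i, k) \<notin> (adj (\<phi> ` T))\<^sup>*" using R e eE ik rtrancl_mono by blast
    then have "\<not> has_cycle (\<phi> ` insert e T)"
      using has_cycle_insert_edge_imp_path[of i k "\<phi> ` T"] Tc ik by auto
    then show "indep ?M (insert e T)" using eE Tc by (simp add: graphic_matroid_def)
  qed
qed

lemma flat_direct_sum_rank_one_iff:
  assumes fin: "finite (\<Union>a\<in>I. D a)" and disj: "disjoint_family_on D I"
  shows "flat (direct_sum_matroid I (\<lambda>a. uniform_matroid 1 (D a))) F \<longleftrightarrow>
    F \<subseteq> (\<Union>a\<in>I. D a) \<and> (\<forall>a\<in>I. D a \<subseteq> F \<or> D a \<inter> F = {})"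
    (is "flat ?M F \<longleftrightarrow> ?R")
proof -
  have finD: "finite (D a)" if "a \<in> I" for a
    using fin that by (meson UN_upper finite_subset)
  have ind: "indep ?M T \<longleftrightarrow> T \<subseteq> (\<Union>a\<in>I. D a) \<and> (\<forall>a\<in>I. \<forall>x\<in>T \<inter> D a. \<forall>y\<in>T \<inter> D a. x = y)" for T
    using finD by (auto simp: direct_sum_matroid_def uniform_matroid_def card_le_Suc0_iff_eq)
  have gr: "ground ?M = (\<Union>a\<in>I. D a)"
    by (simp add: direct_sum_matroid_def uniform_matroid_def)
  have same: "a = b" if "x \<in> D a" "x \<in> D b" "a \<in> I" "b \<in> I" for a b x
    using disj that by (auto simp: disjoint_family_on_def)
  show ?thesis
  proof
    assume fl: "flat ?M F"
    have "D a \<subseteq> F" if a: "a \<in> I" and x: "x \<in> D a" "x \<in> F" for a x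
    proof (rule ccontr)
      assume "\<not> D a \<subseteq> F"
      then obtain e where e: "e \<in> D a" "e \<notin> F" by auto
      show False
      proof (rule flatD_exchange[OF _ _ fl])
        show "finite (ground ?M)" "indep ?M {}" "e \<in> ground ?M - F"
          using fin gr ind e a by auto
        fix T assume T: "T \<subseteq> F" "indep ?M (insert e T)"
        then have T': "T \<subseteq> (\<Union>a\<in>I. D a)" unfolding ind by simp
        have u: "y = z" if "b \<in> I" "y \<in> insert e T \<inter> D b" "z \<in> insert e T \<inter> D b" for b y z
          using T(2) that unfolding ind by (meson bspec)
        have Ta: "z \<notin> D a" if "z \<in> T" for z
          using u[OF a, of z e] that e T(1) by auto
        then have "x \<notin> T" using x by auto
        moreover have "indep ?M (insert x T)"
          unfolding ind
        proof (intro conjI ballI)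
          show "insert x T \<subseteq> (\<Union>a\<in>I. D a)" using T' x a by auto
          fix b y z assume b: "b \<in> I" and yz: "y \<in> insert x T \<inter> D b" "z \<in> insert x T \<inter> D b"
          show "y = z"
          proof (cases "b = a")
            case True then show ?thesis using yz Ta by auto
          next
            case False
            then have "x \<notin> D b" using same[OF x(1) _ a b] by auto
            then show ?thesis using u[OF b, of y z] yz by auto
          qed
        qed
        ultimately show "\<exists>f\<in>F - T. indep ?M (insert f T)" using x by auto
      qed
    qed
    then show ?R using fl gr by (auto simp: flat_def)
  next
    assume R: ?R
    show "flat ?M F"
    proof (rule flatI_augment)
      show "finite (ground ?M)" "indep ?M {}" "F \<subseteq> ground ?M" using fin R gr ind by auto
      fix e T assume e: "e \<in> ground ?M - F" and T: "T \<subseteq> F" "indep ?M T"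
      then obtain a where a: "a \<in> I" "e \<in> D a" using gr by auto
      have "D a \<inter> F = {}" using R e a by auto
      then have Ta: "z \<notin> D a" if "z \<in> T" for z using T(1) that by auto
      have T': "T \<subseteq> (\<Union>a\<in>I. D a)" using T(2) unfolding ind by simp
      have u: "y = z" if "b \<in> I" "y \<in> T \<inter> D b" "z \<in> T \<inter> D b" for b y z
        using T(2) that unfolding ind by (meson bspec)
      show "indep ?M (insert e T)"
        unfolding ind
      proof (intro conjI ballI)
        show "insert e T \<subseteq> (\<Union>a\<in>I. D a)" using T' a by auto
        fix b y z assume b: "b \<in> I" and yz: "y \<in> insert e T \<inter> D b" "z \<in> insert e T \<inter> D b"
        show "y = z"
        proof (cases "b = a")
          case True then show ?thesis using yz Ta by auto
        next
          case False
          then have "e \<notin> D b" using same[OF a(2) _ a(1) b] by auto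
          then show ?thesis using u[OF b, of y z] yz by auto
        qed
      qed
    qed
  qed
qed

section \<open>Chains of sets and their gap function\<close>

text \<open>
  The jump of \<open>x\<close> from \<open>E - F\<close> up to \<open>F - F0\<close>, or $0$ if there is none.  The set \<open>F0\<close> is to be
  thought of as the set where \<open>x\<close> is infinite.
\<close>

definition gap :: "'e set \<Rightarrow> 'e set \<Rightarrow> ('e \<Rightarrow> real) \<Rightarrow> 'e set \<Rightarrow> real" where
  "gap E F0 x F = max 0 (Min (x ` (F - F0)) - Max (x ` (E - F)))"

text \<open>
  Choose \<open>J\<close> in \<open>F\<close> outside all smaller members of the chain, and \<open>K\<close> outside \<open>F\<close> but inside all
  larger members.  They attain the minimum on \<open>F\<close> and, if \<open>F\<close> is a member, the maximum outside it;
  their values then differ exactly by the coefficient of \<open>F\<close>.  If \<open>F\<close> is not a member, then \<open>K\<close> lies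
  in all members that contain \<open>J\<close>, and there is no jump.
\<close>

lemma gap_of_chain_sum:
  fixes x :: "'e \<Rightarrow> real"
  assumes E: "finite E" and A: "finite A" "subset.chain UNIV A"
    and between: "\<And>F. F \<in> A \<Longrightarrow> F0 \<subset> F \<and> F \<subset> E"
    and pos: "\<And>F. F \<in> A \<Longrightarrow> 0 \<le> \<kappa> F"
    and x: "\<And>J. J \<in> E - F0 \<Longrightarrow> x J = c + (\<Sum>F\<in>A. if J \<in> F then \<kappa> F else 0)"
    and F: "F0 \<subset> F" "F \<subset> E"
  shows "gap E F0 x F = (if F \<in> A then \<kappa> F else 0)"
proof -
  define N where "N J = {G \<in> A. J \<in> G}" for J
  have xN: "x J = c + sum \<kappa> (N J)" if "J \<in> E - F0" for J
    unfolding x[OF that] N_def using A(1) by (simp add: sum.inter_filter)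
  have mono: "x J \<le> x K" if "J \<in> E - F0" "K \<in> E - F0" "N J \<subseteq> N K" for J K
    using xN[OF that(1)] xN[OF that(2)] A(1) pos that(3)
    by (auto intro!: sum_mono2 simp: N_def)
  have ch: "G \<subseteq> H \<or> H \<subseteq> G" if "G \<in> A" "H \<in> A" for G H
    using A(2) that unfolding subset_chain_def by auto
  define lo where "lo = {G \<in> A. \<not> F \<subseteq> G}"
  define hi where "hi = {G \<in> A. F \<subset> G}"
  have lohi: "finite lo" "finite hi" "subset.chain UNIV lo" "subset.chain UNIV hi"
    using A unfolding lo_def hi_def subset_chain_def by auto
  obtain J where J: "J \<in> F - F0" "\<And>G. G \<in> lo \<Longrightarrow> J \<notin> G"
  proof (cases "lo = {}")
    case True then show ?thesis using F that by auto
  next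
    case False
    have "\<Union>lo \<in> lo" using Union_in_chain[OF lohi(1) False lohi(3)] .
    then have "\<not> F \<subseteq> \<Union>lo" "F0 \<subset> \<Union>lo" using between by (auto simp: lo_def)
    then obtain J where "J \<in> F" "J \<notin> \<Union>lo" by auto
    then show ?thesis using that[of J] \<open>F0 \<subset> \<Union>lo\<close> by blast
  qed
  obtain K where K: "K \<in> E - F" "\<And>G. G \<in> hi \<Longrightarrow> K \<in> G"
  proof (cases "hi = {}")
    case True then show ?thesis using F that by auto
  next
    case False
    have "\<Inter>hi \<in> hi" using Inter_in_chain[OF lohi(2) False lohi(4)] .
    then have "F \<subset> \<Inter>hi" "\<Inter>hi \<subset> E" using between by (auto simp: hi_def)
    then obtain K where "K \<in> \<Inter>hi" "K \<notin> F" by auto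
    then show ?thesis using that[of K] \<open>\<Inter>hi \<subset> E\<close> by blast
  qed
  have NJ: "N J = hi \<union> (if F \<in> A then {F} else {})"
    using J by (auto simp: N_def hi_def lo_def)
  have JE: "J \<in> E - F0" and KE: "K \<in> E - F0" using J K F by auto
  have minJ: "x J \<le> x J'" if "J' \<in> F - F0" for J'
    using that J F NJ by (intro mono) (auto simp: N_def hi_def split: if_splits)
  have Min: "Min (x ` (F - F0)) = x J"
    using J minJ finite_subset[OF _ E, of F] F by (intro Min_eqI) auto
  show ?thesis
  proof (cases "F \<in> A")
    case True
    have low: "N K' \<subseteq> hi" if "K' \<in> E - F" for K'
    proof
      fix G assume "G \<in> N K'"
      then have "G \<in> A" "K' \<in> G" by (auto simp: N_def)
      then show "G \<in> hi" using ch[OF True \<open>G \<in> A\<close>] that by (auto simp: hi_def)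
    qed
    have NK: "N K = hi" using low[OF K(1)] K(2) by (auto simp: N_def hi_def)
    have maxK: "x K' \<le> x K" if "K' \<in> E - F" for K'
      using that KE low[OF that] NK F by (intro mono) auto
    have Max: "Max (x ` (E - F)) = x K"
      using K maxK E by (intro Max_eqI) auto
    have "F \<notin> hi" by (auto simp: hi_def)
    then have "x J - x K = \<kappa> F"
      using xN[OF JE] xN[OF KE] NJ NK True lohi(2) by simp
    then show ?thesis using Min Max True pos[OF True] by (simp add: gap_def)
  next
    case False
    then have "x J \<le> x K"
      using J K F NJ by (intro mono) (auto simp: N_def hi_def)
    also have "x K \<le> Max (x ` (E - F))" using K E by (intro Max_ge) auto
    finally show ?thesis using Min False by (simp add: gap_def)
  qed
qed

text \<open>
  Split off the set where \<open>x\<close> exceeds its minimum, with the first jump as coefficient, and apply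
  induction to that set.
\<close>

lemma superlevel_decomposition:
  fixes x :: "'e \<Rightarrow> real"
  assumes "finite E" "E \<noteq> {}"
  shows "\<exists>A \<kappa>. finite A \<and> subset.chain UNIV A \<and> (\<forall>F. 0 \<le> \<kappa> F) \<and>
           (\<forall>F\<in>A. F \<noteq> {} \<and> F \<subset> E \<and> (\<exists>s. F = {J \<in> E. s \<le> x J})) \<and>
           (\<forall>J\<in>E. x J = Min (x ` E) + (\<Sum>F\<in>A. if J \<in> F then \<kappa> F else 0))"
  using assms
proof (induction "card E" arbitrary: E rule: less_induct)
  case less
  define m where "m = Min (x ` E)"
  have m: "\<And>J. J \<in> E \<Longrightarrow> m \<le> x J" "m \<in> x ` E"
    using less.prems by (auto simp: m_def)
  define D where "D = {J \<in> E. m < x J}"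
  have DE: "D \<subset> E" using m by (auto simp: D_def)
  show ?case
  proof (cases "D = {}")
    case True
    then have "x J = m" if "J \<in> E" for J using m(1)[OF that] that by (force simp: D_def)
    then show ?thesis
      by (intro exI[of _ "{}"] exI[of _ "\<lambda>_. 0"]) (auto simp: m_def subset_chain_def)
  next
    case False
    have finD: "finite D" using DE less.prems finite_subset by auto
    from less.hyps[OF psubset_card_mono[OF less.prems(1) DE] finD False]
    obtain A \<kappa> where IH: "finite A \<and> subset.chain UNIV A \<and> (\<forall>F. 0 \<le> \<kappa> F) \<and>
        (\<forall>F\<in>A. F \<noteq> {} \<and> F \<subset> D \<and> (\<exists>s. F = {J \<in> D. s \<le> x J})) \<and>
        (\<forall>J\<in>D. x J = Min (x ` D) + (\<Sum>F\<in>A. if J \<in> F then \<kappa> F else 0))"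
      by (elim exE)
    from IH have A: "finite A" "subset.chain UNIV A" "\<forall>F. 0 \<le> \<kappa> F"
      and AF: "\<And>F. F \<in> A \<Longrightarrow> F \<noteq> {} \<and> F \<subset> D \<and> (\<exists>s. F = {J \<in> D. s \<le> x J})"
      and xD: "\<And>J. J \<in> D \<Longrightarrow> x J = Min (x ` D) + (\<Sum>F\<in>A. if J \<in> F then \<kappa> F else 0)"
      by (elim conjE, blast)+
    \<comment> \<open>The second smallest value of \<open>x\<close>; the set \<open>D\<close> receives the coefficient \<open>m' - m\<close>.\<close>
    define m' where "m' = Min (x ` D)"
    have m': "m' \<in> x ` D" "\<And>J. J \<in> D \<Longrightarrow> m' \<le> x J"
      using finD False by (auto simp: m'_def)
    have mm': "m < m'" using m'(1) by (auto simp: D_def)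
    have DA: "D \<notin> A" using AF by auto
    let ?\<mu> = "\<lambda>F. if F = D then m' - m else \<kappa> F"
    have lev: "\<exists>s. F = {J \<in> E. s \<le> x J}" if "F \<in> insert D A" for F
    proof (cases "F = D")
      case True
      then have "F = {J \<in> E. m' \<le> x J}" using m'(2) mm' by (auto simp: D_def)
      then show ?thesis by blast
    next
      case False
      then have "F \<in> A" using that by auto
      then obtain s where "F = {J \<in> D. s \<le> x J}" using AF by blast
      then have "F = {J \<in> E. max s m' \<le> x J}" using m'(2) mm' by (auto simp: D_def)
      then show ?thesis by blast
    qed
    have sum: "x J = m + (\<Sum>F\<in>insert D A. if J \<in> F then ?\<mu> F else 0)" if J: "J \<in> E" for J
    proof (cases "J \<in> D")
      case True
      have "(\<Sum>F\<in>A. if J \<in> F then ?\<mu> F else 0) = (\<Sum>F\<in>A. if J \<in> F then \<kappa> F else 0)"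
        using DA by (intro sum.cong) auto
      then show ?thesis using xD[OF True] A(1) DA True by (simp add: m'_def)
    next
      case False
      then have "J \<notin> F" if "F \<in> insert D A" for F using that AF by auto
      then have "(\<Sum>F\<in>insert D A. if J \<in> F then ?\<mu> F else 0) = 0"
        by (intro sum.neutral) auto
      moreover have "x J = m" using False J m(1)[OF J] by (auto simp: D_def)
      ultimately show ?thesis by simp
    qed
    have AD: "F \<subseteq> D" if "F \<in> A" for F using AF[OF that] by auto
    have ch: "subset.chain UNIV (insert D A)"
      using A(2) AD by (simp add: subset_chain_def)
    show ?thesis
    proof (intro exI[of _ "insert D A"] exI[of _ ?\<mu>] conjI ballI allI)
      show "finite (insert D A)" "subset.chain UNIV (insert D A)" using A ch by auto
      show "0 \<le> ?\<mu> F" for F using A(3) mm' by auto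
      show "x J = Min (x ` E) + (\<Sum>F\<in>insert D A. if J \<in> F then ?\<mu> F else 0)" if "J \<in> E" for J
        using sum[OF that] by (simp add: m_def)
      fix F assume F: "F \<in> insert D A"
      show "\<exists>s. F = {J \<in> E. s \<le> x J}" by (rule lev[OF F])
      have "F \<noteq> {} \<and> F \<subseteq> D" using F AF[of F] False by blast
      then show "F \<noteq> {}" "F \<subset> E" using DE by auto
    qed
  qed
qed

lemma sorted_wrt_psubset_of_chain:
  assumes "finite A" "subset.chain UNIV A"
  shows "\<exists>xs. set xs = A \<and> sorted_wrt (\<subset>) xs"
  using assms
proof (induction "card A" arbitrary: A)
  case 0 then show ?case by (intro exI[of _ "[]"]) auto
next
  case (Suc n)
  let ?U = "\<Union>A"
  have U: "?U \<in> A" using Union_in_chain[of A UNIV] Suc.hyps(2) Suc.prems by (metis card.empty nat.distinct(1))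
  have "card (A - {?U}) = n" using Suc U by simp
  moreover have "subset.chain UNIV (A - {?U})" using Suc.prems(2) unfolding subset_chain_def by blast
  ultimately obtain xs where xs: "set xs = A - {?U}" "sorted_wrt (\<subset>) xs"
    using Suc.hyps(1)[of "A - {?U}"] Suc.prems by auto
  then have "set (xs @ [?U]) = A" "sorted_wrt (\<subset>) (xs @ [?U])"
    using U by (auto simp: sorted_wrt_append)
  then show ?case by blast
qed

lemma sorted_wrt_psubset_unique:
  assumes "sorted_wrt (\<subset>) xs" "sorted_wrt (\<subset>) ys" "set xs = set ys"
  shows "xs = ys"
  using assms
proof (induction xs arbitrary: ys)
  case Nil then show ?case by simp
next
  case (Cons x xs)
  obtain y zs where ys: "ys = y # zs" using Cons.prems(3) by (cases ys) auto
  have "x = y"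
  proof (rule ccontr)
    assume "x \<noteq> y"
    then have "y \<in> set xs" "x \<in> set zs" using Cons.prems(3) ys by auto
    then have "y \<subset> x" "x \<subset> y" using Cons.prems(1,2) ys by auto
    then show False by blast
  qed
  moreover have "x \<notin> set xs" "y \<notin> set zs" using Cons.prems(1,2) ys by auto
  moreover have "insert x (set xs) = insert y (set zs)" using Cons.prems(3) ys by simp
  ultimately have "set xs = set zs" by (metis insert_ident)
  then have "xs = zs" using Cons.IH[of zs] Cons.prems(1,2) ys by simp
  then show ?case using ys \<open>x = y\<close> by simp
qed

lemma chain_set_of_sorted_wrt:
  assumes "sorted_wrt (\<subset>) xs"
  shows "subset.chain UNIV (set xs)"
  using assms
proof (induction xs)
  case Nil then show ?case by (simp add: subset_chain_def)
next
  case (Cons x xs)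
  then have "subset.chain UNIV (set xs)" "\<And>y. y \<in> set xs \<Longrightarrow> x \<subseteq> y" by auto
  then show ?case by (simp add: subset_chain_def)
qed

section \<open>Simplicial fans with a lineality space\<close>

text \<open>
  The generators are indexed, rather than given as a set, since the index set is the combinatorial datum
  that is to be recovered from the cone.
\<close>

definition simplicial_cone :: "'a::real_vector set \<Rightarrow> ('b \<Rightarrow> 'a) \<Rightarrow> 'b set \<Rightarrow> 'a set" where
  "simplicial_cone L g A = {l + (\<Sum>b\<in>A. \<kappa> b *\<^sub>R g b) | l \<kappa>. l \<in> L \<and> (\<forall>b. \<kappa> b \<ge> 0)}"

lemma convex_cone_hull_image:
  fixes g :: "'b \<Rightarrow> 'a::real_vector"
  assumes "finite A"
  shows "convex_cone hull (g ` A) = {\<Sum>b\<in>A. \<kappa> b *\<^sub>R g b | \<kappa>. \<forall>b. \<kappa> b \<ge> (0::real)}"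
    (is "_ = ?R")
proof
  show "convex_cone hull (g ` A) \<subseteq> ?R"
  proof (rule hull_minimal)
    show "g ` A \<subseteq> ?R"
    proof (safe)
      fix b assume b: "b \<in> A"
      have "g b = (\<Sum>c\<in>A. (if c = b then 1 else 0) *\<^sub>R g c)"
        using b assms by (simp add: if_distrib[of "\<lambda>r. r *\<^sub>R _"] cong: if_cong)
      then show "\<exists>\<kappa>. g b = (\<Sum>c\<in>A. \<kappa> c *\<^sub>R g c) \<and> (\<forall>c. \<kappa> c \<ge> (0::real))"
        by (intro exI[of _ "\<lambda>c. if c = b then 1 else 0"]) auto
    qed
    have add: "x + y \<in> ?R" if xy: "x \<in> ?R" "y \<in> ?R" for x y
    proof -
      obtain \<kappa> \<mu> where "x = (\<Sum>b\<in>A. \<kappa> b *\<^sub>R g b)" "y = (\<Sum>b\<in>A. \<mu> b *\<^sub>R g b)"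
        "\<forall>b. \<kappa> b \<ge> (0::real)" "\<forall>b. \<mu> b \<ge> (0::real)"
        using xy by blast
      then show ?thesis
        by (auto intro!: exI[of _ "\<lambda>b. \<kappa> b + \<mu> b"] simp: scaleR_left_distrib sum.distrib)
    qed
    have scale: "c *\<^sub>R x \<in> ?R" if cx: "c \<ge> 0" "x \<in> ?R" for c x
    proof -
      obtain \<kappa> where "x = (\<Sum>b\<in>A. \<kappa> b *\<^sub>R g b)" "\<forall>b. \<kappa> b \<ge> (0::real)"
        using cx by blast
      then show ?thesis
        using cx(1) by (auto intro!: exI[of _ "\<lambda>b. c * \<kappa> b"] simp: scaleR_right.sum)
    qed
    have "?R \<noteq> {}" by (auto intro!: exI[of _ "\<lambda>b. 0"])
    then show "convex_cone ?R"
      unfolding convex_cone_iff using add scale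
      by (metis (no_types, lifting) ex_in_conv order_refl scaleR_eq_0_iff)
  qed
  show "?R \<subseteq> convex_cone hull (g ` A)"
  proof safe
    fix \<kappa> :: "'b \<Rightarrow> real" assume l: "\<forall>b. \<kappa> b \<ge> 0"
    have "(\<Sum>b\<in>B. \<kappa> b *\<^sub>R g b) \<in> convex_cone hull (g ` A)" if "B \<subseteq> A" "finite B" for B
      using that(2,1)
      by induction (auto simp: convex_cone_hull_contains_0 l
          intro!: convex_cone_hull_add convex_cone_hull_mul intro: hull_inc)
    from this[OF subset_refl assms]
    show "(\<Sum>b\<in>A. \<kappa> b *\<^sub>R g b) \<in> convex_cone hull (g ` A)" .
  qed
qed

lemma simplicial_cone_hull:
  assumes "subspace L" "finite A"
  shows "simplicial_cone L g A = convex_cone hull (L \<union> g ` A)"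
proof -
  have "convex_cone hull L = L"
    using assms(1) by (intro hull_same) (rule subspace_imp_convex_cone)
  then show ?thesis
    unfolding convex_cone_hull_Un convex_cone_hull_image[OF assms(2)] simplicial_cone_def by auto
qed

text \<open>
  A subspace is finitely generated as a cone, by a basis and its negative.
\<close>

lemma polyhedron_simplicial_cone:
  fixes L :: "'a::euclidean_space set"
  assumes "subspace L" "finite A"
  shows "polyhedron (simplicial_cone L g A)"
proof -
  obtain B where B: "B \<subseteq> L" "finite B" "span B = L"
    using assms(1) by (metis basis_exists finiteI_independent span_subspace)
  have *: "L = convex_cone hull (B \<union> uminus ` B)"
  proof
    show "convex_cone hull (B \<union> uminus ` B) \<subseteq> L"
      using B assms(1) by (intro hull_minimal subspace_imp_convex_cone) (auto simp: subspace_neg)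
    have "span B \<subseteq> convex_cone hull (B \<union> uminus ` B)"
    proof (rule span_minimal)
      show "subspace (convex_cone hull (B \<union> uminus ` B))"
        unfolding subspace_convex_cone_symmetric
      proof (intro conjI allI impI)
        show "convex_cone (convex_cone hull (B \<union> uminus ` B))"
          by (rule convex_cone_convex_cone_hull)
        have lin: "linear (uminus :: 'a \<Rightarrow> 'a)"
          by (simp add: linear_iff)
        have "uminus ` (convex_cone hull (B \<union> uminus ` B)) = convex_cone hull (B \<union> uminus ` B)"
          by (subst convex_cone_hull_linear_image[OF lin, symmetric])
             (simp add: image_Un image_image Un_commute)
        then show "\<forall>x \<in> convex_cone hull (B \<union> uminus ` B). - x \<in> convex_cone hull (B \<union> uminus ` B)"
          by blast
      qed
    qed (auto intro: hull_inc)
    then show "L \<subseteq> convex_cone hull (B \<union> uminus ` B)" using B by simp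
  qed
  have "simplicial_cone L g A = convex_cone hull ((B \<union> uminus ` B) \<union> g ` A)"
    unfolding simplicial_cone_hull[OF assms]
    by (metis "*" convex_cone_hull_Un hull_hull)
  moreover have "finite ((B \<union> uminus ` B) \<union> g ` A)" using B assms by simp
  ultimately show ?thesis using polyhedron_convex_cone_hull by metis
qed

text \<open>
  In a cone, $x + y$ is the midpoint of $2x$ and $2y$; so a face that contains a sum contains
  both summands.
\<close>

lemma face_of_cone_summands:
  fixes C :: "'a::real_vector set"
  assumes C: "convex_cone C" and F: "F face_of C" and "x \<in> C" "y \<in> C" "x + y \<in> F"
  shows "x \<in> F" "y \<in> F"
proof -
  have "x \<in> F \<and> y \<in> F"
  proof -
    have 2: "2 *\<^sub>R x \<in> C" "2 *\<^sub>R y \<in> C" "2 *\<^sub>R (x + y) \<in> C" "0 \<in> C"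
      using assms convex_cone_scaleR[OF C] convex_cone_contains_0[OF C]
       convex_cone_add[OF C] by auto
    have mid: "u \<in> F \<and> v \<in> F" if "u \<in> C" "v \<in> C" "(1/2) *\<^sub>R u + (1/2) *\<^sub>R v \<in> F" for u v
    proof (cases "u = v")
      case True then show ?thesis using that by (simp flip: scaleR_left_distrib)
    next
      case False
      then have "(1/2) *\<^sub>R u + (1/2) *\<^sub>R v \<in> open_segment u v"
        unfolding in_segment by (auto intro!: exI[of _ "1/2"])
      then show ?thesis using F that unfolding face_of_def by blast
    qed
    have xy: "2 *\<^sub>R x \<in> F" "2 *\<^sub>R y \<in> F"
      using mid[OF 2(1,2)] assms(5) by auto
    have z: "0 \<in> F" using mid[OF 2(3,4)] assms(5) by auto
    have cF: "convex F" using F by (simp add: face_of_def)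
    show ?thesis
      using convexD[OF cF xy(1) z, of "1/2" "1/2"] convexD[OF cF xy(2) z, of "1/2" "1/2"] by simp
  qed
  then show "x \<in> F" "y \<in> F" by auto
qed

lemma convex_cone_simplicial_cone:
  assumes "subspace L" "finite A"
  shows "convex_cone (simplicial_cone L g A)"
  unfolding simplicial_cone_hull[OF assms] by (rule convex_cone_convex_cone_hull)

lemma simplicial_cone_mono:
  assumes "B \<subseteq> A" "finite A"
  shows "simplicial_cone L g B \<subseteq> simplicial_cone L g A"
proof
  fix x assume "x \<in> simplicial_cone L g B"
  then obtain l \<kappa> where x: "x = l + (\<Sum>b\<in>B. \<kappa> b *\<^sub>R g b)" "l \<in> L" "\<forall>b. \<kappa> b \<ge> 0"
    unfolding simplicial_cone_def by auto
  have "(\<Sum>b\<in>B. \<kappa> b *\<^sub>R g b) = (\<Sum>b\<in>A. (if b \<in> B then \<kappa> b else 0) *\<^sub>R g b)"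
    using assms by (intro sum.mono_neutral_cong_left) auto
  then show "x \<in> simplicial_cone L g A"
    unfolding simplicial_cone_def using x
    by (auto intro!: exI[of _ l] exI[of _ "\<lambda>b. if b \<in> B then \<kappa> b else 0"])
qed

text \<open>
  A nonempty face contains the lineality space and is generated by the generators that lie in it: if
  a generator occurs with a positive coefficient in a point of the face, then it is a summand of that
  point up to scaling.
\<close>

lemma face_of_simplicial_cone:
  assumes L: "subspace L" and A: "finite A"
    and F: "F face_of simplicial_cone L g A" "F \<noteq> {}"
  shows "\<exists>B\<subseteq>A. F = simplicial_cone L g B"
proof -
  let ?C = "simplicial_cone L g A"
  have C: "convex_cone ?C" using convex_cone_simplicial_cone[OF L A] .
  have FC: "F \<subseteq> ?C" using F by (simp add: face_of_def)
  have LC: "L \<subseteq> ?C" "\<And>b. b \<in> A \<Longrightarrow> g b \<in> ?C"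
    unfolding simplicial_cone_hull[OF L A] by (auto intro: hull_inc)
  obtain p where p: "p \<in> F" using F by auto
  have z: "0 \<in> F"
    using face_of_cone_summands(1)[OF C F(1), of 0 p] convex_cone_contains_0[OF C] FC p by auto
  have cF: "convex F" using F by (simp add: face_of_def)
  have scl: "c *\<^sub>R x \<in> F" if x: "x \<in> F" and c: "c \<ge> 0" for c x
  proof (cases "c \<le> 1")
    case True
    show ?thesis using convexD[OF cF x z, of c "1 - c"] c True by simp
  next
    case False
    define d where "d = 1 / c"
    have d: "d \<ge> 0" "d \<le> 1" using False by (auto simp: d_def)
    have xC: "x \<in> ?C" using x FC by auto
    show ?thesis
    proof -
      have cx: "c *\<^sub>R x \<in> ?C" using convex_cone_scaleR[OF C c xC] .
      have "d *\<^sub>R (c *\<^sub>R x) + (1 - d) *\<^sub>R 0 \<in> F" using x False by (simp add: d_def)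
      have 1: "c *\<^sub>R x \<noteq> 0 \<Longrightarrow> x \<in> open_segment 0 (c *\<^sub>R x)"
        unfolding in_segment using False by (auto intro!: exI[of _ d] simp: d_def)
      have 0: "0 \<in> ?C" using convex_cone_contains_0[OF C] .
      show ?thesis
      proof (cases "c *\<^sub>R x = 0")
        case True then show ?thesis using z by (simp only: True)
      next
        case False
        show ?thesis using F(1) 1[OF False] 0 cx x unfolding face_of_def by blast
      qed
    qed
  qed
  have addF: "x + y \<in> F" if "x \<in> F" "y \<in> F" for x y
    using scl[of "(1/2) *\<^sub>R x + (1/2) *\<^sub>R y" 2] convexD[OF cF that, of "1/2" "1/2"]
    by (simp add: scaleR_right_distrib)
  have LF: "L \<subseteq> F"
  proof
    fix l assume "l \<in> L"
    then show "l \<in> F"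
      using face_of_cone_summands(1)[OF C F(1), of l "- l"] z LC(1) subspace_neg[OF L, of l] by auto
  qed
  define B where "B = {b \<in> A. g b \<in> F}"
  have "F \<subseteq> simplicial_cone L g B"
  proof
    fix x assume x: "x \<in> F"
    then obtain l \<kappa> where lx: "x = l + (\<Sum>b\<in>A. \<kappa> b *\<^sub>R g b)" "l \<in> L" "\<forall>b. \<kappa> b \<ge> 0"
      using FC unfolding simplicial_cone_def by auto
    have "\<kappa> b = 0" if b: "b \<in> A - B" for b
    proof (rule ccontr)
      assume nz: "\<kappa> b \<noteq> 0"
      have eq: "x = \<kappa> b *\<^sub>R g b + (l + (\<Sum>b\<in>A - {b}. \<kappa> b *\<^sub>R g b))"
        using lx(1) b sum.remove[OF A, of b "\<lambda>b. \<kappa> b *\<^sub>R g b"] by simp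
      have "l + (\<Sum>b\<in>A - {b}. \<kappa> b *\<^sub>R g b) \<in> simplicial_cone L g (A - {b})"
        unfolding simplicial_cone_def using lx by auto
      then have "l + (\<Sum>b\<in>A - {b}. \<kappa> b *\<^sub>R g b) \<in> ?C"
        using simplicial_cone_mono[of "A - {b}" A] A by auto
      then have "\<kappa> b *\<^sub>R g b \<in> F"
        using face_of_cone_summands(1)[OF C F(1)] convex_cone_scaleR[OF C] LC(2) b lx(3) x eq
        by (metis DiffD1)
      then have "g b \<in> F"
        using scl[of "\<kappa> b *\<^sub>R g b" "1 / \<kappa> b"] nz lx(3) by simp
      then show False using b by (simp add: B_def)
    qed
    then have "(\<Sum>b\<in>A. \<kappa> b *\<^sub>R g b) = (\<Sum>b\<in>B. \<kappa> b *\<^sub>R g b)"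
      using A by (intro sum.mono_neutral_right) (auto simp: B_def)
    then show "x \<in> simplicial_cone L g B"
      unfolding simplicial_cone_def using lx by auto
  qed
  moreover have "simplicial_cone L g B \<subseteq> F"
  proof -
    have "convex_cone F" unfolding convex_cone_iff using addF scl z by auto
    moreover have "L \<union> g ` B \<subseteq> F" using LF by (auto simp: B_def)
    moreover have "finite B" using A by (simp add: B_def)
    ultimately show ?thesis
      unfolding simplicial_cone_hull[OF L \<open>finite B\<close>] by (intro hull_minimal)
  qed
  ultimately show ?thesis by (intro exI[of _ B]) (auto simp: B_def)
qed

text \<open>
  An abstract simplicial complex \<open>\<A>\<close> of index sets, such that the coefficients of a point are determined
  modulo \<open>L\<close>, even when two representations use different members of \<open>\<A>\<close>.
\<close>

locale simplicial_fan =
  fixes L :: "'a::euclidean_space set" and g :: "'b \<Rightarrow> 'a" and \<A> :: "'b set set"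
  assumes L: "subspace L"
    and finA: "finite \<A>" "\<And>A. A \<in> \<A> \<Longrightarrow> finite A"
    and neA: "\<A> \<noteq> {}"
    and sub: "\<And>A B. A \<in> \<A> \<Longrightarrow> B \<subseteq> A \<Longrightarrow> B \<in> \<A>"
    and uniq: "\<And>A B \<kappa> \<mu> b. A \<in> \<A> \<Longrightarrow> B \<in> \<A> \<Longrightarrow> (\<And>b. 0 \<le> \<kappa> b) \<Longrightarrow> (\<And>b. 0 \<le> \<mu> b) \<Longrightarrow>
        (\<Sum>b\<in>A. \<kappa> b *\<^sub>R g b) - (\<Sum>b\<in>B. \<mu> b *\<^sub>R g b) \<in> L \<Longrightarrow> b \<in> A \<Longrightarrow>
        (if b \<in> B then \<kappa> b = \<mu> b else \<kappa> b = (0::real))"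
begin

abbreviation "cone_of \<equiv> simplicial_cone L g"

lemma cone_of_subset_iff:
  assumes A: "A \<in> \<A>" and B: "B \<in> \<A>" and le: "cone_of A \<subseteq> cone_of B"
  shows "A \<subseteq> B"
proof
  fix b assume b: "b \<in> A"
  have "(\<Sum>b\<in>A. 1 *\<^sub>R g b) \<in> cone_of A"
    unfolding simplicial_cone_def using subspace_0[OF L]
    by (auto intro!: exI[of _ 0] exI[of _ "\<lambda>_. 1"])
  then obtain l \<mu> where "(\<Sum>b\<in>A. 1 *\<^sub>R g b) = l + (\<Sum>b\<in>B. \<mu> b *\<^sub>R g b)" "l \<in> L" "\<forall>b. \<mu> b \<ge> 0"
    using le unfolding simplicial_cone_def by blast
  then show "b \<in> B"
    using uniq[OF A B, of "\<lambda>_. 1" \<mu> b] b by (auto split: if_splits)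
qed

lemma inj_on_cone_of: "inj_on cone_of \<A>"
  by (intro inj_onI) (simp add: cone_of_subset_iff subset_antisym)

lemma cone_of_Int:
  assumes A: "A \<in> \<A>" and B: "B \<in> \<A>"
  shows "cone_of A \<inter> cone_of B = cone_of (A \<inter> B)"
proof
  show "cone_of (A \<inter> B) \<subseteq> cone_of A \<inter> cone_of B"
    using simplicial_cone_mono finA A B by (metis Int_lower1 Int_lower2 le_inf_iff)
  show "cone_of A \<inter> cone_of B \<subseteq> cone_of (A \<inter> B)"
  proof
    fix x assume "x \<in> cone_of A \<inter> cone_of B"
    then have x: "x \<in> cone_of A" "x \<in> cone_of B" by auto
    obtain l \<kappa> where 1: "x = l + (\<Sum>b\<in>A. \<kappa> b *\<^sub>R g b)" "l \<in> L" "\<forall>b. \<kappa> b \<ge> 0"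
      using x(1) unfolding simplicial_cone_def by auto
    obtain l' \<mu> where 2: "x = l' + (\<Sum>b\<in>B. \<mu> b *\<^sub>R g b)" "l' \<in> L" "\<forall>b. \<mu> b \<ge> 0"
      using x(2) unfolding simplicial_cone_def by auto
    have "(\<Sum>b\<in>A. \<kappa> b *\<^sub>R g b) - (\<Sum>b\<in>B. \<mu> b *\<^sub>R g b) = l' - l"
      using 1(1) 2(1) by (simp add: algebra_simps)
    then have "(\<Sum>b\<in>A. \<kappa> b *\<^sub>R g b) - (\<Sum>b\<in>B. \<mu> b *\<^sub>R g b) \<in> L"
      using subspace_diff[OF L 2(2) 1(2)] by simp
    from uniq[OF A B _ _ this] 1(3) 2(3) have "\<kappa> b = 0" if "b \<in> A - B" for b
      using that by (metis DiffD1 DiffD2)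
    then have "(\<Sum>b\<in>A. \<kappa> b *\<^sub>R g b) = (\<Sum>b\<in>A \<inter> B. \<kappa> b *\<^sub>R g b)"
      using finA(2)[OF A] by (intro sum.mono_neutral_right) auto
    then show "x \<in> cone_of (A \<inter> B)"
      unfolding simplicial_cone_def using 1 by auto
  qed
qed

lemma subset_imp_face:
  assumes A: "A \<in> \<A>" and BA: "B \<subseteq> A"
  shows "cone_of B face_of cone_of A"
proof -
  have B: "B \<in> \<A>" using sub A BA .
  have "x \<in> cone_of B \<and> y \<in> cone_of B"
    if x: "x \<in> cone_of A" and y: "y \<in> cone_of A" and z: "z \<in> cone_of B"
      and seg: "z \<in> open_segment x y" for x y z
  proof -
    obtain l \<kappa> where 1: "x = l + (\<Sum>b\<in>A. \<kappa> b *\<^sub>R g b)" "l \<in> L" "\<forall>b. \<kappa> b \<ge> 0"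
      using x unfolding simplicial_cone_def by auto
    obtain l' \<mu> where 2: "y = l' + (\<Sum>b\<in>A. \<mu> b *\<^sub>R g b)" "l' \<in> L" "\<forall>b. \<mu> b \<ge> 0"
      using y unfolding simplicial_cone_def by auto
    obtain l'' \<nu> where 3: "z = l'' + (\<Sum>b\<in>B. \<nu> b *\<^sub>R g b)" "l'' \<in> L" "\<forall>b. \<nu> b \<ge> 0"
      using z unfolding simplicial_cone_def by auto
    obtain u where u: "0 < u" "u < 1" "z = (1 - u) *\<^sub>R x + u *\<^sub>R y"
      using seg unfolding in_segment by auto
    let ?\<rho> = "\<lambda>b. (1 - u) * \<kappa> b + u * \<mu> b"
    have "(\<Sum>b\<in>A. ?\<rho> b *\<^sub>R g b) = (1 - u) *\<^sub>R (\<Sum>b\<in>A. \<kappa> b *\<^sub>R g b) + u *\<^sub>R (\<Sum>b\<in>A. \<mu> b *\<^sub>R g b)"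
      by (simp add: scaleR_right.sum scaleR_left_distrib sum.distrib)
    moreover have "(\<Sum>b\<in>A. \<kappa> b *\<^sub>R g b) = x - l" "(\<Sum>b\<in>A. \<mu> b *\<^sub>R g b) = y - l'"
      "(\<Sum>b\<in>B. \<nu> b *\<^sub>R g b) = z - l''"
      using 1(1) 2(1) 3(1) by simp_all
    ultimately have "(\<Sum>b\<in>A. ?\<rho> b *\<^sub>R g b) - (\<Sum>b\<in>B. \<nu> b *\<^sub>R g b)
        = (1 - u) *\<^sub>R (x - l) + u *\<^sub>R (y - l') - (z - l'')"
      by simp
    also have "\<dots> = l'' - ((1 - u) *\<^sub>R l + u *\<^sub>R l')"
      unfolding u(3) by (simp add: algebra_simps)
    finally have "(\<Sum>b\<in>A. ?\<rho> b *\<^sub>R g b) - (\<Sum>b\<in>B. \<nu> b *\<^sub>R g b)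
        = l'' - ((1 - u) *\<^sub>R l + u *\<^sub>R l')" .
    moreover have "l'' - ((1 - u) *\<^sub>R l + u *\<^sub>R l') \<in> L"
      using 1 2 3 L by (intro subspace_diff subspace_add subspace_scale) auto
    ultimately have mem: "(\<Sum>b\<in>A. ?\<rho> b *\<^sub>R g b) - (\<Sum>b\<in>B. \<nu> b *\<^sub>R g b) \<in> L" by simp
    have "?\<rho> b = 0" if "b \<in> A - B" for b
      using uniq[OF A B _ _ mem, of b] that 1(3) 2(3) 3(3) u by auto
    moreover have "(1 - u) * \<kappa> b \<ge> 0" "u * \<mu> b \<ge> 0" for b using 1(3) 2(3) u by simp_all
    ultimately have "(1 - u) * \<kappa> b = 0 \<and> u * \<mu> b = 0" if "b \<in> A - B" for b
      using that by (simp add: add_nonneg_eq_0_iff)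
    then have zero: "\<kappa> b = 0 \<and> \<mu> b = 0" if "b \<in> A - B" for b
      using that u by simp
    have "(\<Sum>b\<in>A. \<kappa> b *\<^sub>R g b) = (\<Sum>b\<in>B. \<kappa> b *\<^sub>R g b)" "(\<Sum>b\<in>A. \<mu> b *\<^sub>R g b) = (\<Sum>b\<in>B. \<mu> b *\<^sub>R g b)"
      using finA(2)[OF A] zero BA by (auto intro!: sum.mono_neutral_right)
    then show ?thesis unfolding simplicial_cone_def using 1 2 by auto
  qed
  moreover have "convex (cone_of B)"
    using convex_cone_simplicial_cone[OF L finA(2)[OF B]] by (simp add: convex_cone_def)
  ultimately show ?thesis
    unfolding face_of_def using simplicial_cone_mono[OF BA finA(2)[OF A]] by blast
qed

text \<open>
  Intersections of cones correspond to intersections of index sets, which are again members of the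
  complex, and faces correspond to subsets.
\<close>

theorem is_fan: "is_fan (cone_of ` \<A>)"
  unfolding is_fan_def
proof (intro conjI ballI allI impI)
  show "finite (cone_of ` \<A>)" "cone_of ` \<A> \<noteq> {}" using finA neA by auto
next
  fix C assume "C \<in> cone_of ` \<A>"
  then obtain A where A: "A \<in> \<A>" "C = cone_of A" by auto
  show "polyhedron C" "convex_cone C"
    using polyhedron_simplicial_cone[OF L finA(2)] convex_cone_simplicial_cone[OF L finA(2)] A
    by auto
  fix F assume "F face_of C \<and> F \<noteq> {}"
  then show "F \<in> cone_of ` \<A>"
    using face_of_simplicial_cone[OF L finA(2)[OF A(1)]] A sub by blast
next
  fix C D assume "C \<in> cone_of ` \<A>" "D \<in> cone_of ` \<A>"
  then show "C \<inter> D face_of C" "C \<inter> D face_of D"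
    by (auto simp: cone_of_Int subset_imp_face)
qed

end

section \<open>The cones in coordinates\<close>

text \<open>
  The edges with exactly one end in \<open>S\<close>.
\<close>

definition E_hat :: "'n::finite set \<Rightarrow> 'n set set" where
  "E_hat S = (\<Union>a\<in>S. E_elem S a)"

context
  assumes n2: "2 \<le> CARD('n::finite)"
begin

lemma edge_in_E_full_iff: "(i :: 'n) \<noteq> j \<Longrightarrow> - {i, j} \<in> E_full S \<longleftrightarrow> i \<notin> S \<and> j \<notin> S"
  using hyp2_edge[OF n2, of i j] by (auto simp: E_full_def)

lemma edge_in_E_zero_iff: "(i :: 'n) \<noteq> j \<Longrightarrow> - {i, j} \<in> E_zero S \<longleftrightarrow> i \<in> S \<and> j \<in> S"
proof -
  assume ij: "i \<noteq> j"
  have "S - - {i, j} = S \<inter> {i, j}" by auto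
  moreover have "card (S \<inter> {i, j}) = 2 \<longleftrightarrow> i \<in> S \<and> j \<in> S"
    using ij by (cases "i \<in> S"; cases "j \<in> S") simp_all
  ultimately show ?thesis using hyp2_edge[OF n2 ij] by (simp add: E_zero_def)
qed

lemma edge_in_E_elem_iff:
  assumes "(i :: 'n) \<noteq> j"
  shows "- {i, j} \<in> E_elem S a \<longleftrightarrow> a \<in> S \<and> (i = a \<and> j \<notin> S \<or> j = a \<and> i \<notin> S)"
proof -
  have "S - - {i, j} = S \<inter> {i, j}" by auto
  then have "- {i, j} \<in> E_elem S a \<longleftrightarrow> S \<inter> {i, j} = {a}"
    using hyp2_edge[OF n2 assms] by (simp add: E_elem_def)
  also have "\<dots> \<longleftrightarrow> a \<in> S \<and> (i = a \<and> j \<notin> S \<or> j = a \<and> i \<notin> S)"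
    using assms by (cases "i \<in> S"; cases "j \<in> S") auto
  finally show ?thesis .
qed

lemma edge_in_E_hat_iff:
  assumes "(i :: 'n) \<noteq> j"
  shows "- {i, j} \<in> E_hat S \<longleftrightarrow> (i \<in> S) \<noteq> (j \<in> S)"
  using edge_in_E_elem_iff[OF assms] by (auto simp: E_hat_def)

lemma hyp2_cases:
  assumes "J \<in> hyp2"
  obtains i j :: 'n where "i \<noteq> j" "J = - {i, j}"
  using iffD1[OF hyp2_iff[OF n2] assms] by auto

lemma E_subset_hyp2: "E_full S \<subseteq> (hyp2 :: 'n set set)" "E_hat S \<subseteq> (hyp2 :: 'n set set)"
    "E_zero S \<subseteq> (hyp2 :: 'n set set)"
  by (auto simp: E_full_def E_hat_def E_elem_def E_zero_def)

lemma hyp2_partition: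
  "(hyp2 :: 'n set set) = E_full S \<union> E_hat S \<union> E_zero S"
  "E_full S \<inter> E_hat S = ({} :: 'n set set)" "E_full S \<inter> E_zero S = ({} :: 'n set set)"
  "E_hat S \<inter> E_zero S = ({} :: 'n set set)"
proof -
  have "J \<in> E_full S \<union> E_hat S \<union> E_zero S \<and> J \<notin> E_full S \<inter> E_hat S \<and> J \<notin> E_full S \<inter> E_zero S
      \<and> J \<notin> E_hat S \<inter> E_zero S" if J: "J \<in> hyp2" for J :: "'n set"
  proof -
    obtain i j where "i \<noteq> j" "J = - {i, j}" using J by (rule hyp2_cases)
    then show ?thesis
      by (cases "i \<in> S"; cases "j \<in> S")
         (simp_all add: edge_in_E_full_iff edge_in_E_hat_iff edge_in_E_zero_iff)
  qed
  then show "(hyp2 :: 'n set set) = E_full S \<union> E_hat S \<union> E_zero S"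
    "E_full S \<inter> E_hat S = ({} :: 'n set set)" "E_full S \<inter> E_zero S = ({} :: 'n set set)"
    "E_hat S \<inter> E_zero S = ({} :: 'n set set)"
    using E_subset_hyp2[of S] by blast+
qed

lemma ground_M_full: "ground (M_full S) = E_full (S :: 'n set)"
  by (simp add: M_full_def graphic_matroid_def)

lemma ground_M_hat: "ground (M_hat S) = E_hat (S :: 'n set)"
  by (simp add: M_hat_def direct_sum_matroid_def uniform_matroid_def E_hat_def)

text \<open>
  In a complete graph a path can be shortcut edge by edge, so it suffices to ask for transitivity.
\<close>

lemma flat_M_full_iff:
  "flat (M_full S) F \<longleftrightarrow> F \<subseteq> E_full (S :: 'n set) \<and>
    (\<forall>i j k. i \<noteq> j \<longrightarrow> i \<noteq> k \<longrightarrow> j \<noteq> k \<longrightarrow> - {i, j} \<in> F \<longrightarrow> - {j, k} \<in> F \<longrightarrow> - {i, k} \<in> F)"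
    (is "_ \<longleftrightarrow> ?R")
proof -
  have card2: "card (- J) = 2" if J: "J \<in> E_full S" for J :: "'n set"
  proof -
    obtain i j where "i \<noteq> j" "J = - {i, j}"
      using subsetD[OF E_subset_hyp2(1) J] by (rule hyp2_cases)
    then show ?thesis by simp
  qed
  have "flat (M_full S) F \<longleftrightarrow> F \<subseteq> E_full S \<and>
      (\<forall>e\<in>E_full S. \<forall>i k. - e = {i, k} \<and> (i, k) \<in> (adj (uminus ` F))\<^sup>* \<longrightarrow> e \<in> F)"
    unfolding M_full_def by (rule flat_graphic_matroid_iff) (auto simp: card2 inj_on_def)
  also have "\<dots> \<longleftrightarrow> ?R"
  proof (intro conj_cong refl)
    assume F: "F \<subseteq> E_full S"
    have edge: "{i, j} \<in> uminus ` F \<longleftrightarrow> - {i, j} \<in> F" for i j :: 'n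
      by (metis (no_types, lifting) double_compl image_iff)
    show "(\<forall>e\<in>E_full S. \<forall>i k. - e = {i, k} \<and> (i, k) \<in> (adj (uminus ` F))\<^sup>* \<longrightarrow> e \<in> F) \<longleftrightarrow>
      (\<forall>i j k. i \<noteq> j \<longrightarrow> i \<noteq> k \<longrightarrow> j \<noteq> k \<longrightarrow> - {i, j} \<in> F \<longrightarrow> - {j, k} \<in> F \<longrightarrow> - {i, k} \<in> F)"
      (is "?P \<longleftrightarrow> ?Q")
    proof
      assume P: ?P
      show ?Q
      proof (intro allI impI)
        fix i j k assume d: "i \<noteq> j" "i \<noteq> k" "j \<noteq> k" and e: "- {i, j} \<in> F" "- {j, k} \<in> F"
        have "- {i, j} \<in> E_full S" "- {j, k} \<in> E_full S" using e F by auto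
        then have "- {i, k} \<in> E_full S" using d by (simp add: edge_in_E_full_iff)
        moreover have "(i, j) \<in> adj (uminus ` F)" "(j, k) \<in> adj (uminus ` F)"
          using e edge by (simp_all add: adj_def)
        then have "(i, k) \<in> (adj (uminus ` F))\<^sup>*" by (meson r_into_rtrancl rtrancl_trans)
        moreover have "- (- {i, k}) = {i, k}" by simp
        ultimately show "- {i, k} \<in> F" using P by blast
      qed
    next
      assume Q: ?Q
      have path: "x = i \<or> - {i, x} \<in> F" if p: "(i, x) \<in> (adj (uminus ` F))\<^sup>*" for i x
        using p
      proof (induction rule: rtrancl_induct)
        case (step x y)
        have xy: "- {x, y} \<in> F" using step(2) edge by (simp add: adj_def)
        have "x \<noteq> y"
        proof
          assume "x = y"
          then have "card (- (- {x, y})) = 1" by simp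
          then show False using card2[of "- {x, y}"] xy F by auto
        qed
        then show ?case using step(3) xy Q[rule_format, of i x y] by auto
      qed simp
      show ?P
      proof (intro ballI allI impI, elim conjE)
        fix e i k assume e: "e \<in> E_full S" "- e = {i, k}" and p: "(i, k) \<in> (adj (uminus ` F))\<^sup>*"
        have "i \<noteq> k" using card2[OF e(1)] e(2) by auto
        moreover have "e = - {i, k}" using e(2) by auto
        ultimately show "e \<in> F" using path[OF p] by auto
      qed
    qed
  qed
  finally show ?thesis .
qed

lemma flat_M_hat_iff:
  "flat (M_hat S) G \<longleftrightarrow> G \<subseteq> E_hat (S :: 'n set) \<and>
    (\<forall>a\<in>S. \<forall>j\<in>- S. \<forall>k\<in>- S. - {a, j} \<in> G \<longrightarrow> - {a, k} \<in> G)"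
proof -
  have elem: "E_elem S a = (\<lambda>j. - {a, j}) ` (- S)" if a: "a \<in> S" for a
  proof (intro equalityI subsetI)
    fix J assume J: "J \<in> E_elem S a"
    then have "J \<in> hyp2" by (simp add: E_elem_def)
    then obtain i j where "i \<noteq> j" "J = - {i, j}" by (rule hyp2_cases)
    then show "J \<in> (\<lambda>j. - {a, j}) ` (- S)"
      using J edge_in_E_elem_iff[of i j S a] by (auto simp: insert_commute)
  next
    fix J assume "J \<in> (\<lambda>j. - {a, j}) ` (- S)"
    then obtain j where j: "j \<notin> S" "J = - {a, j}" by auto
    moreover have "a \<noteq> j" using a j by auto
    ultimately show "J \<in> E_elem S a" using a edge_in_E_elem_iff[of a j S a] by simp
  qed
  have "flat (M_hat S) G \<longleftrightarrow> G \<subseteq> (\<Union>a\<in>S. E_elem S a) \<and> (\<forall>a\<in>S. E_elem S a \<subseteq> G \<or> E_elem S a \<inter> G = {})"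
    unfolding M_hat_def
    by (rule flat_direct_sum_rank_one_iff) (auto simp: disjoint_family_on_def E_elem_def)
  also have "\<dots> \<longleftrightarrow> G \<subseteq> E_hat S \<and> (\<forall>a\<in>S. \<forall>j\<in>- S. \<forall>k\<in>- S. - {a, j} \<in> G \<longrightarrow> - {a, k} \<in> G)"
    unfolding E_hat_def by (intro conj_cong refl ball_cong) (auto simp: elem)
  finally show ?thesis .
qed

end

lemma flat_ground: "flat M (ground M)"
  by (simp add: flat_def)

lemma flat_subset_ground: "flat M F \<Longrightarrow> F \<subseteq> ground M"
  by (simp add: flat_def)

text \<open>
  A description in which exceptional chains need no separate treatment: the ground set is a flat, and
  it can only occur as the head, in which case nothing can follow.
\<close>

lemma chain_of_flats_iff:
  "chain_of_flats M Fs \<longleftrightarrow> Fs \<noteq> [] \<and> sorted_wrt (\<subset>) Fs \<and> (\<forall>F\<in>set Fs. flat M F) \<and>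
     (\<forall>F\<in>set (tl Fs). F \<subset> ground M)"
proof (cases Fs)
  case Nil then show ?thesis by (simp add: chain_of_flats_def exceptional_chain_def)
next
  case (Cons F Fs')
  show ?thesis
  proof
    assume "chain_of_flats M Fs"
    then show "Fs \<noteq> [] \<and> sorted_wrt (\<subset>) Fs \<and> (\<forall>F\<in>set Fs. flat M F) \<and>
     (\<forall>F\<in>set (tl Fs). F \<subset> ground M)"
      using Cons flat_ground[of M] by (auto simp: chain_of_flats_def exceptional_chain_def)
  next
    assume R: "Fs \<noteq> [] \<and> sorted_wrt (\<subset>) Fs \<and> (\<forall>F\<in>set Fs. flat M F) \<and>
     (\<forall>F\<in>set (tl Fs). F \<subset> ground M)"
    show "chain_of_flats M Fs"
    proof (cases "F = ground M")
      case True
      have "Fs' = []"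
      proof (rule ccontr)
        assume "Fs' \<noteq> []"
        then obtain G where "G \<in> set Fs'" by (cases Fs') auto
        then have "F \<subset> G" "G \<subset> ground M" using R Cons by auto
        then show False using True by auto
      qed
      then show ?thesis using Cons True by (simp add: chain_of_flats_def exceptional_chain_def)
    next
      case False
      then have "F \<subset> ground M" using R Cons flat_subset_ground[of M F] by auto
      then have "\<forall>G\<in>set Fs. flat M G \<and> G \<subset> ground M" using R Cons by simp
      then show ?thesis using R unfolding chain_of_flats_def by blast
    qed
  qed
qed

lemma exceptional_chain_iff:
  assumes "chain_of_flats M Fs"
  shows "exceptional_chain M Fs \<longleftrightarrow> hd Fs = ground M"
  using assms unfolding chain_of_flats_def exceptional_chain_def by (cases Fs) auto

lemma chain_of_flatsD:
  assumes "chain_of_flats M Fs"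
  shows "Fs = hd Fs # tl Fs" "flat M (hd Fs)" "hd Fs \<subseteq> ground M"
    "\<And>F. F \<in> set (tl Fs) \<Longrightarrow> flat M F \<and> hd Fs \<subset> F \<and> F \<subset> ground M"
    "subset.chain UNIV (set Fs)" "subset.chain UNIV (set (tl Fs))"
    "set Fs = insert (hd Fs) (set (tl Fs))"
proof -
  have C: "Fs \<noteq> []" "sorted_wrt (\<subset>) Fs" "\<And>F. F \<in> set Fs \<Longrightarrow> flat M F"
    "\<And>F. F \<in> set (tl Fs) \<Longrightarrow> F \<subset> ground M"
    using assms unfolding chain_of_flats_iff by auto
  show eq: "Fs = hd Fs # tl Fs" using C(1) by simp
  show "flat M (hd Fs)" using C(1,3) by simp
  then show "hd Fs \<subseteq> ground M" by (rule flat_subset_ground)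
  show s: "set Fs = insert (hd Fs) (set (tl Fs))" using arg_cong[OF eq, of set] by simp
  have sw: "sorted_wrt (\<subset>) (hd Fs # tl Fs)" using C(2) eq by simp
  then show "flat M F \<and> hd Fs \<subset> F \<and> F \<subset> ground M" if "F \<in> set (tl Fs)" for F
    using that C(3,4) s by auto
  show "subset.chain UNIV (set Fs)" using chain_set_of_sorted_wrt[OF C(2)] .
  show "subset.chain UNIV (set (tl Fs))" using sw by (intro chain_set_of_sorted_wrt) simp
qed

text \<open>
  The bridge from tropical points to chains: the head of the chain is the set of infinite coordinates,
  and the later members are the superlevel sets in \<open>superlevel_decomposition\<close>, each enlarged by the
  head.  If \<open>D\<close> is infinite everywhere, the result is the exceptional chain and the last equation is vacuous.
\<close>

lemma chain_of_flats_of_superlevel_sets: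
  fixes D :: "'e \<Rightarrow> ereal"
  assumes fin: "finite (ground M)" and D: "\<And>J. J \<in> ground M \<Longrightarrow> D J \<noteq> -\<infinity>"
    and lev: "\<And>b. flat M {J \<in> ground M. b \<le> D J}"
  shows "\<exists>Fs \<kappa> m. chain_of_flats M Fs \<and> (\<forall>F. 0 \<le> \<kappa> F) \<and> hd Fs = {J \<in> ground M. D J = \<infinity>} \<and>
    (\<forall>J\<in>ground M - hd Fs. D J = ereal ((\<Sum>F\<in>set (tl Fs). if J \<in> F then \<kappa> F else 0) + m))"
proof -
  define F0 where "F0 = {J \<in> ground M. D J = \<infinity>}"
  have "F0 = {J \<in> ground M. \<infinity> \<le> D J}" by (auto simp: F0_def)
  then have F0: "flat M F0" by (simp only: lev)
  show ?thesis
  proof (cases "F0 = ground M")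
    case True
    have "chain_of_flats M [F0]" using True by (simp add: chain_of_flats_def exceptional_chain_def)
    then show ?thesis using True
      by (intro exI[of _ "[F0]"] exI[of _ "\<lambda>_. 0"] exI[of _ 0]) (simp add: F0_def)
  next
    case False
    define E where "E = ground M - F0"
    have E: "finite E" "E \<noteq> {}" using fin False by (auto simp: E_def F0_def)
    define x where "x J = real_of_ereal (D J)" for J
    have Dx: "D J = ereal (x J)" if "J \<in> E" for J
      using that D[of J] by (auto simp: E_def F0_def x_def ereal_real)
    from superlevel_decomposition[OF E, of x] obtain A \<kappa> where IH: "finite A \<and> subset.chain UNIV A \<and>
       (\<forall>F. 0 \<le> \<kappa> F) \<and> (\<forall>F\<in>A. F \<noteq> {} \<and> F \<subset> E \<and> (\<exists>s. F = {J \<in> E. s \<le> x J})) \<and>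
       (\<forall>J\<in>E. x J = Min (x ` E) + (\<Sum>F\<in>A. if J \<in> F then \<kappa> F else 0))"
      by (elim exE)
    then have A: "finite A" "subset.chain UNIV A" and \<kappa>: "\<And>F. 0 \<le> \<kappa> F"
      and x: "\<And>J. J \<in> E \<Longrightarrow> x J = Min (x ` E) + (\<Sum>F\<in>A. if J \<in> F then \<kappa> F else 0)"
      by auto
    have AF: "F \<noteq> {} \<and> F \<subset> E \<and> (\<exists>s. F = {J \<in> E. s \<le> x J})" if "F \<in> A" for F
      using IH that by (elim conjE) (rule bspec)
    have AE: "F \<noteq> {}" "F \<subset> E" "F \<inter> F0 = {}" if "F \<in> A" for F
      using AF[OF that] by (auto simp: E_def)
    have flatA: "flat M (F0 \<union> F)" if F: "F \<in> A" for F
    proof -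
      obtain s where s: "F = {J \<in> E. s \<le> x J}" using AF[OF F] by auto
      have "F0 \<union> F = {J \<in> ground M. ereal s \<le> D J}"
      proof (intro equalityI subsetI)
        fix J assume "J \<in> F0 \<union> F"
        then consider "J \<in> F0" | "J \<in> E" "s \<le> x J" unfolding s by blast
        then show "J \<in> {J \<in> ground M. ereal s \<le> D J}"
        proof cases
          case 1 then show ?thesis by (simp add: F0_def)
        next
          case 2 then show ?thesis using Dx[OF 2(1)] by (simp add: E_def)
        qed
      next
        fix J assume J: "J \<in> {J \<in> ground M. ereal s \<le> D J}"
        show "J \<in> F0 \<union> F"
        proof (cases "J \<in> F0")
          case False
          then have "J \<in> E" using J by (simp add: E_def)
          then show ?thesis using J Dx[of J] unfolding s by simp
        qed simp
      qed
      then show ?thesis by (simp only: lev)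
    qed
    have "subset.chain UNIV ((\<union>) F0 ` A)" using A(2) unfolding subset_chain_def by auto
    then obtain Fs where Fs: "set Fs = (\<union>) F0 ` A" "sorted_wrt (\<subset>) Fs"
      using sorted_wrt_psubset_of_chain[of "(\<union>) F0 ` A"] A(1) by auto
    have mem: "F0 \<subset> F \<and> F \<subset> ground M \<and> flat M F" if F: "F \<in> set Fs" for F
    proof -
      obtain F' where F': "F' \<in> A" "F = F0 \<union> F'" using F Fs(1) by auto
      have "F' \<subset> E" "F' \<noteq> {}" "F' \<inter> F0 = {}" using AE[OF F'(1)] by auto
      moreover have "F0 \<subseteq> ground M" by (auto simp: F0_def)
      ultimately show ?thesis using flatA[OF F'(1)] unfolding F'(2) by (auto simp: E_def)
    qed
    have ch: "chain_of_flats M (F0 # Fs)"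
      unfolding chain_of_flats_iff using Fs(2) mem F0 by auto
    have dec: "D J = ereal ((\<Sum>F\<in>set Fs. if J \<in> F then \<kappa> (F - F0) else 0) + Min (x ` E))"
      if J: "J \<in> E" for J
    proof -
      have inj: "inj_on ((\<union>) F0) A" using AE(3) by (intro inj_onI) blast
      have "(\<Sum>F\<in>set Fs. if J \<in> F then \<kappa> (F - F0) else 0)
          = (\<Sum>F\<in>A. if J \<in> F0 \<union> F then \<kappa> (F0 \<union> F - F0) else 0)"
        unfolding Fs(1) by (subst sum.reindex[OF inj]) (simp add: comp_def)
      also have "\<dots> = (\<Sum>F\<in>A. if J \<in> F then \<kappa> F else 0)"
      proof (intro sum.cong refl)
        fix F assume "F \<in> A"
        then have "F0 \<union> F - F0 = F" using AE(3) by blast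
        moreover have "J \<notin> F0" using J by (simp add: E_def)
        ultimately show "(if J \<in> F0 \<union> F then \<kappa> (F0 \<union> F - F0) else 0) = (if J \<in> F then \<kappa> F else 0)"
          by simp
      qed
      finally show ?thesis using x[OF J] Dx[OF J] by simp
    qed
    show ?thesis
    proof (intro exI[of _ "F0 # Fs"] exI[of _ "\<lambda>F. \<kappa> (F - F0)"] exI[of _ "Min (x ` E)"]
        conjI allI ballI)
      show "chain_of_flats M (F0 # Fs)" by (rule ch)
      show "0 \<le> \<kappa> (F - F0)" for F by (rule \<kappa>)
      show "hd (F0 # Fs) = {J \<in> ground M. D J = \<infinity>}" by (simp only: list.sel F0_def)
      show "D J = ereal ((\<Sum>F\<in>set (tl (F0 # Fs)). if J \<in> F then \<kappa> (F - F0) else 0) + Min (x ` E))"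
        if "J \<in> ground M - hd (F0 # Fs)" for J
        using dec[of J] that unfolding E_def list.sel by blast
    qed
  qed
qed

text \<open>
  The edge coordinate of $\sum_{i \notin S} \alpha_i a_i$: the sum of \<open>\<alpha>\<close> over the ends of the edge outside \<open>S\<close>.
\<close>

definition lin_coord :: "'n::finite set \<Rightarrow> ('n \<Rightarrow> real) \<Rightarrow> 'n set \<Rightarrow> real" where
  "lin_coord S \<alpha> J = (\<Sum>i\<in>- S - J. \<alpha> i)"

lemma lin_space_iff:
  fixes S :: "'n::finite set"
  shows "(a, b) \<in> lin_space S \<longleftrightarrow>
    (\<exists>\<alpha>. (\<forall>J. vec_nth a J = (if J \<in> hyp2 then lin_coord S \<alpha> J else 0)) \<and>
         (\<forall>I. vec_nth b I = (\<Sum>i\<in>- S. if I = - {i} then \<alpha> i else 0)))"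
proof -
  define Q where "Q x \<alpha> \<longleftrightarrow>
      (\<forall>J. vec_nth (fst x) J = (if J \<in> hyp2 then lin_coord S \<alpha> J else 0)) \<and>
      (\<forall>I. vec_nth (snd x) I = (\<Sum>i\<in>- S. if I = - {i} then \<alpha> i else 0))"
    for x :: "(real ^ 'n set) \<times> (real ^ 'n set)" and \<alpha>
  define v :: "'n \<Rightarrow> (real ^ 'n set) \<times> (real ^ 'n set)" where
    "v i = (\<chi> J. if J \<in> hyp2 then real (card ({i} - J)) else 0, ind_vec {- {i}})" for i
  have fst_v: "vec_nth (fst (v i)) J = (if J \<in> hyp2 then if i \<in> J then 0 else 1 else 0)" for i J
    by (simp add: v_def insert_Diff_if)
  have snd_v: "vec_nth (snd (v i)) I = (if I = - {i} then 1 else 0)" for i I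
    by (simp add: v_def ind_vec_def)
  have lin: "lin_space S = span (v ` (- S))" by (simp add: lin_space_def v_def)
  have P: "Q (\<Sum>i\<in>- S. \<alpha> i *\<^sub>R v i) \<alpha>" for \<alpha>
  proof -
    have "vec_nth (fst (\<Sum>i\<in>- S. \<alpha> i *\<^sub>R v i)) J = (if J \<in> hyp2 then lin_coord S \<alpha> J else 0)" for J
    proof -
      have "vec_nth (fst (\<Sum>i\<in>- S. \<alpha> i *\<^sub>R v i)) J = (\<Sum>i\<in>- S. \<alpha> i * vec_nth (fst (v i)) J)"
        by (simp add: fst_sum)
      also have "\<dots> = (if J \<in> hyp2 then (\<Sum>i\<in>- S. if i \<in> J then 0 else \<alpha> i) else 0)"
        unfolding fst_v by (auto intro!: sum.cong sum.neutral)
      also have "(\<Sum>i\<in>- S. if i \<in> J then 0 else \<alpha> i) = lin_coord S \<alpha> J"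
        unfolding lin_coord_def by (intro sum.mono_neutral_cong_right) auto
      finally show ?thesis .
    qed
    moreover have "vec_nth (snd (\<Sum>i\<in>- S. \<alpha> i *\<^sub>R v i)) I = (\<Sum>i\<in>- S. if I = - {i} then \<alpha> i else 0)" for I
      unfolding snd_sum sum_component by (intro sum.cong) (auto simp: snd_v)
    ultimately show ?thesis by (simp only: Q_def) simp
  qed
  have inv: "x = y" if "Q x \<alpha>" "Q y \<alpha>" for x y \<alpha>
    using that by (simp add: Q_def prod_eq_iff Finite_Cartesian_Product.vec_eq_iff)
  have "(a, b) \<in> lin_space S \<longleftrightarrow> (\<exists>\<alpha>. Q (a, b) \<alpha>)"
  proof
    assume "(a, b) \<in> lin_space S"
    then show "\<exists>\<alpha>. Q (a, b) \<alpha>"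
      unfolding lin
    proof (induction "(a, b)" arbitrary: a b rule: span_induct_alt)
      case base
      then show ?case by (intro exI[of _ "\<lambda>_. 0"]) (simp add: Q_def lin_coord_def zero_prod_def)
    next
      case (step c x y)
      obtain a' b' where y: "y = (a', b')" by fastforce
      obtain \<alpha> where \<alpha>: "Q (a', b') \<alpha>" using step(2)[OF y] by blast
      obtain i where i: "i \<in> - S" "x = v i" using step(1) by auto
      have e1: "lin_coord S (\<lambda>j. \<alpha> j + (if j = i then c else 0)) J = lin_coord S \<alpha> J + (if i \<in> J then 0 else c)" for J
        using i(1) by (simp add: lin_coord_def sum.distrib)
      have e2: "(\<Sum>j\<in>- S. if I = - {j} then \<alpha> j + (if j = i then c else 0) else 0)
          = (\<Sum>j\<in>- S. if I = - {j} then \<alpha> j else 0) + (if I = - {i} then c else 0)" for I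
      proof -
        have "(\<Sum>j\<in>- S. if I = - {j} then \<alpha> j + (if j = i then c else 0) else 0)
          = (\<Sum>j\<in>- S. (if I = - {j} then \<alpha> j else 0) + (if j = i then if I = - {i} then c else 0 else 0))"
          by (intro sum.cong) auto
        then show ?thesis using i(1) by (simp add: sum.distrib)
      qed
      have a: "a = c *\<^sub>R fst (v i) + a'" "b = c *\<^sub>R snd (v i) + b'"
        using step(3) unfolding y i(2) by (auto simp: prod_eq_iff)
      have "Q (a, b) (\<lambda>j. \<alpha> j + (if j = i then c else 0))"
        using \<alpha> unfolding Q_def fst_conv snd_conv e1 e2 a by (simp add: fst_v snd_v)
      then show ?case by blast
    qed
  next
    assume "\<exists>\<alpha>. Q (a, b) \<alpha>"
    then obtain \<alpha> where "Q (a, b) \<alpha>" by blast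
    then have eq: "(a, b) = (\<Sum>i\<in>- S. \<alpha> i *\<^sub>R v i)" using P inv by blast
    show "(a, b) \<in> lin_space S"
      unfolding lin eq by (intro span_sum span_scale span_base imageI)
  qed
  then show ?thesis by (simp add: Q_def)
qed

text \<open>
  The coordinates of a point of a cone with head \<open>I0\<close> and generators \<open>\<A>\<close>: \<open>\<alpha>\<close> parametrises the
  lineality space, \<open>\<kappa>\<close> the cone coefficients, and \<open>c\<close> the line spanned by the all-ones vector.
\<close>

definition flag_u ::
  "'n::finite set \<Rightarrow> 'n set set \<Rightarrow> 'n set set set \<Rightarrow> ('n \<Rightarrow> real) \<Rightarrow> ('n set set \<Rightarrow> real) \<Rightarrow> real \<Rightarrow> 'n set \<Rightarrow> ereal" where
  "flag_u S I0 \<A> \<alpha> \<kappa> c J =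
     (if J \<in> hyp2 - (E_zero S \<union> I0)
      then ereal (lin_coord S \<alpha> J + (\<Sum>F\<in>\<A>. if J \<in> F then \<kappa> F else 0) + c) else \<infinity>)"

definition flag_v :: "'n::finite set \<Rightarrow> ('n \<Rightarrow> real) \<Rightarrow> 'n set \<Rightarrow> ereal" where
  "flag_v S \<alpha> I =
     (if \<exists>i\<in>- S. I = - {i} then ereal (\<Sum>i\<in>- S. if I = - {i} then \<alpha> i else 0) else \<infinity>)"

lemma flag_v_vertex: "flag_v S \<alpha> (- {i}) = (if i \<in> S then \<infinity> else ereal (\<alpha> i))"
  by (auto simp: flag_v_def)

lemma flag_v_outside: "I \<notin> hyp1 \<Longrightarrow> flag_v S \<alpha> I = \<infinity>"
  by (auto simp: flag_v_def hyp1_vertex)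

lemma w_vec_eq: "w_vec S I = (if \<exists>i\<in>- S. I = - {i} then 0 else \<infinity>)"
proof (cases "I \<in> hyp1")
  case True
  then obtain i where "I = - {i}" using hyp1_iff[of I] by auto
  then show ?thesis by (auto simp: w_vec_def inf_vec_def hyp1_vertex)
next
  case False
  then show ?thesis by (auto simp: w_vec_def inf_vec_def hyp1_vertex)
qed

text \<open>
  The generators of the cone of a pair of chains.  Both chains are put into one set, from which they
  can be recovered since their ground sets are disjoint and no member of a tail is empty.
\<close>

definition tails :: "'e set list \<Rightarrow> 'e set list \<Rightarrow> 'e set set" where
  "tails Fs Gs = set (tl Fs) \<union> set (tl Gs)"

lemma flag_cone_eq:
  "flag_cone (S, Fs, Gs) =
     {(tp_class (flag_u S (hd Fs \<union> hd Gs) (tails Fs Gs) \<alpha> \<kappa> c), tp_class (flag_v S \<alpha>)) | \<alpha> \<kappa> c.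
        \<forall>F. 0 \<le> \<kappa> F}"
proof -
  let ?A = "tails Fs Gs" and ?I = "hd Fs \<union> hd Gs"
  have hull: "x \<in> convex_cone hull (ind_vec ` ?A) \<longleftrightarrow>
      (\<exists>\<kappa>. (\<forall>F. 0 \<le> \<kappa> F) \<and> x = (\<Sum>F\<in>?A. \<kappa> F *\<^sub>R ind_vec F))" for x :: "real ^ 'a set"
    using convex_cone_hull_image[of ?A "ind_vec :: _ \<Rightarrow> real ^ 'a set"] by (auto simp: tails_def)
  have x: "vec_nth (\<Sum>F\<in>?A. \<kappa> F *\<^sub>R ind_vec F :: real ^ 'a set) J = (\<Sum>F\<in>?A. if J \<in> F then \<kappa> F else 0)"
    for \<kappa> J
    unfolding sum_component by (intro sum.cong) (auto simp: ind_vec_def)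
  have inf: "inf_vec (- hyp2 \<union> E_zero S \<union> hd Fs \<union> hd Gs) J
      = (if J \<in> hyp2 - (E_zero S \<union> ?I) then 0 else \<infinity>)" for J
    by (auto simp: inf_vec_def)
  have u: "(\<lambda>J. ereal (vec_nth a J) + (inf_vec (- hyp2 \<union> E_zero S \<union> hd Fs \<union> hd Gs) J
      + ereal (vec_nth (\<Sum>F\<in>?A. \<kappa> F *\<^sub>R ind_vec F) J) + ereal c)) = flag_u S ?I ?A \<alpha> \<kappa> c"
    if "\<forall>J. vec_nth a J = (if J \<in> hyp2 then lin_coord S \<alpha> J else 0)" for a \<alpha> \<kappa> c
    unfolding inf x flag_u_def using that by (intro ext) simp
  have v: "(\<lambda>I. ereal (vec_nth b I) + w_vec S I) = flag_v S \<alpha>"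
    if "\<forall>I. vec_nth b I = (\<Sum>i\<in>- S. if I = - {i} then \<alpha> i else 0)" for b \<alpha>
    unfolding w_vec_eq flag_v_def using that by (intro ext) simp
  show ?thesis
  proof (intro equalityI subsetI)
    fix p assume "p \<in> flag_cone (S, Fs, Gs)"
    then obtain a b y where p: "p = (tp_class (\<lambda>J. ereal (vec_nth a J) + y J),
        tp_class (\<lambda>I. ereal (vec_nth b I) + w_vec S I))"
      and ab: "(a, b) \<in> lin_space S" and y: "y \<in> chain_cone S Fs Gs"
      unfolding flag_cone_def by auto
    obtain \<alpha> where \<alpha>: "\<forall>J. vec_nth a J = (if J \<in> hyp2 then lin_coord S \<alpha> J else 0)"
      "\<forall>I. vec_nth b I = (\<Sum>i\<in>- S. if I = - {i} then \<alpha> i else 0)"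
      using ab unfolding lin_space_iff by blast
    obtain x c where y': "y = (\<lambda>J. inf_vec (- hyp2 \<union> E_zero S \<union> hd Fs \<union> hd Gs) J + ereal (vec_nth x J) + ereal c)"
      "x \<in> convex_cone hull (ind_vec ` ?A)"
      using y unfolding chain_cone_def tails_def by blast
    obtain \<kappa> where \<kappa>: "\<forall>F. 0 \<le> \<kappa> F" "x = (\<Sum>F\<in>?A. \<kappa> F *\<^sub>R ind_vec F)"
      using iffD1[OF hull y'(2)] by (elim exE conjE)
    have "p = (tp_class (flag_u S ?I ?A \<alpha> \<kappa> c), tp_class (flag_v S \<alpha>))"
      unfolding p y'(1) \<kappa>(2) u[OF \<alpha>(1)] v[OF \<alpha>(2)] ..
    then show "p \<in> {(tp_class (flag_u S ?I ?A \<alpha> \<kappa> c), tp_class (flag_v S \<alpha>)) | \<alpha> \<kappa> c. \<forall>F. 0 \<le> \<kappa> F}"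
      using \<kappa>(1) by blast
  next
    fix p assume "p \<in> {(tp_class (flag_u S ?I ?A \<alpha> \<kappa> c), tp_class (flag_v S \<alpha>)) | \<alpha> \<kappa> c. \<forall>F. 0 \<le> \<kappa> F}"
    then obtain \<alpha> \<kappa> c where p: "p = (tp_class (flag_u S ?I ?A \<alpha> \<kappa> c), tp_class (flag_v S \<alpha>))"
      and \<kappa>: "\<forall>F. 0 \<le> \<kappa> F" by blast
    define a :: "real ^ 'a set" where "a = (\<chi> J. if J \<in> hyp2 then lin_coord S \<alpha> J else 0)"
    define b :: "real ^ 'a set" where "b = (\<chi> I. \<Sum>i\<in>- S. if I = - {i} then \<alpha> i else 0)"
    define x :: "real ^ 'a set" where "x = (\<Sum>F\<in>?A. \<kappa> F *\<^sub>R ind_vec F)"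
    have a: "\<forall>J. vec_nth a J = (if J \<in> hyp2 then lin_coord S \<alpha> J else 0)"
      and b: "\<forall>I. vec_nth b I = (\<Sum>i\<in>- S. if I = - {i} then \<alpha> i else 0)"
      by (simp_all add: a_def b_def)
    have ab: "(a, b) \<in> lin_space S" unfolding lin_space_iff using a b by blast
    have "x \<in> convex_cone hull (ind_vec ` ?A)" using hull \<kappa> x_def by blast
    then have y: "(\<lambda>J. inf_vec (- hyp2 \<union> E_zero S \<union> hd Fs \<union> hd Gs) J + ereal (vec_nth x J) + ereal c)
        \<in> chain_cone S Fs Gs"
      unfolding chain_cone_def tails_def by blast
    have "p = (tp_class (\<lambda>J. ereal (vec_nth a J) + (inf_vec (- hyp2 \<union> E_zero S \<union> hd Fs \<union> hd Gs) J
        + ereal (vec_nth x J) + ereal c)), tp_class (\<lambda>I. ereal (vec_nth b I) + w_vec S I))"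
      unfolding p u[OF a, of \<kappa> c, symmetric] v[OF b, symmetric] x_def ..
    then show "p \<in> flag_cone (S, Fs, Gs)"
      unfolding flag_cone_def prod.case
      by (intro CollectI exI[of _ a] exI[of _ b]
          exI[of _ "\<lambda>J. inf_vec (- hyp2 \<union> E_zero S \<union> hd Fs \<union> hd Gs) J + ereal (vec_nth x J) + ereal c"]
          conjI ab y)
  qed
qed

lemma tp_class_shift: "tp_class (\<lambda>i. w i + ereal c) = tp_class w"
proof -
  have "\<exists>e'. (\<lambda>i. w i + ereal c + ereal e) = (\<lambda>i. w i + ereal e')" for e
    by (intro exI[of _ "c + e"]) (auto simp: add.assoc)
  moreover have "\<exists>e'. (\<lambda>i. w i + ereal e) = (\<lambda>i. w i + ereal c + ereal e')" for e
    by (intro exI[of _ "e - c"]) (auto simp: add.assoc)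
  ultimately show ?thesis unfolding tp_class_def by blast
qed

lemma tp_class_eqD:
  assumes "tp_class v = tp_class w"
  shows "\<exists>c. v = (\<lambda>i. w i + ereal c)"
proof -
  have "v \<in> tp_class v" unfolding tp_class_def by (auto intro!: exI[of _ 0] simp flip: zero_ereal_def)
  then show ?thesis using assms unfolding tp_class_def by auto
qed

context
  assumes n2: "2 \<le> CARD('n::finite)"
begin

lemma lin_coord_edge:
  "(i :: 'n) \<noteq> j \<Longrightarrow> lin_coord S \<alpha> (- {i, j}) = (if i \<in> S then 0 else \<alpha> i) + (if j \<in> S then 0 else \<alpha> j)"
proof -
  assume ij: "i \<noteq> j"
  have "- S - - {i, j} = {i, j} - S" by auto
  then show ?thesis using ij
    by (cases "i \<in> S"; cases "j \<in> S") (simp_all add: lin_coord_def insert_Diff_if)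
qed

lemma chain_pair_tails:
  assumes "chain_of_flats (M_full (S :: 'n set)) Fs" "chain_of_flats (M_hat S) Gs"
  shows "F \<in> set (tl Fs) \<Longrightarrow> hd Fs \<subset> F \<and> F \<subset> E_full S"
    "G \<in> set (tl Gs) \<Longrightarrow> hd Gs \<subset> G \<and> G \<subset> E_hat S"
    "hd Fs \<subseteq> E_full S" "hd Gs \<subseteq> E_hat S"
    "set (tl Fs) \<inter> set (tl Gs) = {}"
    "set (tl Fs) = {F \<in> tails Fs Gs. F \<subseteq> E_full S}" "set (tl Gs) = {G \<in> tails Fs Gs. G \<subseteq> E_hat S}"
proof -
  have 1: "hd Fs \<subset> F \<and> F \<subset> E_full S" if "F \<in> set (tl Fs)" for F
    using chain_of_flatsD(4)[OF assms(1) that] by (simp add: ground_M_full[OF n2])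
  have 2: "hd Gs \<subset> G \<and> G \<subset> E_hat S" if "G \<in> set (tl Gs)" for G
    using chain_of_flatsD(4)[OF assms(2) that] by (simp add: ground_M_hat[OF n2])
  show "F \<in> set (tl Fs) \<Longrightarrow> hd Fs \<subset> F \<and> F \<subset> E_full S"
    "G \<in> set (tl Gs) \<Longrightarrow> hd Gs \<subset> G \<and> G \<subset> E_hat S" using 1 2 by auto
  show "hd Fs \<subseteq> E_full S" "hd Gs \<subseteq> E_hat S"
    using chain_of_flatsD(3)[OF assms(1)] chain_of_flatsD(3)[OF assms(2)]
    by (simp_all add: ground_M_full[OF n2] ground_M_hat[OF n2])
  have disj: "E_full S \<inter> E_hat S = {}" by (rule hyp2_partition(2)[OF n2])
  have no: "\<not> F \<subseteq> E_hat S" if "F \<in> set (tl Fs)" for F using 1[OF that] disj by blast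
  have no': "\<not> G \<subseteq> E_full S" if "G \<in> set (tl Gs)" for G using 2[OF that] disj by blast
  show "set (tl Fs) \<inter> set (tl Gs) = {}" using no 2 by auto
  show "set (tl Fs) = {F \<in> tails Fs Gs. F \<subseteq> E_full S}" using 1 no' by (auto simp: tails_def)
  show "set (tl Gs) = {G \<in> tails Fs Gs. G \<subseteq> E_hat S}" using 2 no by (auto simp: tails_def)
qed

lemma tails_sum:
  assumes "chain_of_flats (M_full (S :: 'n set)) Fs" "chain_of_flats (M_hat S) Gs"
  shows "J \<in> E_full S \<Longrightarrow> (\<Sum>F\<in>tails Fs Gs. if J \<in> F then \<kappa> F else 0)
      = (\<Sum>F\<in>set (tl Fs). if J \<in> F then \<kappa> F else (0::real))"
    "J \<in> E_hat S \<Longrightarrow> (\<Sum>F\<in>tails Fs Gs. if J \<in> F then \<kappa> F else 0)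
      = (\<Sum>F\<in>set (tl Gs). if J \<in> F then \<kappa> F else (0::real))"
proof -
  have disj: "E_full S \<inter> E_hat S = {}" by (rule hyp2_partition(2)[OF n2])
  note T = chain_pair_tails[OF assms]
  have no: "J \<notin> F" if "J \<in> E_hat S" "F \<in> set (tl Fs)" for F J using T(1)[OF that(2)] disj that by blast
  have no': "J \<notin> F" if "J \<in> E_full S" "F \<in> set (tl Gs)" for F J using T(2)[OF that(2)] disj that by blast
  show "J \<in> E_full S \<Longrightarrow> (\<Sum>F\<in>tails Fs Gs. if J \<in> F then \<kappa> F else 0)
      = (\<Sum>F\<in>set (tl Fs). if J \<in> F then \<kappa> F else (0::real))"
    by (intro sum.mono_neutral_right) (auto simp: tails_def no')
  show "J \<in> E_hat S \<Longrightarrow> (\<Sum>F\<in>tails Fs Gs. if J \<in> F then \<kappa> F else 0)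
      = (\<Sum>F\<in>set (tl Gs). if J \<in> F then \<kappa> F else (0::real))"
    by (intro sum.mono_neutral_right) (auto simp: tails_def no)
qed

lemma flag_pairD:
  assumes "(S :: 'n set, Fs, Gs) \<in> flag_chain_pairs"
  shows "S \<noteq> UNIV" "chain_of_flats (M_full S) Fs" "chain_of_flats (M_hat S) Gs"
    "hd Fs \<noteq> E_full S \<or> hd Gs \<noteq> E_hat S"
  using assms exceptional_chain_iff[of "M_full S" Fs] exceptional_chain_iff[of "M_hat S" Gs]
  by (auto simp: flag_chain_pairs_def ground_M_full[OF n2] ground_M_hat[OF n2])

lemma flag_point_tp_reps:
  assumes t: "(S :: 'n set, Fs, Gs) \<in> flag_chain_pairs"
  shows "flag_u S (hd Fs \<union> hd Gs) (tails Fs Gs) \<alpha> \<kappa> c \<in> tp_reps hyp2" "flag_v S \<alpha> \<in> tp_reps hyp1"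
    "{J \<in> hyp2. flag_u S (hd Fs \<union> hd Gs) (tails Fs Gs) \<alpha> \<kappa> c J = \<infinity>} = E_zero S \<union> (hd Fs \<union> hd Gs)"
    "{I \<in> hyp1. flag_v S \<alpha> I = \<infinity>} = (\<lambda>i. - {i}) ` S"
proof -
  note P = flag_pairD[OF t]
  note T = chain_pair_tails[OF P(2,3)]
  note E = hyp2_partition[OF n2, of S]
  obtain J where "J \<in> hyp2 - (E_zero S \<union> (hd Fs \<union> hd Gs))"
  proof -
    have "\<exists>J. J \<in> E_full S - hd Fs \<or> J \<in> E_hat S - hd Gs" using P(4) T(3,4) by blast
    then obtain J where "J \<in> E_full S - hd Fs \<or> J \<in> E_hat S - hd Gs" by blast
    then have "J \<in> hyp2 - (E_zero S \<union> (hd Fs \<union> hd Gs))" using E T(3,4) by blast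
    then show ?thesis using that by blast
  qed
  then show "flag_u S (hd Fs \<union> hd Gs) (tails Fs Gs) \<alpha> \<kappa> c \<in> tp_reps hyp2"
    by (auto simp: tp_reps_def flag_u_def)
  obtain i where i: "i \<notin> S" using P(1) by auto
  have "\<exists>I\<in>hyp1. flag_v S \<alpha> I \<noteq> \<infinity>"
    by (rule bexI[of _ "- {i}"]) (simp_all add: flag_v_vertex i hyp1_vertex)
  moreover have "flag_v S \<alpha> I \<noteq> -\<infinity>" for I by (simp add: flag_v_def)
  ultimately show "flag_v S \<alpha> \<in> tp_reps hyp1" unfolding tp_reps_def using flag_v_outside by blast
  have "E_zero S \<union> (hd Fs \<union> hd Gs) \<subseteq> hyp2" using E T(3,4) by blast
  then show "{J \<in> hyp2. flag_u S (hd Fs \<union> hd Gs) (tails Fs Gs) \<alpha> \<kappa> c J = \<infinity>} = E_zero S \<union> (hd Fs \<union> hd Gs)"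
    by (auto simp: flag_u_def)
  show "{I \<in> hyp1. flag_v S \<alpha> I = \<infinity>} = (\<lambda>i. - {i}) ` S"
  proof (intro equalityI subsetI)
    fix I assume I: "I \<in> {I \<in> hyp1. flag_v S \<alpha> I = \<infinity>}"
    then obtain i where "I = - {i}" using hyp1_iff[of I] by auto
    then show "I \<in> (\<lambda>i. - {i}) ` S" using I flag_v_vertex[of S \<alpha> i] by (auto split: if_splits)
  qed (auto simp: flag_v_vertex hyp1_vertex)
qed

text \<open>
  The normalised edge coordinate \<open>D\<close> is larger on edges that lie in more members of the chain.  Given two edges
  of a triangle of inner edges, one of them lies in every chain member that contains the other; such a
  member contains both and hence, being a flat, the third edge.  On the edges
  leaving \<open>S\<close> every flat contains all or none of the edges at a given vertex of \<open>S\<close>.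
\<close>

lemma flag_point_incidence:
  assumes t: "(S :: 'n set, Fs, Gs) \<in> flag_chain_pairs" and \<kappa>: "\<forall>F. 0 \<le> \<kappa> F"
  shows "tropical_incidence (flag_u S (hd Fs \<union> hd Gs) (tails Fs Gs) \<alpha> \<kappa> c) (flag_v S \<alpha>)"
    (is "tropical_incidence ?u _")
proof -
  note P = flag_pairD[OF t]
  note T = chain_pair_tails[OF P(2,3)]
  note E = hyp2_partition[OF n2, of S]
  define D where "D J = (if J \<in> hd Fs \<union> hd Gs then \<infinity>
      else ereal ((\<Sum>F\<in>tails Fs Gs. if J \<in> F then \<kappa> F else 0) + c))" for J
  have Dm: "D J \<noteq> -\<infinity>" for J by (simp add: D_def)
  have um: "?u J \<noteq> -\<infinity>" for J by (simp add: flag_u_def)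
  have uD: "?u J = D J + ereal (lin_coord S \<alpha> J)" if "J \<in> hyp2" "J \<notin> E_zero S" for J
    using that by (auto simp: flag_u_def D_def)
  have ue: "?u (- {i, j}) = D (- {i, j}) + ereal ((if i \<in> S then 0 else \<alpha> i) + (if j \<in> S then 0 else \<alpha> j))"
    if "i \<noteq> j" "i \<notin> S \<or> j \<notin> S" for i j
    using uD[of "- {i, j}"] that hyp2_edge[OF n2, of i j] edge_in_E_zero_iff[OF n2, of i j S]
      lin_coord_edge[of i j S \<alpha>] by auto
  have uz: "?u (- {i, j}) = \<infinity>" if "i \<noteq> j" "i \<in> S" "j \<in> S" for i j
    using edge_in_E_zero_iff[OF n2, of i j S] that by (simp add: flag_u_def)
  have D_mono: "D J \<le> D J'"
    if J: "J \<in> E_full S" "J' \<in> E_full S" and le: "\<And>F. F \<in> set Fs \<Longrightarrow> J \<in> F \<Longrightarrow> J' \<in> F" for J J'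
  proof -
    have hd: "hd Fs \<in> set Fs" and tl: "\<And>F. F \<in> set (tl Fs) \<Longrightarrow> F \<in> set Fs"
      using chain_of_flatsD(7)[OF P(2)] by auto
    have "J \<notin> hd Gs" "J' \<notin> hd Gs" using J E(2) T(4) by auto
    moreover have "(\<Sum>F\<in>set (tl Fs). if J \<in> F then \<kappa> F else 0) \<le> (\<Sum>F\<in>set (tl Fs). if J' \<in> F then \<kappa> F else 0)"
      using le tl \<kappa> by (intro sum_mono) auto
    ultimately show ?thesis
      using le[OF hd] tails_sum(1)[OF P(2,3) J(1), of \<kappa>] tails_sum(1)[OF P(2,3) J(2), of \<kappa>]
      by (simp add: D_def)
  qed
  have D_tri: "min (D (- {i, k})) (D (- {i, j})) \<le> D (- {j, k})"
    if d: "i \<noteq> j" "i \<noteq> k" "j \<noteq> k" and R: "i \<notin> S" "j \<notin> S" "k \<notin> S" for i j k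
  proof -
    have mem: "- {i, k} \<in> E_full S" "- {i, j} \<in> E_full S" "- {j, k} \<in> E_full S"
      using d R by (simp_all add: edge_in_E_full_iff[OF n2])
    have closed: "- {j, k} \<in> F" if F: "F \<in> set Fs" "- {i, k} \<in> F" "- {i, j} \<in> F" for F
    proof -
      have fl: "flat (M_full S) F"
        using F(1) chain_of_flatsD(2,4)[OF P(2)] chain_of_flatsD(7)[OF P(2)] by auto
      have e: "- {j, i} = - {i, j}" by auto
      show ?thesis
        using iffD1[OF flat_M_full_iff[OF n2] fl, THEN conjunct2, rule_format, of j i k]
          F(2,3) d unfolding e by simp
    qed
    have "(\<forall>F\<in>set Fs. - {i, k} \<in> F \<longrightarrow> - {i, j} \<in> F) \<or> (\<forall>F\<in>set Fs. - {i, j} \<in> F \<longrightarrow> - {i, k} \<in> F)"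
    proof (rule ccontr)
      assume "\<not> ?thesis"
      then obtain F F' where F: "F \<in> set Fs" "F' \<in> set Fs" "- {i, k} \<in> F" "- {i, j} \<notin> F"
        "- {i, j} \<in> F'" "- {i, k} \<notin> F'" by blast
      have "F \<subseteq> F' \<or> F' \<subseteq> F"
        using chain_of_flatsD(5)[OF P(2)] F(1,2) unfolding subset_chain_def by blast
      then show False using F by auto
    qed
    then show ?thesis
    proof
      assume "\<forall>F\<in>set Fs. - {i, k} \<in> F \<longrightarrow> - {i, j} \<in> F"
      then have "D (- {i, k}) \<le> D (- {j, k})" using closed by (intro D_mono mem) auto
      then show ?thesis by (simp add: min_le_iff_disj)
    next
      assume "\<forall>F\<in>set Fs. - {i, j} \<in> F \<longrightarrow> - {i, k} \<in> F"
      then have "D (- {i, j}) \<le> D (- {j, k})" using closed by (intro D_mono mem) auto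
      then show ?thesis by (simp add: min_le_iff_disj)
    qed
  qed
  have D_hat: "D (- {a, j}) = D (- {a, k})" if a: "a \<in> S" and R: "j \<notin> S" "k \<notin> S" for a j k
  proof -
    have aj: "a \<noteq> j" "a \<noteq> k" using a R by auto
    have mem: "- {a, j} \<in> E_hat S" "- {a, k} \<in> E_hat S"
      using a R aj by (simp_all add: edge_in_E_hat_iff[OF n2])
    have same: "- {a, j} \<in> G \<longleftrightarrow> - {a, k} \<in> G" if G: "G \<in> set Gs" for G
    proof -
      have "flat (M_hat S) G"
        using G chain_of_flatsD(2,4)[OF P(3)] chain_of_flatsD(7)[OF P(3)] by auto
      then show ?thesis using a R unfolding flat_M_hat_iff[OF n2] by auto
    qed
    have hd: "hd Gs \<in> set Gs" and tl: "\<And>F. F \<in> set (tl Gs) \<Longrightarrow> F \<in> set Gs"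
      using chain_of_flatsD(7)[OF P(3)] by auto
    have "- {a, j} \<notin> hd Fs" "- {a, k} \<notin> hd Fs" using mem E(2) T(3) by auto
    moreover have "(\<Sum>F\<in>set (tl Gs). if - {a, j} \<in> F then \<kappa> F else 0) = (\<Sum>F\<in>set (tl Gs). if - {a, k} \<in> F then \<kappa> F else 0)"
      using same tl by (intro sum.cong) auto
    ultimately show ?thesis
      using same[OF hd] tails_sum(2)[OF P(2,3) mem(1), of \<kappa>] tails_sum(2)[OF P(2,3) mem(2), of \<kappa>]
      by (simp add: D_def)
  qed
  show ?thesis
    unfolding tropical_incidence_def
  proof (intro conjI allI impI)
    show "?u \<in> tp_reps hyp2" "flag_v S \<alpha> \<in> tp_reps hyp1"
      using flag_point_tp_reps[OF t] by auto
    fix i j k :: 'n assume d: "i \<noteq> j" "i \<noteq> k" "j \<noteq> k"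
    consider "i \<in> S \<or> (j \<in> S \<and> k \<in> S)" | "i \<notin> S" "j \<in> S" "k \<notin> S" | "i \<notin> S" "j \<notin> S" "k \<in> S"
      | "i \<notin> S" "j \<notin> S" "k \<notin> S" by blast
    then show "min (?u (- {i, k}) + flag_v S \<alpha> (- {j})) (?u (- {i, j}) + flag_v S \<alpha> (- {k}))
        \<le> ?u (- {j, k}) + flag_v S \<alpha> (- {i})"
    proof cases
      case 1
      then have top: "?u (- {j, k}) + flag_v S \<alpha> (- {i}) = \<infinity>"
        using um[of "- {j, k}"] uz[of j k] d by (auto simp: flag_v_vertex)
      show ?thesis unfolding top by simp
    next
      case 2
      have e: "- {i, j} = - {j, i}" by auto
      have eq: "?u (- {i, j}) + flag_v S \<alpha> (- {k}) = ?u (- {j, k}) + flag_v S \<alpha> (- {i})"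
        using ue[of j i] ue[of j k] D_hat[of j i k] 2 d unfolding e
        by (cases "D (- {j, k})") (auto simp: flag_v_vertex)
      show ?thesis unfolding eq by (rule min.cobounded2)
    next
      case 3
      have e: "- {i, k} = - {k, i}" "- {j, k} = - {k, j}" by auto
      have eq: "?u (- {i, k}) + flag_v S \<alpha> (- {j}) = ?u (- {j, k}) + flag_v S \<alpha> (- {i})"
        using ue[of k i] ue[of k j] D_hat[of k i j] 3 d unfolding e
        by (cases "D (- {k, j})") (auto simp: flag_v_vertex)
      show ?thesis unfolding eq by (rule min.cobounded1)
    next
      case 4
      have "?u (- {i, k}) + flag_v S \<alpha> (- {j}) = D (- {i, k}) + ereal (\<alpha> i + \<alpha> j + \<alpha> k)"
        "?u (- {i, j}) + flag_v S \<alpha> (- {k}) = D (- {i, j}) + ereal (\<alpha> i + \<alpha> j + \<alpha> k)"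
        "?u (- {j, k}) + flag_v S \<alpha> (- {i}) = D (- {j, k}) + ereal (\<alpha> i + \<alpha> j + \<alpha> k)"
        using ue[of i k] ue[of i j] ue[of j k] 4 d
        by (cases "D (- {i, k})"; cases "D (- {i, j})"; cases "D (- {j, k})"; simp add: flag_v_vertex)+
      then show ?thesis
        using D_tri[OF d 4] by (auto simp: min_le_iff_disj intro: add_right_mono)
    qed
  qed
qed

text \<open>
  The superlevel sets of the normalised edge coordinate \<open>D\<close> are flats on both ground sets.  The two
  chains come with two minima \<open>m1\<close> and \<open>m2\<close>, whereas a cone has a single constant \<open>c\<close>; shifting all
  vertex coordinates by \<open>s\<close> subtracts \<open>2 * s\<close> from \<open>D\<close> on inner edges and \<open>s\<close> on leaving ones, and is
  invisible in the second projective space.  Solving $2s + c = m_1$ and $s + c = m_2$ gives the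
  constants used below.
\<close>

lemma incidence_imp_flag_cone:
  fixes u v :: "'n set \<Rightarrow> ereal"
  assumes inc: "tropical_incidence u v"
  shows "\<exists>t\<in>flag_chain_pairs. (tp_class u, tp_class v) \<in> flag_cone t"
proof -
  have um: "u J \<noteq> -\<infinity>" and vm: "v J \<noteq> -\<infinity>"
    and u0: "J \<notin> hyp2 \<Longrightarrow> u J = \<infinity>" and v0: "J \<notin> hyp1 \<Longrightarrow> v J = \<infinity>" for J
    using inc by (auto simp: tropical_incidence_def tp_reps_def)
  have rel: "min (u (- {i, k}) + v (- {j})) (u (- {i, j}) + v (- {k})) \<le> u (- {j, k}) + v (- {i})"
    if "i \<noteq> j" "i \<noteq> k" "j \<noteq> k" for i j k
    using inc that by (simp add: tropical_incidence_def)
  define S where "S = {i. v (- {i}) = \<infinity>}"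
  obtain I0 where I0: "I0 \<in> hyp1" "v I0 \<noteq> \<infinity>"
    using inc by (auto simp: tropical_incidence_def tp_reps_def)
  obtain j0 where "I0 = - {j0}" using iffD1[OF hyp1_iff I0(1)] ..
  then have j0: "j0 \<notin> S" using I0(2) by (simp add: S_def)
  note E = hyp2_partition[OF n2, of S]
  define \<alpha> where "\<alpha> i = real_of_ereal (v (- {i}))" for i
  have va: "v (- {i}) = ereal (\<alpha> i)" if "i \<notin> S" for i
    using that vm[of "- {i}"] by (auto simp: S_def \<alpha>_def ereal_real)
  have vS: "v (- {i}) = \<infinity>" if "i \<in> S" for i using that by (simp add: S_def)
  define D where "D J = u J - ereal (lin_coord S \<alpha> J)" for J
  have uD: "u J = D J + ereal (lin_coord S \<alpha> J)" and Dm: "D J \<noteq> -\<infinity>"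
    and Dinf: "D J = \<infinity> \<longleftrightarrow> u J = \<infinity>" for J
    using um[of J] by (cases "u J"; simp add: D_def)+
  have ue: "u (- {i, j}) = D (- {i, j}) + ereal ((if i \<in> S then 0 else \<alpha> i) + (if j \<in> S then 0 else \<alpha> j))"
    if "i \<noteq> j" for i j
    using uD[of "- {i, j}"] lin_coord_edge[OF that, of S \<alpha>] by simp
  have uz: "u J = \<infinity>" if J: "J \<in> E_zero S" for J
  proof -
    have "J \<in> hyp2" using J E by auto
    then obtain a b where ab: "a \<noteq> b" "J = - {a, b}" by (rule hyp2_cases[OF n2])
    then have S: "a \<in> S" "b \<in> S" using J edge_in_E_zero_iff[OF n2, of a b S] by auto
    then have "j0 \<noteq> a" "j0 \<noteq> b" using j0 by auto
    then show ?thesis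
      using rel[of j0 a b] ab S va[OF j0] vS um by (cases "u (- {a, b})") auto
  qed
  have D_tri: "min (D (- {i, j})) (D (- {j, k})) \<le> D (- {i, k})"
    if d: "i \<noteq> j" "i \<noteq> k" "j \<noteq> k" and R: "i \<notin> S" "j \<notin> S" "k \<notin> S" for i j k
  proof -
    have e: "- {j, i} = - {i, j}" by auto
    have "u (- {j, k}) + v (- {i}) = D (- {j, k}) + ereal (\<alpha> i + \<alpha> j + \<alpha> k)"
      "u (- {j, i}) + v (- {k}) = D (- {i, j}) + ereal (\<alpha> i + \<alpha> j + \<alpha> k)"
      "u (- {i, k}) + v (- {j}) = D (- {i, k}) + ereal (\<alpha> i + \<alpha> j + \<alpha> k)"
      unfolding e using ue[of j k] ue[of i j] ue[of i k] va R d
      by (cases "D (- {j, k})"; cases "D (- {i, j})"; cases "D (- {i, k})"; simp)+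
    then have "min (D (- {j, k}) + ereal (\<alpha> i + \<alpha> j + \<alpha> k)) (D (- {i, j}) + ereal (\<alpha> i + \<alpha> j + \<alpha> k))
       \<le> D (- {i, k}) + ereal (\<alpha> i + \<alpha> j + \<alpha> k)"
      using rel[of j i k] d by simp
    then show ?thesis
      using Dm by (cases "D (- {j, k})"; cases "D (- {i, j})"; cases "D (- {i, k})")
        (auto simp: min_def split: if_splits)
  qed
  have D_hat: "D (- {a, j}) \<le> D (- {a, k})" if a: "a \<in> S" and R: "j \<notin> S" "k \<notin> S" for a j k
  proof (cases "j = k")
    case False
    have aj: "a \<noteq> j" "a \<noteq> k" using a R by auto
    have e: "- {j, a} = - {a, j}" by auto
    have "u (- {a, j}) + ereal (\<alpha> k) \<le> u (- {a, k}) + ereal (\<alpha> j)"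
      using rel[of j a k] aj False va[OF R(1)] va[OF R(2)] vS[OF a] um unfolding e by auto
    then show ?thesis
      using ue[OF aj(1)] ue[OF aj(2)] a R Dm
      by (cases "D (- {a, j})"; cases "D (- {a, k})") auto
  qed simp
  have flat_full: "flat (M_full S) {J \<in> ground (M_full S). b \<le> D J}" for b
    unfolding flat_M_full_iff[OF n2] ground_M_full[OF n2]
  proof (intro conjI allI impI)
    fix i j k assume d: "i \<noteq> j" "i \<noteq> k" "j \<noteq> k"
      and e: "- {i, j} \<in> {J \<in> E_full S. b \<le> D J}" "- {j, k} \<in> {J \<in> E_full S. b \<le> D J}"
    have R: "i \<notin> S" "j \<notin> S" "k \<notin> S" using e d by (simp_all add: edge_in_E_full_iff[OF n2])
    then have "- {i, k} \<in> E_full S" using d by (simp add: edge_in_E_full_iff[OF n2])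
    moreover have "b \<le> D (- {i, k})"
      by (rule order_trans[OF _ D_tri[OF d R]]) (use e in simp)
    ultimately show "- {i, k} \<in> {J \<in> E_full S. b \<le> D J}" by simp
  qed auto
  have flat_hat: "flat (M_hat S) {J \<in> ground (M_hat S). b \<le> D J}" for b
    unfolding flat_M_hat_iff[OF n2] ground_M_hat[OF n2]
  proof (intro conjI ballI impI)
    fix a j k assume a: "a \<in> S" "j \<in> - S" "k \<in> - S" and e: "- {a, j} \<in> {J \<in> E_hat S. b \<le> D J}"
    have "a \<noteq> k" using a by auto
    then have "- {a, k} \<in> E_hat S" using a edge_in_E_hat_iff[OF n2, of a k S] by simp
    moreover have "b \<le> D (- {a, k})"
      by (rule order_trans[OF _ D_hat[of a j k]]) (use e a in auto)
    ultimately show "- {a, k} \<in> {J \<in> E_hat S. b \<le> D J}" by simp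
  qed auto
  have "\<exists>Fs \<kappa>1 m1. chain_of_flats (M_full S) Fs \<and> (\<forall>F. 0 \<le> \<kappa>1 F) \<and>
      hd Fs = {J \<in> E_full S. D J = \<infinity>} \<and> (\<forall>J\<in>E_full S - hd Fs.
        D J = ereal ((\<Sum>F\<in>set (tl Fs). if J \<in> F then \<kappa>1 F else 0) + m1))"
    using chain_of_flats_of_superlevel_sets[of "M_full S" D, OF _ Dm flat_full]
    by (simp only: ground_M_full[OF n2] finite)
  then obtain Fs \<kappa>1 m1 where HF: "chain_of_flats (M_full S) Fs \<and> (\<forall>F. 0 \<le> \<kappa>1 F) \<and>
      hd Fs = {J \<in> E_full S. D J = \<infinity>} \<and> (\<forall>J\<in>E_full S - hd Fs.
        D J = ereal ((\<Sum>F\<in>set (tl Fs). if J \<in> F then \<kappa>1 F else 0) + m1))"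
    by (elim exE)
  note F = conjunct1[OF HF] spec[OF conjunct1[OF conjunct2[OF HF]]]
    conjunct1[OF conjunct2[OF conjunct2[OF HF]]] bspec[OF conjunct2[OF conjunct2[OF conjunct2[OF HF]]]]
  have "\<exists>Gs \<kappa>2 m2. chain_of_flats (M_hat S) Gs \<and> (\<forall>F. 0 \<le> \<kappa>2 F) \<and>
      hd Gs = {J \<in> E_hat S. D J = \<infinity>} \<and> (\<forall>J\<in>E_hat S - hd Gs.
        D J = ereal ((\<Sum>F\<in>set (tl Gs). if J \<in> F then \<kappa>2 F else 0) + m2))"
    using chain_of_flats_of_superlevel_sets[of "M_hat S" D, OF _ Dm flat_hat]
    by (simp only: ground_M_hat[OF n2] finite)
  then obtain Gs \<kappa>2 m2 where HG: "chain_of_flats (M_hat S) Gs \<and> (\<forall>F. 0 \<le> \<kappa>2 F) \<and>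
      hd Gs = {J \<in> E_hat S. D J = \<infinity>} \<and> (\<forall>J\<in>E_hat S - hd Gs.
        D J = ereal ((\<Sum>F\<in>set (tl Gs). if J \<in> F then \<kappa>2 F else 0) + m2))"
    by (elim exE)
  note G = conjunct1[OF HG] spec[OF conjunct1[OF conjunct2[OF HG]]]
    conjunct1[OF conjunct2[OF conjunct2[OF HG]]] bspec[OF conjunct2[OF conjunct2[OF conjunct2[OF HG]]]]
  note T = chain_pair_tails[OF F(1) G(1)]
  have t: "(S, Fs, Gs) \<in> flag_chain_pairs"
  proof -
    have "\<exists>J\<in>hyp2. u J \<noteq> \<infinity>" using inc by (auto simp: tropical_incidence_def tp_reps_def)
    then have "\<exists>J\<in>E_full S \<union> E_hat S. D J \<noteq> \<infinity>" using E uz Dinf by blast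
    then have "\<not> (hd Fs = E_full S \<and> hd Gs = E_hat S)" unfolding F(3) G(3) by blast
    then show ?thesis
      using j0 F(1) G(1) exceptional_chain_iff[OF F(1)] exceptional_chain_iff[OF G(1)]
      by (auto simp: flag_chain_pairs_def ground_M_full[OF n2] ground_M_hat[OF n2])
  qed
  \<comment> \<open>No member of the second tail lies in \<^term>\<open>E_full S\<close>, so both families of coefficients fit into one.\<close>
  define \<kappa> where "\<kappa> F = (if F \<subseteq> E_full S then \<kappa>1 F else \<kappa>2 F)" for F
  have \<kappa>: "\<forall>F. 0 \<le> \<kappa> F" using F(2) G(2) by (simp add: \<kappa>_def)
  define s where "s = m1 - m2"
  define c where "c = 2 * m2 - m1"
  define \<beta> where "\<beta> i = \<alpha> i + s" for i
  have lin: "lin_coord S \<beta> J = lin_coord S \<alpha> J + real (card (- S - J)) * s" for J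
    by (simp add: lin_coord_def \<beta>_def sum.distrib)
  have "flag_u S (hd Fs \<union> hd Gs) (tails Fs Gs) \<beta> \<kappa> c = u"
  proof
    fix J
    consider "J \<notin> hyp2" | "J \<in> E_zero S" | "J \<in> hd Fs \<union> hd Gs"
      | "J \<in> E_full S - hd Fs" | "J \<in> E_hat S - hd Gs" using E by blast
    then show "flag_u S (hd Fs \<union> hd Gs) (tails Fs Gs) \<beta> \<kappa> c J = u J"
    proof cases
      case 1 then show ?thesis using u0 by (simp add: flag_u_def)
    next
      case 2 then show ?thesis using uz by (simp add: flag_u_def)
    next
      case 3
      then have "u J = \<infinity>" unfolding F(3) G(3) using Dinf by auto
      then show ?thesis using 3 by (simp add: flag_u_def)
    next
      case 4
      then have J: "J \<in> hyp2 - (E_zero S \<union> (hd Fs \<union> hd Gs))" "J \<in> E_full S" using E T(4) by blast+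
      then have "J \<in> hyp2" by simp
      then obtain i j where ij: "i \<noteq> j" "J = - {i, j}" by (rule hyp2_cases[OF n2])
      then have "i \<notin> S" "j \<notin> S" using J(2) edge_in_E_full_iff[OF n2, of i j S] by auto
      then have "- S - J = {i, j}" using ij by auto
      then have "card (- S - J) = 2" using ij by simp
      moreover have "(\<Sum>F\<in>tails Fs Gs. if J \<in> F then \<kappa> F else 0) = (\<Sum>F\<in>set (tl Fs). if J \<in> F then \<kappa>1 F else 0)"
        unfolding tails_sum(1)[OF F(1) G(1) J(2)] using T(6) by (intro sum.cong) (auto simp: \<kappa>_def)
      ultimately show ?thesis
        using J(1) uD[of J] F(4)[OF 4] by (simp add: flag_u_def lin s_def c_def)
    next
      case 5
      then have J: "J \<in> hyp2 - (E_zero S \<union> (hd Fs \<union> hd Gs))" "J \<in> E_hat S" using E T(3) by blast+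
      then have "J \<in> hyp2" by simp
      then obtain i j where ij: "i \<noteq> j" "J = - {i, j}" by (rule hyp2_cases[OF n2])
      then have "(i \<in> S) \<noteq> (j \<in> S)" using J(2) edge_in_E_hat_iff[OF n2, of i j S] by auto
      then have "- S - J = {i} \<or> - S - J = {j}" using ij by auto
      then have "card (- S - J) = 1" by auto
      moreover have "(\<Sum>F\<in>tails Fs Gs. if J \<in> F then \<kappa> F else 0) = (\<Sum>F\<in>set (tl Gs). if J \<in> F then \<kappa>2 F else 0)"
      proof -
        have "\<not> G \<subseteq> E_full S" if G: "G \<in> set (tl Gs)" for G
        proof -
          have "G \<notin> set (tl Fs)" using T(5) G by blast
          moreover have "G \<in> tails Fs Gs" using G by (simp add: tails_def)
          ultimately show ?thesis unfolding T(6) by simp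
        qed
        then show ?thesis
          unfolding tails_sum(2)[OF F(1) G(1) J(2)] by (intro sum.cong) (auto simp: \<kappa>_def)
      qed
      ultimately show ?thesis
        using J(1) uD[of J] G(4)[OF 5] by (simp add: flag_u_def lin s_def c_def)
    qed
  qed
  moreover have "flag_v S \<beta> = (\<lambda>I. v I + ereal s)"
  proof
    fix I show "flag_v S \<beta> I = v I + ereal s"
    proof (cases "I \<in> hyp1")
      case True
      then obtain i where "I = - {i}" using hyp1_iff[of I] by auto
      then show ?thesis using va[of i] vS[of i] by (simp add: flag_v_vertex \<beta>_def)
    next
      case False then show ?thesis using v0 by (simp add: flag_v_outside)
    qed
  qed
  ultimately have "(tp_class u, tp_class v) \<in> flag_cone (S, Fs, Gs)"
    unfolding flag_cone_eq mem_Collect_eq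
    using \<kappa> tp_class_shift[of v s] by (intro exI[of _ \<beta>] exI[of _ \<kappa>] exI[of _ c]) simp
  then show ?thesis using t by blast
qed

lemma Union_flag_cones:
  "(\<Union>t\<in>flag_chain_pairs :: ('n set \<times> 'n set set list \<times> 'n set set list) set. flag_cone t) =
    {(tp_class u, tp_class v) | u v. tropical_incidence u (v :: 'n set \<Rightarrow> ereal)}"
proof (intro equalityI subsetI)
  fix p assume "p \<in> (\<Union>t\<in>flag_chain_pairs :: ('n set \<times> 'n set set list \<times> 'n set set list) set. flag_cone t)"
  then obtain S :: "'n set" and Fs Gs where t: "(S, Fs, Gs) \<in> flag_chain_pairs" "p \<in> flag_cone (S, Fs, Gs)"
    by auto
  then obtain \<alpha> \<kappa> c where "p = (tp_class (flag_u S (hd Fs \<union> hd Gs) (tails Fs Gs) \<alpha> \<kappa> c), tp_class (flag_v S \<alpha>))"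
    "\<forall>F. 0 \<le> \<kappa> F" unfolding flag_cone_eq by blast
  then show "p \<in> {(tp_class u, tp_class v) | u v. tropical_incidence u v}"
    using flag_point_incidence[OF t(1), of \<kappa> \<alpha> c] by blast
next
  fix p assume "p \<in> {(tp_class u, tp_class v) | u v. tropical_incidence u (v :: 'n set \<Rightarrow> ereal)}"
  then show "p \<in> (\<Union>t\<in>flag_chain_pairs. flag_cone t)" using incidence_imp_flag_cone by blast
qed

end

section \<open>Strata, uniqueness of the cones and the fan structure\<close>

definition ray :: "'n::finite set \<Rightarrow> 'n set set \<Rightarrow> 'n set set \<Rightarrow> (real ^ 'n set) \<times> (real ^ 'n set)" where
  "ray S I0 F = (\<chi> J. if J \<in> hyp2 - (E_zero S \<union> I0) \<and> J \<in> F then 1 else 0, 0)"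

text \<open>
  The finite coordinates of the lineality space common to all cones with the same infinite coordinates,
  including the two lines along which representatives of tropical projective points vary.
\<close>

definition lineality :: "'n::finite set \<Rightarrow> 'n set set \<Rightarrow> ((real ^ 'n set) \<times> (real ^ 'n set)) set" where
  "lineality S I0 =
     {(\<chi> J. if J \<in> hyp2 - (E_zero S \<union> I0) then lin_coord S \<alpha> J + c else 0,
       \<chi> I. if \<exists>i\<in>- S. I = - {i} then (\<Sum>i\<in>- S. if I = - {i} then \<alpha> i else 0) + c' else 0) | \<alpha> c c'. True}"

lemma subspace_lineality: "subspace (lineality S I0)"
proof (rule subspaceI)
  show "0 \<in> lineality S I0"
    unfolding lineality_def
    by (intro CollectI exI[of _ "\<lambda>_. 0"] exI[of _ 0])
      (simp add: prod_eq_iff Finite_Cartesian_Product.vec_eq_iff lin_coord_def)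
next
  fix x y assume "x \<in> lineality S I0" "y \<in> lineality S I0"
  then obtain \<alpha> c c' \<beta> e e' where
    x: "x = (\<chi> J. if J \<in> hyp2 - (E_zero S \<union> I0) then lin_coord S \<alpha> J + c else 0,
       \<chi> I. if \<exists>i\<in>- S. I = - {i} then (\<Sum>i\<in>- S. if I = - {i} then \<alpha> i else 0) + c' else 0)" and
    y: "y = (\<chi> J. if J \<in> hyp2 - (E_zero S \<union> I0) then lin_coord S \<beta> J + e else 0,
       \<chi> I. if \<exists>i\<in>- S. I = - {i} then (\<Sum>i\<in>- S. if I = - {i} then \<beta> i else 0) + e' else 0)"
    unfolding lineality_def by blast
  have 1: "lin_coord S (\<lambda>i. \<alpha> i + \<beta> i) J = lin_coord S \<alpha> J + lin_coord S \<beta> J" for J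
    by (simp add: lin_coord_def sum.distrib)
  have 2: "(\<Sum>i\<in>- S. if I = - {i} then \<alpha> i + \<beta> i else 0)
      = (\<Sum>i\<in>- S. if I = - {i} then \<alpha> i else 0) + (\<Sum>i\<in>- S. if I = - {i} then \<beta> i else 0)" for I
    by (subst sum.distrib[symmetric]) (intro sum.cong, auto)
  show "x + y \<in> lineality S I0"
    unfolding lineality_def x y
    by (intro CollectI exI[of _ "\<lambda>i. \<alpha> i + \<beta> i"] exI[of _ "c + e"] exI[of _ "c' + e'"])
      (simp add: prod_eq_iff Finite_Cartesian_Product.vec_eq_iff 1 2)
next
  fix r :: real and x assume "x \<in> lineality S I0"
  then obtain \<alpha> c c' where
    x: "x = (\<chi> J. if J \<in> hyp2 - (E_zero S \<union> I0) then lin_coord S \<alpha> J + c else 0,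
       \<chi> I. if \<exists>i\<in>- S. I = - {i} then (\<Sum>i\<in>- S. if I = - {i} then \<alpha> i else 0) + c' else 0)"
    unfolding lineality_def by blast
  have 1: "lin_coord S (\<lambda>i. r * \<alpha> i) J = r * lin_coord S \<alpha> J" for J
    by (simp add: lin_coord_def sum_distrib_left)
  have 2: "(\<Sum>i\<in>- S. if I = - {i} then r * \<alpha> i else 0) = r * (\<Sum>i\<in>- S. if I = - {i} then \<alpha> i else 0)" for I
    by (subst sum_distrib_left) (intro sum.cong, auto)
  show "r *\<^sub>R x \<in> lineality S I0"
    unfolding lineality_def x
    by (intro CollectI exI[of _ "\<lambda>i. r * \<alpha> i"] exI[of _ "r * c"] exI[of _ "r * c'"])
      (simp add: prod_eq_iff Finite_Cartesian_Product.vec_eq_iff 1 2 distrib_left)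
qed

lemma fst_sum_ray:
  "vec_nth (fst (\<Sum>F\<in>\<A>. \<kappa> F *\<^sub>R ray S I0 F)) J
    = (if J \<in> hyp2 - (E_zero S \<union> I0) then (\<Sum>F\<in>\<A>. if J \<in> F then \<kappa> F else 0) else 0)"
  unfolding fst_sum sum_component ray_def by (auto intro!: sum.cong sum.neutral)

lemma snd_sum_ray: "snd (\<Sum>F\<in>\<A>. \<kappa> F *\<^sub>R ray S I0 F) = 0"
  unfolding snd_sum ray_def by simp

lemma finite_part_flag_cone:
  "finite_part (flag_cone (S, Fs, Gs)) =
    simplicial_cone (lineality S (hd Fs \<union> hd Gs)) (ray S (hd Fs \<union> hd Gs)) (tails Fs Gs)"
    (is "_ = simplicial_cone (lineality S ?I) _ ?A")
proof -
  have eq: "((\<chi> J. real_of_ereal (flag_u S ?I ?A \<alpha> \<kappa> c J + ereal e)), (\<chi> I. real_of_ereal (flag_v S \<alpha> I + ereal e')))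
    = ((\<chi> J. if J \<in> hyp2 - (E_zero S \<union> ?I) then lin_coord S \<alpha> J + (c + e) else 0),
       (\<chi> I. if \<exists>i\<in>- S. I = - {i} then (\<Sum>i\<in>- S. if I = - {i} then \<alpha> i else 0) + e' else 0))
      + (\<Sum>F\<in>?A. \<kappa> F *\<^sub>R ray S ?I F)" for \<alpha> \<kappa> c e e'
    unfolding prod_eq_iff Finite_Cartesian_Product.vec_eq_iff fst_add snd_add vector_add_component
      fst_sum_ray snd_sum_ray
    by (auto simp: flag_u_def flag_v_def)
  show ?thesis
  proof (intro equalityI subsetI)
    fix p assume "p \<in> finite_part (flag_cone (S, Fs, Gs))"
    then obtain v w where p: "p = (\<chi> i. real_of_ereal (v i), \<chi> j. real_of_ereal (w j))"
      "(tp_class v, tp_class w) \<in> flag_cone (S, Fs, Gs)" unfolding finite_part_def by blast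
    obtain \<alpha> \<kappa> c where q: "tp_class v = tp_class (flag_u S ?I ?A \<alpha> \<kappa> c)" "tp_class w = tp_class (flag_v S \<alpha>)"
      "\<forall>F. 0 \<le> \<kappa> F" using p(2) unfolding flag_cone_eq by blast
    obtain e where e: "v = (\<lambda>J. flag_u S ?I ?A \<alpha> \<kappa> c J + ereal e)" using tp_class_eqD[OF q(1)] ..
    obtain e' where e': "w = (\<lambda>I. flag_v S \<alpha> I + ereal e')" using tp_class_eqD[OF q(2)] ..
    show "p \<in> simplicial_cone (lineality S ?I) (ray S ?I) ?A"
      unfolding p(1) e e' eq simplicial_cone_def lineality_def using q(3) by blast
  next
    fix p assume "p \<in> simplicial_cone (lineality S ?I) (ray S ?I) ?A"
    then obtain l \<kappa> where l: "l \<in> lineality S ?I" and \<kappa>: "\<forall>F. 0 \<le> \<kappa> F"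
      and p: "p = l + (\<Sum>F\<in>?A. \<kappa> F *\<^sub>R ray S ?I F)" unfolding simplicial_cone_def by blast
    obtain \<alpha> c c' where l': "l = (\<chi> J. if J \<in> hyp2 - (E_zero S \<union> ?I) then lin_coord S \<alpha> J + (c + 0) else 0,
       \<chi> I. if \<exists>i\<in>- S. I = - {i} then (\<Sum>i\<in>- S. if I = - {i} then \<alpha> i else 0) + c' else 0)"
      using l unfolding lineality_def add_0_right by blast
    have "(tp_class (\<lambda>J. flag_u S ?I ?A \<alpha> \<kappa> c J + ereal 0), tp_class (\<lambda>I. flag_v S \<alpha> I + ereal c'))
        \<in> flag_cone (S, Fs, Gs)"
      unfolding flag_cone_eq tp_class_shift using \<kappa> by blast
    then show "p \<in> finite_part (flag_cone (S, Fs, Gs))"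
      unfolding p l' eq[symmetric] finite_part_def
      by (intro CollectI exI[of _ "\<lambda>J. flag_u S ?I ?A \<alpha> \<kappa> c J + ereal 0"]
          exI[of _ "\<lambda>I. flag_v S \<alpha> I + ereal c'"] conjI refl)
  qed
qed

text \<open>
  Two representatives of a point differ by real constants, so they have the same infinite coordinates.
\<close>

lemma stratum_unique:
  assumes "p \<in> stratum A B P Q" "p \<in> stratum A B P' Q'"
  shows "P = P' \<and> Q = Q'"
proof -
  obtain v w where 1: "p = (tp_class v, tp_class w)" "{i \<in> A. v i = \<infinity>} = P" "{j \<in> B. w j = \<infinity>} = Q"
    using assms(1) unfolding stratum_def by blast
  obtain v' w' where 2: "p = (tp_class v', tp_class w')" "{i \<in> A. v' i = \<infinity>} = P'" "{j \<in> B. w' j = \<infinity>} = Q'"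
    using assms(2) unfolding stratum_def by blast
  have "tp_class v = tp_class v'" "tp_class w = tp_class w'" using 1(1) 2(1) by auto
  then obtain c c' where "v = (\<lambda>i. v' i + ereal c)" "w = (\<lambda>i. w' i + ereal c')"
    using tp_class_eqD by metis
  moreover have "a + ereal r = \<infinity> \<longleftrightarrow> a = \<infinity>" for a r by (cases a) auto
  ultimately show ?thesis using 1(2,3) 2(2,3) by auto
qed

context
  assumes n2: "2 \<le> CARD('n::finite)"
begin

definition inf_coords :: "'n set \<times> 'n set set list \<times> 'n set set list \<Rightarrow> 'n set set \<times> 'n set set" where
  "inf_coords = (\<lambda>(S, Fs, Gs). (E_zero S \<union> (hd Fs \<union> hd Gs), (\<lambda>i. - {i}) ` S))"

lemma flag_cone_stratum:
  assumes "t \<in> flag_chain_pairs" "inf_coords t = (P, Q)"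
  shows "flag_cone t \<subseteq> stratum hyp2 hyp1 P Q" "flag_cone t \<noteq> {}"
proof -
  obtain S Fs Gs where t: "t = (S, Fs, Gs)" by (cases t) auto
  have PQ: "P = E_zero S \<union> (hd Fs \<union> hd Gs)" "Q = (\<lambda>i. - {i}) ` S"
    using assms(2) by (simp_all add: t inf_coords_def)
  note R = flag_point_tp_reps[OF n2 assms(1)[unfolded t]]
  show "flag_cone t \<subseteq> stratum hyp2 hyp1 P Q"
  proof
    fix p assume "p \<in> flag_cone t"
    then obtain \<alpha> \<kappa> c where "p = (tp_class (flag_u S (hd Fs \<union> hd Gs) (tails Fs Gs) \<alpha> \<kappa> c), tp_class (flag_v S \<alpha>))"
      unfolding t flag_cone_eq by blast
    then show "p \<in> stratum hyp2 hyp1 P Q"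
      unfolding stratum_def PQ mem_Collect_eq using R by blast
  qed
  have "(tp_class (flag_u S (hd Fs \<union> hd Gs) (tails Fs Gs) (\<lambda>_. 0) (\<lambda>_. 0) 0), tp_class (flag_v S (\<lambda>_. 0)))
      \<in> flag_cone t"
    unfolding t flag_cone_eq mem_Collect_eq
    by (intro exI[of _ "\<lambda>_. 0"] exI[of _ 0]) simp
  then show "flag_cone t \<noteq> {}" by blast
qed

text \<open>
  The set \<open>S\<close> is visible in the second component, and the two heads are the intersections of the first
  component with the disjoint sets of inner and leaving edges.
\<close>

lemma inf_coords_inj:
  assumes t: "(S, Fs, Gs) \<in> flag_chain_pairs" "(S', Fs', Gs') \<in> flag_chain_pairs"
    and eq: "inf_coords (S, Fs, Gs) = inf_coords (S', Fs', Gs')"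
  shows "S = S'" "hd Fs = hd Fs'" "hd Gs = hd Gs'"
proof -
  have "(\<lambda>i. - {i}) ` S = (\<lambda>i. - {i}) ` S'" using eq by (simp add: inf_coords_def)
  moreover have "inj (\<lambda>i :: 'n. - {i})" by (auto intro!: injI)
  ultimately show S: "S = S'" by (simp add: inj_image_eq_iff)
  have P: "E_zero S \<union> (hd Fs \<union> hd Gs) = E_zero S \<union> (hd Fs' \<union> hd Gs')"
    using eq S by (simp add: inf_coords_def)
  note E = hyp2_partition[OF n2, of S]
  have h: "hd Fs \<subseteq> E_full S" "hd Gs \<subseteq> E_hat S" "hd Fs' \<subseteq> E_full S" "hd Gs' \<subseteq> E_hat S"
    using chain_pair_tails(3,4)[OF n2 flag_pairD(2,3)[OF n2 t(1)]]
      chain_pair_tails(3,4)[OF n2 flag_pairD(2,3)[OF n2 t(2)]] S by auto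
  have "hd Fs = (E_zero S \<union> (hd Fs \<union> hd Gs)) \<inter> E_full S" "hd Fs' = (E_zero S \<union> (hd Fs' \<union> hd Gs')) \<inter> E_full S"
    "hd Gs = (E_zero S \<union> (hd Fs \<union> hd Gs)) \<inter> E_hat S" "hd Gs' = (E_zero S \<union> (hd Fs' \<union> hd Gs')) \<inter> E_hat S"
    using h E(2-4) by blast+
  then show "hd Fs = hd Fs'" "hd Gs = hd Gs'" using P by metis+
qed

text \<open>
  An element of the lineality space with trivial second component has constant \<open>\<alpha>\<close>, hence is constant on
  the finite inner edges and on the finite leaving edges.  On each of the two sets of edges, the gap
  function therefore takes the same values on both combinations.
\<close>

lemma ray_coefficients_unique:
  fixes S :: "'n set"
  assumes t: "(S, Fs, Gs) \<in> flag_chain_pairs" "(S, Fs', Gs') \<in> flag_chain_pairs"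
    and hd: "hd Fs' = hd Fs" "hd Gs' = hd Gs"
    and pos: "\<And>F. 0 \<le> \<kappa> F" "\<And>F. 0 \<le> \<mu> F"
    and diff: "(\<Sum>F\<in>tails Fs Gs. \<kappa> F *\<^sub>R ray S (hd Fs \<union> hd Gs) F)
       - (\<Sum>F\<in>tails Fs' Gs'. \<mu> F *\<^sub>R ray S (hd Fs \<union> hd Gs) F) \<in> lineality S (hd Fs \<union> hd Gs)"
    and F: "F \<in> tails Fs Gs"
  shows "if F \<in> tails Fs' Gs' then \<kappa> F = \<mu> F else \<kappa> F = 0"
proof -
  let ?I = "hd Fs \<union> hd Gs"
  note P = flag_pairD[OF n2 t(1)] and P' = flag_pairD[OF n2 t(2)]
  note T = chain_pair_tails[OF n2 P(2,3)] and T' = chain_pair_tails[OF n2 P'(2,3)]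
  note E = hyp2_partition[OF n2, of S]
  note ts = tails_sum[OF n2 P(2,3)] and ts' = tails_sum[OF n2 P'(2,3)]
  obtain \<alpha> c c' where eq: "(\<Sum>F\<in>tails Fs Gs. \<kappa> F *\<^sub>R ray S ?I F) - (\<Sum>F\<in>tails Fs' Gs'. \<mu> F *\<^sub>R ray S ?I F)
    = (\<chi> J. if J \<in> hyp2 - (E_zero S \<union> ?I) then lin_coord S \<alpha> J + c else 0,
       \<chi> I. if \<exists>i\<in>- S. I = - {i} then (\<Sum>i\<in>- S. if I = - {i} then \<alpha> i else 0) + c' else 0)"
    (is "?l = ?r") using diff unfolding lineality_def by blast
  have fst_eq: "(\<Sum>F\<in>tails Fs Gs. if J \<in> F then \<kappa> F else 0)
      = (lin_coord S \<alpha> J + c) + (\<Sum>F\<in>tails Fs' Gs'. if J \<in> F then \<mu> F else 0)"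
    if J: "J \<in> hyp2 - (E_zero S \<union> ?I)" for J
  proof -
    have "vec_nth (fst ?l) J = vec_nth (fst ?r) J" unfolding eq ..
    then show ?thesis
      unfolding fst_diff vector_minus_component fst_sum_ray using J by simp
  qed
  have \<alpha>: "\<alpha> i = - c'" if i: "i \<notin> S" for i
  proof -
    have "vec_nth (snd ?l) (- {i}) = vec_nth (snd ?r) (- {i})" unfolding eq ..
    then have "0 = (\<Sum>j\<in>- S. if i = j then \<alpha> j else 0) + c'"
      unfolding snd_diff vector_minus_component snd_sum_ray using i by simp
    then show ?thesis using i by simp
  qed
  have lc: "lin_coord S \<alpha> J = - (real (card (- S - J)) * c')" for J
    by (simp add: lin_coord_def \<alpha>)
  consider "F \<in> set (tl Fs)" | "F \<in> set (tl Gs)" using F by (auto simp: tails_def)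
  then show ?thesis
  proof cases
    case 1
    have xJ: "(\<Sum>F\<in>set (tl Fs). if J \<in> F then \<kappa> F else 0)
        = (c - 2 * c') + (\<Sum>F\<in>set (tl Fs'). if J \<in> F then \<mu> F else 0)" if J: "J \<in> E_full S - hd Fs" for J
    proof -
      have J': "J \<in> hyp2 - (E_zero S \<union> ?I)" "J \<in> E_full S" using J E T(4) by blast+
      then have "J \<in> hyp2" by simp
      then obtain i j where ij: "i \<noteq> j" "J = - {i, j}" by (rule hyp2_cases[OF n2])
      then have "i \<notin> S" "j \<notin> S" using J'(2) edge_in_E_full_iff[OF n2, of i j S] by auto
      then have "- S - J = {i, j}" using ij by auto
      then have "lin_coord S \<alpha> J = - 2 * c'" using ij lc[of J] by simp
      then show ?thesis using fst_eq[OF J'(1)] ts(1)[OF J'(2), of \<kappa>] ts'(1)[OF J'(2), of \<mu>] by simp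
    qed
    let ?x = "\<lambda>J. \<Sum>F\<in>set (tl Fs). if J \<in> F then \<kappa> F else 0"
    have FF: "hd Fs \<subset> F" "F \<subset> E_full S" using T(1)[OF 1] by auto
    have "gap (E_full S) (hd Fs) ?x F = (if F \<in> set (tl Fs) then \<kappa> F else 0)"
      by (rule gap_of_chain_sum[where c = 0])
        (use T(1) pos FF chain_of_flatsD(6)[OF P(2)] in auto)
    moreover have "gap (E_full S) (hd Fs) ?x F = (if F \<in> set (tl Fs') then \<mu> F else 0)"
      by (rule gap_of_chain_sum[where c = "c - 2 * c'"])
        (use T'(1) pos FF chain_of_flatsD(6)[OF P'(2)] hd xJ in auto)
    moreover have "F \<in> tails Fs' Gs' \<longleftrightarrow> F \<in> set (tl Fs')"
      unfolding T'(6) using FF by auto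
    ultimately show ?thesis using 1 by (simp split: if_splits)
  next
    case 2
    have xJ: "(\<Sum>F\<in>set (tl Gs). if J \<in> F then \<kappa> F else 0)
        = (c - c') + (\<Sum>F\<in>set (tl Gs'). if J \<in> F then \<mu> F else 0)" if J: "J \<in> E_hat S - hd Gs" for J
    proof -
      have J': "J \<in> hyp2 - (E_zero S \<union> ?I)" "J \<in> E_hat S" using J E T(3) by blast+
      then have "J \<in> hyp2" by simp
      then obtain i j where ij: "i \<noteq> j" "J = - {i, j}" by (rule hyp2_cases[OF n2])
      then have "(i \<in> S) \<noteq> (j \<in> S)" using J'(2) edge_in_E_hat_iff[OF n2, of i j S] by auto
      then have "- S - J = {i} \<or> - S - J = {j}" using ij by auto
      then have "lin_coord S \<alpha> J = - c'" using lc[of J] by auto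
      then show ?thesis using fst_eq[OF J'(1)] ts(2)[OF J'(2), of \<kappa>] ts'(2)[OF J'(2), of \<mu>] by simp
    qed
    let ?x = "\<lambda>J. \<Sum>F\<in>set (tl Gs). if J \<in> F then \<kappa> F else 0"
    have FF: "hd Gs \<subset> F" "F \<subset> E_hat S" using T(2)[OF 2] by auto
    have "gap (E_hat S) (hd Gs) ?x F = (if F \<in> set (tl Gs) then \<kappa> F else 0)"
      by (rule gap_of_chain_sum[where c = 0])
        (use T(2) pos FF chain_of_flatsD(6)[OF P(3)] in auto)
    moreover have "gap (E_hat S) (hd Gs) ?x F = (if F \<in> set (tl Gs') then \<mu> F else 0)"
      by (rule gap_of_chain_sum[where c = "c - c'"])
        (use T'(2) pos FF chain_of_flatsD(6)[OF P'(3)] hd xJ in auto)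
    moreover have "F \<in> tails Fs' Gs' \<longleftrightarrow> F \<in> set (tl Gs')"
      unfolding T'(7) using FF by auto
    ultimately show ?thesis using 2 by (simp split: if_splits)
  qed
qed

lemma chain_of_flats_subchain:
  assumes "chain_of_flats M Fs"
  shows "chain_of_flats M (hd Fs # filter Q (tl Fs))"
proof -
  note C = chain_of_flatsD[OF assms]
  have "sorted_wrt (\<subset>) Fs" using assms unfolding chain_of_flats_iff by simp
  then have "sorted_wrt (\<subset>) (hd Fs # tl Fs)" using C(1) by simp
  then show ?thesis unfolding chain_of_flats_iff using C(2,4) by (auto intro: sorted_wrt_filter)
qed

text \<open>
  The simplicial complex underlying a stratum: its simplices are the sets of flats that can follow
  the two prescribed heads.
\<close>

definition stratum_complex :: "'n set \<Rightarrow> 'n set set \<Rightarrow> 'n set set \<Rightarrow> 'n set set set set" where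
  "stratum_complex S F0 G0 = {tails Fs Gs | Fs Gs. (S, Fs, Gs) \<in> flag_chain_pairs \<and> hd Fs = F0 \<and> hd Gs = G0}"

lemma simplicial_fan_stratum:
  assumes t: "(S, Fs, Gs) \<in> flag_chain_pairs"
  shows "simplicial_fan (lineality S (hd Fs \<union> hd Gs)) (ray S (hd Fs \<union> hd Gs)) (stratum_complex S (hd Fs) (hd Gs))"
proof
  show "subspace (lineality S (hd Fs \<union> hd Gs))" by (rule subspace_lineality)
  show "finite (stratum_complex S (hd Fs) (hd Gs))" by simp
  show "stratum_complex S (hd Fs) (hd Gs) \<noteq> {}" using t unfolding stratum_complex_def by blast
  show "finite A" for A :: "'n set set set" by simp
  fix A B assume A: "A \<in> stratum_complex S (hd Fs) (hd Gs)"
  obtain Fs1 Gs1 where 1: "A = tails Fs1 Gs1" "(S, Fs1, Gs1) \<in> flag_chain_pairs" "hd Fs1 = hd Fs" "hd Gs1 = hd Gs"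
    using A unfolding stratum_complex_def by blast
  {
    assume BA: "B \<subseteq> A"
    let ?Fs = "hd Fs1 # filter (\<lambda>F. F \<in> B) (tl Fs1)" and ?Gs = "hd Gs1 # filter (\<lambda>F. F \<in> B) (tl Gs1)"
    note P = flag_pairD[OF n2 1(2)]
    have c: "chain_of_flats (M_full S) ?Fs" "chain_of_flats (M_hat S) ?Gs"
      using P(2,3) by (auto intro: chain_of_flats_subchain)
    have "(S, ?Fs, ?Gs) \<in> flag_chain_pairs"
      using P c exceptional_chain_iff[OF c(1)] exceptional_chain_iff[OF c(2)]
      by (auto simp: flag_chain_pairs_def ground_M_full[OF n2] ground_M_hat[OF n2])
    moreover have "tails ?Fs ?Gs = B" using BA 1(1) by (auto simp: tails_def)
    moreover have "hd ?Fs = hd Fs" "hd ?Gs = hd Gs" using 1 by simp_all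
    ultimately show "B \<in> stratum_complex S (hd Fs) (hd Gs)" unfolding stratum_complex_def by blast
  }
  fix \<kappa> \<mu> :: "'n set set \<Rightarrow> real" and b
  assume B: "B \<in> stratum_complex S (hd Fs) (hd Gs)" and pos: "\<And>b. 0 \<le> \<kappa> b" "\<And>b. 0 \<le> \<mu> b"
    and diff: "(\<Sum>b\<in>A. \<kappa> b *\<^sub>R ray S (hd Fs \<union> hd Gs) b) - (\<Sum>b\<in>B. \<mu> b *\<^sub>R ray S (hd Fs \<union> hd Gs) b)
      \<in> lineality S (hd Fs \<union> hd Gs)" and b: "b \<in> A"
  obtain Fs2 Gs2 where 2: "B = tails Fs2 Gs2" "(S, Fs2, Gs2) \<in> flag_chain_pairs" "hd Fs2 = hd Fs" "hd Gs2 = hd Gs"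
    using B unfolding stratum_complex_def by blast
  show "if b \<in> B then \<kappa> b = \<mu> b else \<kappa> b = 0"
    unfolding 2(1)
  proof (rule ray_coefficients_unique[OF 1(2) 2(2)])
    show "hd Fs2 = hd Fs1" "hd Gs2 = hd Gs1" using 1 2 by simp_all
    show "b \<in> tails Fs1 Gs1" using b 1(1) by simp
    show "(\<Sum>F\<in>tails Fs1 Gs1. \<kappa> F *\<^sub>R ray S (hd Fs1 \<union> hd Gs1) F)
       - (\<Sum>F\<in>tails Fs2 Gs2. \<mu> F *\<^sub>R ray S (hd Fs1 \<union> hd Gs1) F) \<in> lineality S (hd Fs1 \<union> hd Gs1)"
      using diff unfolding 1(1,3,4) 2(1) .
  qed (rule pos)+
qed

text \<open>
  The infinite coordinates give \<open>S\<close> and the heads, the cone in the stratum gives the set of flats in the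
  tails, and a chain is determined by the set of its members.
\<close>

lemma flag_cone_inj: "inj_on flag_cone (flag_chain_pairs :: ('n set \<times> 'n set set list \<times> 'n set set list) set)"
proof (rule inj_onI)
  fix t t' :: "'n set \<times> 'n set set list \<times> 'n set set list"
  assume tt: "t \<in> flag_chain_pairs" "t' \<in> flag_chain_pairs" and eq: "flag_cone t = flag_cone t'"
  obtain S Fs Gs where t: "t = (S, Fs, Gs)" by (cases t) auto
  obtain S' Fs' Gs' where t': "t' = (S', Fs', Gs')" by (cases t') auto
  obtain P Q where PQ: "inf_coords t = (P, Q)" by fastforce
  obtain P' Q' where PQ': "inf_coords t' = (P', Q')" by fastforce
  obtain p where p: "p \<in> flag_cone t" using flag_cone_stratum(2)[OF tt(1) PQ] by blast
  have "p \<in> stratum hyp2 hyp1 P Q" using flag_cone_stratum(1)[OF tt(1) PQ] p by blast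
  moreover have "p \<in> stratum hyp2 hyp1 P' Q'" using flag_cone_stratum(1)[OF tt(2) PQ'] p eq by blast
  ultimately have "inf_coords (S, Fs, Gs) = inf_coords (S', Fs', Gs')"
    using stratum_unique PQ PQ' t t' by metis
  note h = inf_coords_inj[OF tt[unfolded t t'] this]
  interpret simplicial_fan "lineality S (hd Fs \<union> hd Gs)" "ray S (hd Fs \<union> hd Gs)" "stratum_complex S (hd Fs) (hd Gs)"
    by (rule simplicial_fan_stratum) (use tt t in simp)
  have "cone_of (tails Fs Gs) = cone_of (tails Fs' Gs')"
    using arg_cong[OF eq, of finite_part] unfolding t t' finite_part_flag_cone h .
  moreover have "tails Fs Gs \<in> stratum_complex S (hd Fs) (hd Gs)"
    using tt(1) unfolding t stratum_complex_def by blast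
  moreover have "tails Fs' Gs' \<in> stratum_complex S (hd Fs) (hd Gs)"
    using tt(2) unfolding t' stratum_complex_def h by blast
  ultimately have tails: "tails Fs Gs = tails Fs' Gs'" using inj_on_cone_of by (meson inj_onD)
  note P = flag_pairD[OF n2 tt(1)[unfolded t]] and P' = flag_pairD[OF n2 tt(2)[unfolded t']]
  have "set (tl Fs) = set (tl Fs')" "set (tl Gs) = set (tl Gs')"
    using chain_pair_tails(6,7)[OF n2 P(2,3)] chain_pair_tails(6,7)[OF n2 P'(2,3)] tails h by simp_all
  then have "set Fs = set Fs'" "set Gs = set Gs'"
    using chain_of_flatsD(7)[OF P(2)] chain_of_flatsD(7)[OF P(3)]
      chain_of_flatsD(7)[OF P'(2)] chain_of_flatsD(7)[OF P'(3)] h by simp_all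
  moreover have "sorted_wrt (\<subset>) Fs" "sorted_wrt (\<subset>) Gs" "sorted_wrt (\<subset>) Fs'" "sorted_wrt (\<subset>) Gs'"
    using P(2,3) P'(2,3) unfolding chain_of_flats_iff by simp_all
  ultimately have "Fs = Fs'" "Gs = Gs'" using sorted_wrt_psubset_unique by blast+
  then show "t = t'" using t t' h by simp
qed

lemma is_fan_stratum:
  assumes ne: "(\<Union>t\<in>flag_chain_pairs. flag_cone t) \<inter> stratum hyp2 hyp1 P Q \<noteq> {}"
  shows "is_fan (finite_part ` {C \<in> flag_cone ` (flag_chain_pairs :: ('n set \<times> 'n set set list \<times> 'n set set list) set).
    C \<subseteq> stratum hyp2 hyp1 P Q})"
proof -
  obtain t p where tp: "t \<in> flag_chain_pairs" "p \<in> flag_cone t" "p \<in> stratum hyp2 hyp1 P Q"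
    using ne by blast
  obtain S Fs Gs where t: "t = (S, Fs, Gs)" by (cases t) auto
  note tt = tp(1)[unfolded t]
  have PQ_iff: "flag_cone s \<subseteq> stratum hyp2 hyp1 P Q \<longleftrightarrow> inf_coords s = (P, Q)"
    if s: "s \<in> flag_chain_pairs" for s
  proof
    assume le: "flag_cone s \<subseteq> stratum hyp2 hyp1 P Q"
    obtain P' Q' where PQ': "inf_coords s = (P', Q')" by fastforce
    obtain q where q: "q \<in> flag_cone s" using flag_cone_stratum(2)[OF s PQ'] by blast
    have "q \<in> stratum hyp2 hyp1 P Q" "q \<in> stratum hyp2 hyp1 P' Q'"
      using le q flag_cone_stratum(1)[OF s PQ'] by blast+
    then show "inf_coords s = (P, Q)" using stratum_unique PQ' by metis
  qed (rule flag_cone_stratum(1)[OF s])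
  have t_PQ: "inf_coords t = (P, Q)"
  proof -
    obtain P' Q' where PQ': "inf_coords t = (P', Q')" by fastforce
    have "p \<in> stratum hyp2 hyp1 P' Q'" using tp(2) flag_cone_stratum(1)[OF tp(1) PQ'] by blast
    then show ?thesis using stratum_unique tp(3) PQ' by metis
  qed
  interpret simplicial_fan "lineality S (hd Fs \<union> hd Gs)" "ray S (hd Fs \<union> hd Gs)" "stratum_complex S (hd Fs) (hd Gs)"
    by (rule simplicial_fan_stratum[OF tt])
  have "finite_part ` {C \<in> flag_cone ` flag_chain_pairs. C \<subseteq> stratum hyp2 hyp1 P Q}
      = cone_of ` stratum_complex S (hd Fs) (hd Gs)"
  proof (intro equalityI subsetI)
    fix K assume "K \<in> finite_part ` {C \<in> flag_cone ` flag_chain_pairs. C \<subseteq> stratum hyp2 hyp1 P Q}"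
    then obtain s where s: "s \<in> flag_chain_pairs" "flag_cone s \<subseteq> stratum hyp2 hyp1 P Q" "K = finite_part (flag_cone s)"
      by blast
    obtain S' Fs' Gs' where s': "s = (S', Fs', Gs')" by (cases s) auto
    have "inf_coords (S, Fs, Gs) = inf_coords (S', Fs', Gs')"
      using PQ_iff[OF s(1)] s(2) t_PQ t s' by simp
    note h = inf_coords_inj[OF tt s(1)[unfolded s'] this]
    have "K = cone_of (tails Fs' Gs')" unfolding s(3) s' finite_part_flag_cone h ..
    moreover have "tails Fs' Gs' \<in> stratum_complex S (hd Fs) (hd Gs)"
      using s(1) unfolding s' stratum_complex_def h by blast
    ultimately show "K \<in> cone_of ` stratum_complex S (hd Fs) (hd Gs)" by blast
  next
    fix K assume "K \<in> cone_of ` stratum_complex S (hd Fs) (hd Gs)"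
    then obtain Fs' Gs' where s: "(S, Fs', Gs') \<in> flag_chain_pairs" "hd Fs' = hd Fs" "hd Gs' = hd Gs"
      "K = cone_of (tails Fs' Gs')" unfolding stratum_complex_def by blast
    have "inf_coords (S, Fs', Gs') = (P, Q)" using t_PQ s(2,3) by (simp add: t inf_coords_def)
    then have "flag_cone (S, Fs', Gs') \<subseteq> stratum hyp2 hyp1 P Q" using PQ_iff[OF s(1)] by simp
    moreover have "K = finite_part (flag_cone (S, Fs', Gs'))"
      unfolding finite_part_flag_cone s(2-4) ..
    ultimately show "K \<in> finite_part ` {C \<in> flag_cone ` flag_chain_pairs. C \<subseteq> stratum hyp2 hyp1 P Q}"
      using s(1) by blast
  qed
  then show ?thesis using is_fan by simp
qed

end

theorem theorem43:
  fixes val :: "'k::alg_closed_field \<Rightarrow> ereal"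
  assumes "nonarch_valuation val" and "nontrivial_valuation val"
    and "3 \<le> CARD('n::{finite,linorder})"
  shows "trop val hyp2 hyp1 (Fl_short :: (('n set \<Rightarrow> 'k) \<times> ('n set \<Rightarrow> 'k)) set)
           = (\<Union>t\<in>flag_chain_pairs. flag_cone t)
       \<and> bij_betw flag_cone (flag_chain_pairs :: ('n set \<times> 'n set set list \<times> 'n set set list) set)
           (flag_cone ` flag_chain_pairs)
       \<and> (\<forall>P Q. trop val hyp2 hyp1 (Fl_short :: (('n set \<Rightarrow> 'k) \<times> ('n set \<Rightarrow> 'k)) set)
                   \<inter> stratum hyp2 hyp1 P Q \<noteq> {} \<longrightarrow>
              is_fan (finite_part ` {C \<in> flag_cone ` flag_chain_pairs. C \<subseteq> stratum hyp2 hyp1 P Q}))"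
proof -
  have n2: "2 \<le> CARD('n)" using assms(3) by simp
  interpret alg_closed_valued_field val by unfold_locales (rule assms(1))
  have trop: "trop val hyp2 hyp1 (Fl_short :: (('n set \<Rightarrow> 'k) \<times> ('n set \<Rightarrow> 'k)) set)
           = (\<Union>t\<in>flag_chain_pairs. flag_cone t)"
    unfolding trop_Fl_short[OF assms(3,2)] Union_flag_cones[OF n2] ..
  show ?thesis
  proof (intro conjI allI impI)
    show "trop val hyp2 hyp1 (Fl_short :: (('n set \<Rightarrow> 'k) \<times> ('n set \<Rightarrow> 'k)) set)
           = (\<Union>t\<in>flag_chain_pairs. flag_cone t)" by (rule trop)
    show "bij_betw flag_cone (flag_chain_pairs :: ('n set \<times> 'n set set list \<times> 'n set set list) set)
           (flag_cone ` flag_chain_pairs)"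
      using flag_cone_inj[OF n2] by (rule inj_on_imp_bij_betw)
    fix P Q
    assume "trop val hyp2 hyp1 (Fl_short :: (('n set \<Rightarrow> 'k) \<times> ('n set \<Rightarrow> 'k)) set)
                   \<inter> stratum hyp2 hyp1 P Q \<noteq> {}"
    then show "is_fan (finite_part ` {C \<in> flag_cone ` flag_chain_pairs. C \<subseteq> stratum hyp2 hyp1 P Q})"
      unfolding trop by (rule is_fan_stratum[OF n2])
  qed
qed

end
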